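(* Let $p$ be an odd prime, $n\ge1$, $K$ a field of characteristic zero containing a primitive $p^n$-th root of unity, and $L/K$ a cyclic Galois extension of degree $p^n$ with group $G=\langle\sigma\rangle$. For $0\le m\le n$ let $K_m$ be the unique intermediate field with $[K_m:K]=p^m$. Then for $0\le r<p^{n-1}$ there is an isomorphism of $K$-algebras $$H_r\cong K^{p^{1+v_p(r)}}\times\prod_{m=1}^{n-1-v_p(r)}(K_m)^{p^{v_p(r)}(p-1)},$$ where for $r=0$ one sets $v_p(r)=n-1$ (so that $H_0\cong K^{p^n}$).
   Context: $v_p$ is the $p$-adic valuation; $A^k$ denotes the product of $k$ copies of $A$. Let $N=\langle\eta\rangle$ be cyclic of order $p^n$ and $\delta\in\mathrm{Aut}(N)$ the $(p-1)$-th power of a generator of the cyclic group $\mathrm{Aut}(N)$. Let $\rho(\eta)\in\mathrm{Perm}(N)$ be $x\mapsto x\eta^{-1}$ and $\lambda_N(\nu)(x)=\nu x$. For $0\le s<p^{n-1}$ let $\beta_s:G\to\mathrm{Perm}(N)$ be the homomorphism with $\beta_s(\sigma)=\rho(\eta)\circ\delta^{s}$. Let $b_s:G\to N$, $b_s(g)=\beta_s(g)(1_N)$ (a bijection), and $\alpha_s:N\to\mathrm{Perm}(G)$, $\alpha_s(\nu)=b_s^{-1}\circ\lambda_N(\nu)\circ b_s$. Then $\alpha_s(N)$ is a regular subgroup of $\mathrm{Perm}(G)$ normalized by the left regular representation $\lambda(G)$, and $H_s=L[\alpha_s(N)]^G$, where $G$ acts on $L$ as Galois automorphisms and on $\alpha_s(N)$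 by $g\ast\nu=\lambda(g)\nu\lambda(g)^{-1}$. *)

theory Defs
  imports "HOL-Algebra.Algebra" "HOL-Computational_Algebra.Primes"
begin

section \<open>Fields\<close>

definition char_zero :: "('a, 'm) ring_scheme \<Rightarrow> bool"
  where "char_zero R \<longleftrightarrow> (\<forall>k::nat. 0 < k \<longrightarrow> [k] \<cdot>\<^bsub>R\<^esub> \<one>\<^bsub>R\<^esub> \<noteq> \<zero>\<^bsub>R\<^esub>)"

definition primitive_root_of_unity :: "('a, 'm) ring_scheme \<Rightarrow> nat \<Rightarrow> 'a \<Rightarrow> bool"
  where "primitive_root_of_unity R k \<zeta> \<longleftrightarrow>
    \<zeta> \<in> carrier R \<and> \<zeta> [^]\<^bsub>R\<^esub> k = \<one>\<^bsub>R\<^esub> \<and> (\<forall>j::nat. 0 < j \<and> j < k \<longrightarrow> \<zeta> [^]\<^bsub>R\<^esub> j \<noteq> \<one>\<^bsub>R\<^esub>)"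

definition Gal :: "('a, 'm) ring_scheme \<Rightarrow> 'a set \<Rightarrow> ('a \<Rightarrow> 'a) monoid"
  where "Gal L K = BijGroup (carrier L)
    \<lparr>carrier := {\<phi> \<in> Bij (carrier L). \<phi> \<in> ring_hom L L \<and> (\<forall>x\<in>K. \<phi> x = x)}\<rparr>"

definition finite_galois :: "('a, 'm) ring_scheme \<Rightarrow> 'a set \<Rightarrow> bool"
  where "finite_galois L K \<longleftrightarrow> field L \<and> subfield K L \<and>
    (\<exists>d. ring.dimension L d K (carrier L)) \<and>
    {x \<in> carrier L. \<forall>\<phi>\<in>carrier (Gal L K). \<phi> x = x} = K"

text \<open>The following is only meaningful when there is exactly one intermediate field of degree
  \<open>d\<close>, as is the case for cyclic extensions of degree divisible by \<open>d\<close>.\<close>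

definition intermediate_field :: "('a, 'm) ring_scheme \<Rightarrow> 'a set \<Rightarrow> nat \<Rightarrow> 'a set"
  where "intermediate_field L K d =
    (THE F. subfield F L \<and> K \<subseteq> F \<and> ring.dimension L d K F)"


section \<open>Algebras over a commutative ring\<close>

definition field_alg :: "('a, 'm) ring_scheme \<Rightarrow> 'a set \<Rightarrow> ('a, 'a) module"
  where "field_alg L F =
    \<lparr>carrier = F, monoid.mult = (\<otimes>\<^bsub>L\<^esub>), one = \<one>\<^bsub>L\<^esub>, ring.zero = \<zero>\<^bsub>L\<^esub>, ring.add = (\<oplus>\<^bsub>L\<^esub>), smult = (\<otimes>\<^bsub>L\<^esub>)\<rparr>"

definition alg_times :: "('k, 'a, 'm) module_scheme \<Rightarrow> ('k, 'b, 'n) module_scheme \<Rightarrow> ('k, 'a \<times> 'b) module"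
  where "alg_times A B =
    \<lparr>carrier = carrier A \<times> carrier B,
     monoid.mult = (\<lambda>(a, b) (a', b'). (a \<otimes>\<^bsub>A\<^esub> a', b \<otimes>\<^bsub>B\<^esub> b')),
     one = (\<one>\<^bsub>A\<^esub>, \<one>\<^bsub>B\<^esub>),
     ring.zero = (\<zero>\<^bsub>A\<^esub>, \<zero>\<^bsub>B\<^esub>),
     ring.add = (\<lambda>(a, b) (a', b'). (a \<oplus>\<^bsub>A\<^esub> a', b \<oplus>\<^bsub>B\<^esub> b')),
     smult = (\<lambda>k (a, b). (k \<odot>\<^bsub>A\<^esub> a, k \<odot>\<^bsub>B\<^esub> b))\<rparr>"

definition alg_prod :: "'i set \<Rightarrow> ('i \<Rightarrow> ('k, 'a, 'm) module_scheme) \<Rightarrow> ('k, 'i \<Rightarrow> 'a) module"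
  where "alg_prod I A =
    \<lparr>carrier = (\<Pi>\<^sub>E i\<in>I. carrier (A i)),
     monoid.mult = (\<lambda>x y. \<lambda>i\<in>I. x i \<otimes>\<^bsub>A i\<^esub> y i),
     one = (\<lambda>i\<in>I. \<one>\<^bsub>A i\<^esub>),
     ring.zero = (\<lambda>i\<in>I. \<zero>\<^bsub>A i\<^esub>),
     ring.add = (\<lambda>x y. \<lambda>i\<in>I. x i \<oplus>\<^bsub>A i\<^esub> y i),
     smult = (\<lambda>k x. \<lambda>i\<in>I. k \<odot>\<^bsub>A i\<^esub> x i)\<rparr>"

definition alg_power :: "('k, 'a, 'm) module_scheme \<Rightarrow> nat \<Rightarrow> ('k, nat \<Rightarrow> 'a) module"
  where "alg_power A k = alg_prod {..<k} (\<lambda>_. A)"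

definition alg_isomorphic ::
    "('k, 'l) ring_scheme \<Rightarrow> ('k, 'a, 'm) module_scheme \<Rightarrow> ('k, 'b, 'n) module_scheme \<Rightarrow> bool"
  where "alg_isomorphic R A B \<longleftrightarrow> algebra R A \<and> algebra R B \<and>
    (\<exists>h \<in> ring_iso A B. \<forall>k\<in>carrier R. \<forall>x\<in>carrier A. h (k \<odot>\<^bsub>A\<^esub> x) = k \<odot>\<^bsub>B\<^esub> h x)"


section \<open>Group algebras and descent\<close>

text \<open>Only for finite \<open>M\<close>: the element \<open>\<Sum>\<^sub>x c\<^sub>x x\<close> of \<open>L[M]\<close> is the function \<open>x \<mapsto> c\<^sub>x\<close>, and the
  multiplication is convolution.\<close>

definition group_alg :: "('a, 'm) ring_scheme \<Rightarrow> ('g, 'n) monoid_scheme \<Rightarrow> ('a, 'g \<Rightarrow> 'a) module"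
  where "group_alg L M =
    \<lparr>carrier = carrier M \<rightarrow>\<^sub>E carrier L,
     monoid.mult = (\<lambda>f g. \<lambda>x\<in>carrier M.
       \<Oplus>\<^bsub>L\<^esub> y\<in>carrier M. f y \<otimes>\<^bsub>L\<^esub> g (inv\<^bsub>M\<^esub> y \<otimes>\<^bsub>M\<^esub> x)),
     one = (\<lambda>x\<in>carrier M. if x = \<one>\<^bsub>M\<^esub> then \<one>\<^bsub>L\<^esub> else \<zero>\<^bsub>L\<^esub>),
     ring.zero = (\<lambda>x\<in>carrier M. \<zero>\<^bsub>L\<^esub>),
     ring.add = (\<lambda>f g. \<lambda>x\<in>carrier M. f x \<oplus>\<^bsub>L\<^esub> g x),
     smult = (\<lambda>k f. \<lambda>x\<in>carrier M. k \<otimes>\<^bsub>L\<^esub> f x)\<rparr>"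

definition left_reg :: "('g, 'm) monoid_scheme \<Rightarrow> 'g \<Rightarrow> 'g \<Rightarrow> 'g"
  where "left_reg G g = (\<lambda>x\<in>carrier G. g \<otimes>\<^bsub>G\<^esub> x)"

definition right_reg :: "('g, 'm) monoid_scheme \<Rightarrow> 'g \<Rightarrow> 'g \<Rightarrow> 'g"
  where "right_reg G g = (\<lambda>x\<in>carrier G. x \<otimes>\<^bsub>G\<^esub> inv\<^bsub>G\<^esub> g)"

definition conj_act :: "('g, 'm) monoid_scheme \<Rightarrow> 'g \<Rightarrow> ('g \<Rightarrow> 'g) \<Rightarrow> 'g \<Rightarrow> 'g"
  where "conj_act G g \<pi> =
    left_reg G g \<otimes>\<^bsub>BijGroup (carrier G)\<^esub> \<pi> \<otimes>\<^bsub>BijGroup (carrier G)\<^esub> inv\<^bsub>BijGroup (carrier G)\<^esub> left_reg G g"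

text \<open>For \<open>G\<close> a group of automorphisms of \<open>L\<close> and \<open>P\<close> a set of permutations of \<open>G\<close> stable under
  \<open>conj_act\<close>, the element \<open>g\<close> sends \<open>\<Sum>\<^sub>\<pi> c\<^sub>\<pi> \<pi>\<close> to \<open>\<Sum>\<^sub>\<pi> g(c\<^sub>\<pi>) (g * \<pi>)\<close>, so the coefficient of the
  image at \<open>\<pi>\<close> is \<open>g\<close> applied to the coefficient at \<open>g\<inverse> * \<pi>\<close>.\<close>

definition semilinear_act ::
    "('a \<Rightarrow> 'a, 'm) monoid_scheme \<Rightarrow> (('a \<Rightarrow> 'a) \<Rightarrow> 'a \<Rightarrow> 'a) set \<Rightarrow> ('a \<Rightarrow> 'a)
      \<Rightarrow> ((('a \<Rightarrow> 'a) \<Rightarrow> 'a \<Rightarrow> 'a) \<Rightarrow> 'a) \<Rightarrow> (('a \<Rightarrow> 'a) \<Rightarrow> 'a \<Rightarrow> 'a) \<Rightarrow> 'a"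
  where "semilinear_act G P g f = (\<lambda>\<pi>\<in>P. g (f (conj_act G (inv\<^bsub>G\<^esub> g) \<pi>)))"

definition descent_alg ::
    "('a, 'l) ring_scheme \<Rightarrow> ('a \<Rightarrow> 'a, 'm) monoid_scheme \<Rightarrow> (('a \<Rightarrow> 'a) \<Rightarrow> 'a \<Rightarrow> 'a) set
      \<Rightarrow> ('a, (('a \<Rightarrow> 'a) \<Rightarrow> 'a \<Rightarrow> 'a) \<Rightarrow> 'a) module"
  where "descent_alg L G P =
    (let A = group_alg L (BijGroup (carrier G)\<lparr>carrier := P\<rparr>)
     in A\<lparr>carrier := {f \<in> carrier A. \<forall>g\<in>carrier G. semilinear_act G P g f = f}\<rparr>)"


section \<open>The regular subgroups\<close>

context
  fixes N :: "('c, 'n) monoid_scheme" and \<eta> :: 'c and \<delta> :: "'c \<Rightarrow> 'c"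
    and G :: "('g, 'm) monoid_scheme" and \<sigma> :: 'g
begin

definition beta :: "nat \<Rightarrow> 'g \<Rightarrow> 'c \<Rightarrow> 'c"
  where "beta s = (THE \<beta>. \<beta> \<in> hom G (BijGroup (carrier N)) \<and> \<beta> \<in> extensional (carrier G) \<and>
    \<beta> \<sigma> = right_reg N \<eta> \<otimes>\<^bsub>BijGroup (carrier N)\<^esub> (\<delta> [^]\<^bsub>AutoGroup N\<^esub> s))"

definition bmap :: "nat \<Rightarrow> 'g \<Rightarrow> 'c"
  where "bmap s g = beta s g \<one>\<^bsub>N\<^esub>"

definition alpha :: "nat \<Rightarrow> 'c \<Rightarrow> 'g \<Rightarrow> 'g"
  where "alpha s \<nu> = (\<lambda>g\<in>carrier G. inv_into (carrier G) (bmap s) (left_reg N \<nu> (bmap s g)))"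

end

definition hopf_alg ::
    "('a, 'l) ring_scheme \<Rightarrow> ('a \<Rightarrow> 'a, 'm) monoid_scheme \<Rightarrow> ('a \<Rightarrow> 'a)
      \<Rightarrow> ('c, 'n) monoid_scheme \<Rightarrow> 'c \<Rightarrow> ('c \<Rightarrow> 'c) \<Rightarrow> nat
      \<Rightarrow> ('a, (('a \<Rightarrow> 'a) \<Rightarrow> 'a \<Rightarrow> 'a) \<Rightarrow> 'a) module"
  where "hopf_alg L G \<sigma> N \<eta> \<delta> s = descent_alg L G (alpha N \<eta> \<delta> G \<sigma> s ` carrier N)"

definition val :: "nat \<Rightarrow> nat \<Rightarrow> nat \<Rightarrow> nat"
  where "val p n r = (if r = 0 then n - 1 else multiplicity p r)"

end

theory Submission
  imports Defs "HOL-Number_Theory.Residues"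
begin

text \<open>
  Identify \<open>N\<close> with \<open>\<int>/p\<^sup>n\<close> and let \<open>\<delta>\<^sup>r\<close> be multiplication by \<open>d\<close>. An element of the group algebra
  lies in \<open>H\<^sub>r\<close> iff its coefficients satisfy \<open>\<sigma>(f(i)) = f(d i)\<close>. As \<open>K\<close> contains the \<open>p\<^sup>n\<close>-th roots of
  unity, the discrete Fourier transform turns convolution into the pointwise product and this
  condition into \<open>F(D j) = \<sigma>(F(j))\<close>, where \<open>D\<close> is the inverse of \<open>d\<close> modulo \<open>p\<^sup>n\<close>. Hence \<open>F\<close> is given
  by one value for each orbit of \<open>D\<close> on \<open>\<int>/p\<^sup>n\<close>, and for an orbit of length \<open>p\<^sup>m\<close> this value is an
  arbitrary element of the fixed field of \<open>\<sigma>\<^bsup>p^m\<^esup>\<close>, which is \<open>K\<^sub>m\<close>. With \<open>e = 1 + v\<^sub>p(r)\<close>, lifting the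
  exponent gives \<open>v\<^sub>p(D - 1) = e\<close> (or \<open>D = 1\<close> if \<open>r = 0\<close>), so \<open>D\<close> generates the classes congruent to 1
  modulo \<open>p\<^sup>e\<close>, and the orbits are represented by \<open>p\<^bsup>n-e-m\<^esup> u\<close> with \<open>u < p\<^sup>e\<close>, where \<open>u\<close> is prime to \<open>p\<close>
  if \<open>m > 0\<close>.
\<close>


section \<open>Cyclic groups with a chosen generator\<close>

text \<open>The number \<open>e\<close> originates in the automorphism group of \<open>N\<close>.
  Its generator \<gamma> raises \<eta> to a power \<open>g\<close> that is a primitive root modulo
  \<open>p ^ n\<close>, so \<open>g ^ (p - 1) = 1 + p * a\<close>, with \<open>a\<close> prime to
  \<open>p\<close> as soon as \<open>n\<close> is at least 2; taking the \<open>r\<close>-th power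
  adds v_p(r) to the valuation. For \<open>r = 0\<close> the multiplier is 1 and every orbit is a
  point, which is what the convention v_p(0) = n - 1 encodes.

  Transported to exponents of \<eta>, the permutation \<beta>_r(\<sigma>) is the affine map sending
  x to d x - 1. Conjugating a translation by it multiplies the translation by \<open>d\<close>,
  whence the condition on coefficients; and it is a single cycle because 1 + d + ... + d^(k-1) and
  \<open>k\<close> have the same valuation, whence the bijectivity of b_r.

  The field K_m is a definite description in terms of dimension. To evaluate it, the fixed field of
  the \<open>p ^ m\<close>-th iterate of \<sigma> must be shown to have degree \<open>p ^ m\<close>
  and to be the only intermediate field of that degree. Both facts come from Dedekind's independence
  of characters and Artin's bound on the degree over a fixed field.\<close>

locale cyclic_gen = group G
  for G (structure) and x q +
  assumes pos: "0 < q" and gen: "x \<in> carrier G"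
    and carrier_eq: "carrier G = (\<lambda>i::nat. x [^] i) ` {..<q}"
    and pow_eq: "\<And>i j. x [^] i = x [^] j \<longleftrightarrow> [i = j] (mod q)"
begin

lemma exists_pow: "y \<in> carrier G \<Longrightarrow> \<exists>i<q. y = x [^] i"
  using carrier_eq by auto

lemma pow_closed [simp]: "x [^] (i::nat) \<in> carrier G"
  using gen by simp

text \<open>The factor \<open>q - 1\<close> plays the role of -1 and keeps exponents in the natural
  numbers. The exponent \<open>p ^ n - 1\<close> in \<open>D\<close> comes from here.\<close>

lemma inv_pow: "inv (x [^] i) = x [^] ((q - 1) * i)"
proof (rule inv_equality)
  have "(q - 1) * i + i = q * i" using pos by (cases q) auto
  then show "x [^] ((q - 1) * i) \<otimes> x [^] i = \<one>"
    using gen pow_eq[of "q * i" 0] by (simp add: nat_pow_mult cong_def)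
qed (use gen in auto)

lemma card_carrier: "card (carrier G) = q"
  using pow_eq unfolding carrier_eq by (subst card_image) (auto simp: inj_on_def cong_def)

end

lemma (in group) cyclic_genI:
  assumes x: "x \<in> carrier G" "carrier G = generate G {x}" and q: "ord x = q" "0 < q"
  shows "cyclic_gen G x q"
proof (unfold_locales)
  show eq: "x [^] i = x [^] j \<longleftrightarrow> [i = j] (mod q)" for i j :: nat
  proof -
    have "x [^] i = x [^] j \<longleftrightarrow> int q dvd int j - int i"
      using int_pow_eq[OF x(1), of "int i" "int j"] q(1) by (simp add: int_pow_int)
    also have "\<dots> \<longleftrightarrow> [i = j] (mod q)"
      by (metis cong_iff_dvd_diff cong_int_iff cong_sym_eq)
    finally show ?thesis .
  qed
  show "carrier G = (\<lambda>i::nat. x [^] i) ` {..<q}"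
  proof (intro equalityI subsetI)
    fix y assume "y \<in> carrier G"
    then obtain k :: nat where "y = x [^] k"
      using generate_pow_nat[OF x(1)] q x(2) by auto
    also have "\<dots> = x [^] (k mod q)" using eq by (simp add: cong_def)
    finally show "y \<in> (\<lambda>i::nat. x [^] i) ` {..<q}" using q(2) by auto
  qed (use x in auto)
qed (use x q in auto)


section \<open>Lifting the exponent and orbits of multiplication modulo a prime power\<close>

lemma one_plus_power_quadratic:
  fixes y :: nat
  shows "\<exists>t. (1 + y) ^ k = 1 + k * y + y ^ 2 * t"
proof (induction k)
  case (Suc k)
  then obtain t where "(1 + y) ^ k = 1 + k * y + y ^ 2 * t" by blast
  then have "(1 + y) ^ Suc k = (1 + y) * (1 + k * y + y ^ 2 * t)" by simp
  also have "\<dots> = 1 + Suc k * y + y ^ 2 * (k + (1 + y) * t)"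
    by (simp add: algebra_simps power2_eq_square)
  finally show ?case by blast
qed simp

text \<open>Third order is required for the exponent \<open>p\<close>: with
  \<open>y = p * a\<close>, a remainder \<open>y ^ 2 * t\<close> would only be known to be divisible
  by \<open>p ^ 2\<close>, just like the linear term \<open>p * y\<close>.\<close>

lemma one_plus_power_cubic:
  fixes y :: nat
  shows "\<exists>t. (1 + y) ^ k = 1 + k * y + (k choose 2) * y ^ 2 + y ^ 3 * t"
proof (induction k)
  case 0
  show ?case by (simp add: numeral_2_eq_2)
next
  case (Suc k)
  then obtain t where "(1 + y) ^ k = 1 + k * y + (k choose 2) * y ^ 2 + y ^ 3 * t" by blast
  then have "(1 + y) ^ Suc k = (1 + y) * (1 + k * y + (k choose 2) * y ^ 2 + y ^ 3 * t)" by simp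
  also have "\<dots> = 1 + Suc k * y + (Suc k choose 2) * y ^ 2 + y ^ 3 * ((k choose 2) + (1 + y) * t)"
    by (simp add: algebra_simps power2_eq_square power3_eq_cube numeral_2_eq_2)
  finally show ?case by blast
qed

lemma exact_power_prime_step:
  fixes p e a :: nat
  assumes p: "Factorial_Ring.prime p" "odd p" and "0 < e" and a: "\<not> p dvd a"
  shows "\<exists>a'. (1 + p ^ e * a) ^ p = 1 + p ^ Suc e * a' \<and> \<not> p dvd a'"
proof -
  from \<open>0 < e\<close> obtain f where e: "e = Suc f" by (cases e) auto
  from \<open>odd p\<close> obtain h where h: "p = 2 * h + 1" by (elim oddE)
  \<comment> \<open>Oddness of \<open>p\<close> makes \<open>p choose 2\<close> a multiple of
    \<open>p\<close>, so the quadratic term is divisible by \<open>p ^ (2 * e + 1)\<close> and hence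
    by \<open>p ^ (e + 2)\<close>.\<close>
  have "p choose 2 = p * h" by (simp add: choose_two h)
  with one_plus_power_cubic[of "p ^ e * a" p] obtain t where
    "(1 + p ^ e * a) ^ p = 1 + p * (p ^ e * a) + p * h * (p ^ e * a) ^ 2 + (p ^ e * a) ^ 3 * t"
    by auto
  also have "\<dots> = 1 + p ^ Suc e * (a + p * (p ^ f * h * a ^ 2 + p ^ (2 * f) * a ^ 3 * t))"
    by (simp add: e algebra_simps power2_eq_square power3_eq_cube mult_2_right flip: power_add)
  finally show ?thesis
    using a by (metis dvd_add_left_iff dvd_triv_left)
qed

text \<open>Write \<open>k = p ^ j * c\<close> with \<open>c\<close> prime to \<open>p\<close>. Each
  of the \<open>j\<close> successive \<open>p\<close>-th powers raises the exact valuation by one;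
  the exponent \<open>c\<close> keeps it, because it only multiplies the unit part by
  \<open>c\<close> modulo \<open>p\<close>.\<close>

lemma lifting_the_exponent:
  fixes p e a k :: nat
  assumes p: "Factorial_Ring.prime p" "odd p" and e: "0 < e" and a: "\<not> p dvd a" and k: "0 < k"
  shows "\<exists>a'. (1 + p ^ e * a) ^ k = 1 + p ^ (e + multiplicity p k) * a' \<and> \<not> p dvd a'"
proof -
  have "\<not> is_unit p" using p(1) not_prime_unit by blast
  with k obtain c where c: "k = p ^ multiplicity p k * c" "\<not> p dvd c"
    using multiplicity_decompose'[of k p] by auto
  have *: "\<exists>a'. (1 + p ^ e * a) ^ (p ^ j) = 1 + p ^ (e + j) * a' \<and> \<not> p dvd a'" for j
  proof (induction j)
    case 0
    show ?case using a by auto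
  next
    case (Suc j)
    then obtain b where b: "(1 + p ^ e * a) ^ (p ^ j) = 1 + p ^ (e + j) * b" "\<not> p dvd b" by blast
    have "(1 + p ^ e * a) ^ (p ^ Suc j) = ((1 + p ^ e * a) ^ (p ^ j)) ^ p"
      by (simp add: power_mult[symmetric] mult.commute)
    with exact_power_prime_step[OF p _ b(2), of "e + j"] e b(1) show ?case by simp
  qed
  define E where "E = e + multiplicity p k"
  from * obtain b where b: "(1 + p ^ e * a) ^ (p ^ multiplicity p k) = 1 + p ^ E * b" "\<not> p dvd b"
    unfolding E_def by blast
  have E: "E = Suc (E - 1)" using e by (simp add: E_def)
  from one_plus_power_quadratic[of "p ^ E * b" c] obtain t where
    t: "(1 + p ^ E * b) ^ c = 1 + c * (p ^ E * b) + (p ^ E * b) ^ 2 * t" by blast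
  have "(1 + p ^ e * a) ^ k = ((1 + p ^ e * a) ^ (p ^ multiplicity p k)) ^ c"
    by (metis c(1) power_mult)
  also have "\<dots> = 1 + c * (p ^ E * b) + (p ^ E * b) ^ 2 * t"
    using b t by simp
  also have "\<dots> = 1 + p ^ E * (c * b + p * (p ^ (E - 1) * b ^ 2 * t))"
  proof -
    have "p ^ E = p * p ^ (E - 1)" by (metis E power_Suc)
    then have "(p ^ E * b) ^ 2 = p ^ E * (p * (p ^ (E - 1) * b ^ 2))"
      by (simp add: power2_eq_square algebra_simps)
    then show ?thesis by (simp add: algebra_simps)
  qed
  finally have 1: "(1 + p ^ e * a) ^ k = 1 + p ^ E * (c * b + p * (p ^ (E - 1) * b ^ 2 * t))" .
  have "\<not> p dvd c * b + p * (p ^ (E - 1) * b ^ 2 * t)"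
    using b(2) c(2) p(1) by (metis dvd_add_left_iff dvd_triv_left prime_dvd_mult_iff)
  with 1 show ?thesis unfolding E_def by blast
qed

lemma prime_power_dvd_exact_iff:
  fixes p a :: nat
  assumes "Factorial_Ring.prime p" "\<not> p dvd a"
  shows "p ^ m dvd p ^ v * a \<longleftrightarrow> m \<le> v"
proof
  assume *: "p ^ m dvd p ^ v * a"
  show "m \<le> v"
  proof (rule ccontr)
    assume "\<not> m \<le> v"
    then have "p ^ v * p dvd p ^ v * a"
      using * by (metis dvd_trans le_imp_power_dvd not_less_eq_eq power_Suc2)
    then show False using assms by (simp add: prime_gt_0_nat)
  qed
next
  assume "m \<le> v"
  then show "p ^ m dvd p ^ v * a" by (simp add: le_imp_power_dvd)
qed

lemma cong_one_plus_iff: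
  fixes x m :: nat
  shows "[1 + x = 1] (mod m) \<longleftrightarrow> m dvd x"
  by (metis add.right_neutral cong_0_iff cong_add_lcancel_nat)

text \<open>The exact valuation of \<open>(1 + p ^ e * a) ^ k - 1\<close> is
  \<open>e + multiplicity p k\<close>. In other words, \<open>1 + p ^ e * a\<close> has
  multiplicative order \<open>p ^ m\<close> modulo \<open>p ^ (e + m)\<close>.\<close>

lemma exact_power_cong_one_iff:
  fixes p e a k m :: nat
  assumes p: "Factorial_Ring.prime p" "odd p" and e: "0 < e" and a: "\<not> p dvd a"
  shows "[(1 + p ^ e * a) ^ k = 1] (mod p ^ (e + m)) \<longleftrightarrow> p ^ m dvd k"
proof (cases "k = 0")
  case False
  then obtain a' where a': "(1 + p ^ e * a) ^ k = 1 + p ^ (e + multiplicity p k) * a'" "\<not> p dvd a'"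
    using lifting_the_exponent[OF assms] by blast
  have "[(1 + p ^ e * a) ^ k = 1] (mod p ^ (e + m)) \<longleftrightarrow> m \<le> multiplicity p k"
    unfolding a'(1) cong_one_plus_iff prime_power_dvd_exact_iff[OF p(1) a'(2)] by simp
  also have "\<dots> \<longleftrightarrow> p ^ m dvd k"
    using False p(1) not_prime_unit power_dvd_iff_le_multiplicity by blast
  finally show ?thesis .
qed simp

text \<open>The sum times \<open>d - 1\<close> is \<open>d ^ k - 1\<close>, whose valuation is that
  of \<open>d - 1\<close> plus that of \<open>k\<close>; so the sum has the valuation of
  \<open>k\<close>. This is the arithmetic behind the bijectivity of b_s. For p = 2 it fails, as d =
  3 and k = 2 show.\<close>

lemma prime_power_dvd_geometric_sum_iff:
  fixes p d k n :: nat
  assumes p: "Factorial_Ring.prime p" "odd p" and d: "0 < d" "[d = 1] (mod p)"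
  shows "p ^ n dvd (\<Sum>i<k. d ^ i) \<longleftrightarrow> p ^ n dvd k"
proof (cases "k = 0 \<or> d = 1")
  case False
  then have d1: "1 < d" and k: "k \<noteq> 0" using d(1) by auto
  have pu: "\<not> is_unit p" using p(1) by (metis not_prime_unit)
  define e where "e = multiplicity p (d - 1)"
  obtain a where a: "d - 1 = p ^ e * a" "\<not> p dvd a"
    using multiplicity_decompose'[OF _ pu, of "d - 1"] d1 unfolding e_def by auto
  have da: "d = 1 + p ^ e * a" using a d1 by linarith
  have "p dvd d - 1" using d(2) d1 by (metis cong_altdef_nat less_imp_le)
  then have e: "0 < e" using pu d1 unfolding e_def
    by (metis a(1) a(2) e_def mult_1 not_gr_zero power_0)
  obtain b where b: "d ^ k = 1 + p ^ (e + multiplicity p k) * b" "\<not> p dvd b"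
    using lifting_the_exponent[OF p e a(2), of k] False da by auto
  have "1 + p ^ e * (a * (\<Sum>i<k. d ^ i)) = d ^ k"
  proof (induction k)
    case (Suc k)
    have "d ^ Suc k = d ^ k + p ^ e * a * d ^ k" using da by (metis add_mult_distrib mult_1 power_Suc)
    with Suc show ?case by (simp add: algebra_simps)
  qed simp
  then have "p ^ e * (a * (\<Sum>i<k. d ^ i)) = p ^ e * (p ^ multiplicity p k * b)"
    using b by (simp add: power_add mult.assoc)
  then have eq: "a * (\<Sum>i<k. d ^ i) = p ^ multiplicity p k * b"
    using p(1) by (simp add: prime_gt_0_nat)
  \<comment> \<open>\<open>a\<close> is the part of \<open>d - 1\<close> prime to \<open>p\<close>;
    multiplying the sum by it does not affect divisibility by \<open>p ^ n\<close>.\<close>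
  have "coprime (p ^ n) a"
    using a(2) p(1) by (simp add: prime_imp_coprime)
  then have "p ^ n dvd (\<Sum>i<k. d ^ i) \<longleftrightarrow> p ^ n dvd a * (\<Sum>i<k. d ^ i)"
    by (simp add: coprime_dvd_mult_right_iff)
  also have "\<dots> \<longleftrightarrow> n \<le> multiplicity p k"
    unfolding eq by (rule prime_power_dvd_exact_iff[OF p(1) b(2)])
  also have "\<dots> \<longleftrightarrow> p ^ n dvd k"
    using False pu by (simp add: power_dvd_iff_le_multiplicity)
  finally show ?thesis .
qed auto


text \<open>If \<open>p\<close> divided \<open>a\<close>, then \<open>1 + p\<close>, being a power of \<open>g\<close> modulo \<open>p\<^sup>2\<close>, would satisfy
  \<open>(1 + p)\<^bsup>p-1\<^esup> \<equiv> 1\<close> modulo \<open>p\<^sup>2\<close>.\<close>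

lemma primitive_multiplier_exact:
  fixes p n g a j :: nat
  assumes p: "Factorial_Ring.prime p" "odd p" and n: "2 \<le> n"
    and g: "g ^ (p - 1) = 1 + p * a" and j: "[g ^ j = 1 + p] (mod p ^ n)"
  shows "\<not> p dvd a"
proof
  assume "p dvd a"
  then have "[g ^ (p - 1) = 1] (mod p ^ 2)"
    unfolding g cong_one_plus_iff by (simp add: power2_eq_square)
  then have "[(g ^ (p - 1)) ^ j = 1 ^ j] (mod p ^ 2)" by (rule cong_pow)
  moreover have "[(g ^ j) ^ (p - 1) = (1 + p) ^ (p - 1)] (mod p ^ 2)"
    using j n by (intro cong_pow) (meson cong_dvd_modulus_nat le_imp_power_dvd)
  ultimately have "[(1 + p ^ 1 * 1) ^ (p - 1) = 1] (mod p ^ (1 + 1))"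
    by (simp add: power_mult[symmetric] mult.commute numeral_2_eq_2)
      (metis cong_def)
  then have "p ^ 1 dvd p - 1"
    using exact_power_cong_one_iff[OF p, of 1 1 "p - 1" 1] p(1) by (auto simp: prime_nat_iff)
  then show False
    using prime_gt_1_nat[OF p(1)] by (auto dest: dvd_imp_le)
qed

text \<open>The bound on \<open>r\<close> keeps \<open>e = 1 + val p n r\<close> at most
  \<open>n\<close>, so that \<open>p ^ e\<close> divides \<open>p ^ n\<close>.\<close>

lemma val_less:
  assumes p: "Factorial_Ring.prime p" and n: "1 \<le> n" and r: "r < p ^ (n - 1)"
  shows "val p n r < n"
proof (cases "r = 0")
  case False
  then have "p ^ multiplicity p r \<le> r"
    by (intro dvd_imp_le multiplicity_dvd) auto
  with r have "p ^ multiplicity p r < p ^ (n - 1)" by simp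
  then have "multiplicity p r < n - 1"
    using prime_gt_1_nat[OF p] by (simp add: power_strict_increasing_iff)
  with False show ?thesis by (simp add: val_def)
qed (use n in \<open>simp add: val_def\<close>)

text \<open>The \<open>r\<close>-th power of \<open>1 + p * a\<close> differs from 1 by exact
  valuation 1 + v_p(r), so its order is known. For \<open>r = 0\<close> the convention for
  \<open>val\<close> forces \<open>m = 0\<close>, where both sides hold.\<close>

lemma multiplier_power_cong_one_iff:
  fixes p n r g a k m :: nat
  assumes p: "Factorial_Ring.prime p" "odd p" and r: "r < p ^ (n - 1)"
    and g: "g ^ (p - 1) = 1 + p * a" and a: "2 \<le> n \<Longrightarrow> \<not> p dvd a"
    and m: "m \<le> n - (1 + val p n r)"
  shows "[(g ^ ((p - 1) * r)) ^ k = 1] (mod p ^ (1 + val p n r + m)) \<longleftrightarrow> p ^ m dvd k"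
proof (cases "r = 0")
  case True
  with m show ?thesis by (simp add: val_def)
next
  case False
  \<comment> \<open>A nonzero \<open>r\<close> below \<open>p ^ (n - 1)\<close> forces
    \<open>n\<close> to be at least 2, the range in which \<open>a\<close> is known to be prime to
    \<open>p\<close>.\<close>
  have "n \<noteq> 0 \<and> n \<noteq> 1" using r False by (intro conjI notI) auto
  then have n: "2 \<le> n" by linarith
  obtain b where b: "(1 + p ^ 1 * a) ^ r = 1 + p ^ (1 + multiplicity p r) * b" "\<not> p dvd b"
    using lifting_the_exponent[OF p _ a[OF n], of 1 r] False by auto
  have "g ^ ((p - 1) * r) = 1 + p ^ (1 + val p n r) * b"
    using b False unfolding power_mult g by (simp add: val_def)
  then show ?thesis
    using exact_power_cong_one_iff[OF p _ b(2), of "1 + val p n r" k m] by simp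
qed

text \<open>\<open>totatives\<close> counts from 1 to \<open>p ^ e\<close> whereas the index set
  runs from 0 to \<open>p ^ e - 1\<close>; both end points are multiples of \<open>p\<close>, so
  Euler's totient applies.\<close>

lemma card_less_not_dvd_prime_power:
  assumes p: "Factorial_Ring.prime p" and e: "0 < e"
  shows "card {u. u < p ^ e \<and> \<not> p dvd u} = p ^ (e - 1) * (p - 1)"
proof -
  have "{u. u < p ^ e \<and> \<not> p dvd u} = totatives (p ^ e)"
  proof (intro equalityI subsetI)
    fix u assume "u \<in> {u. u < p ^ e \<and> \<not> p dvd u}"
    then show "u \<in> totatives (p ^ e)"
      using p by (auto simp: totatives_def intro!: Nat.gr0I) (metis coprime_commute coprime_power_right_iff prime_imp_coprime)
  next
    fix u assume u: "u \<in> totatives (p ^ e)"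
    have "\<not> p dvd u"
      using u p e by (auto simp: totatives_def)
    moreover have "u \<noteq> p ^ e" using calculation e by auto
    ultimately show "u \<in> {u. u < p ^ e \<and> \<not> p dvd u}" using u by (auto simp: totatives_def)
  qed
  then show ?thesis
    using totient_prime_power[OF p e] by (simp add: totient_def)
qed

section \<open>Orbits of multiplication by \<open>D\<close> on the residues modulo
  \<open>p ^ n\<close>\<close>

locale orbit_transversal =
  fixes p n e D :: nat
  assumes p: "Factorial_Ring.prime p" and e: "0 < e" "e \<le> n"
    and order: "\<And>k m. m \<le> n - e \<Longrightarrow> [D ^ k = 1] (mod p ^ (e + m)) \<longleftrightarrow> p ^ m dvd k"
begin

text \<open>There are \<open>p ^ e\<close> pairs with \<open>m = 0\<close> and
  \<open>p ^ (e - 1) * (p - 1)\<close> pairs for each positive \<open>m\<close>, the multiplicities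
  in the theorem. The case \<open>r = 0\<close> is covered by \<open>e = n\<close>, where only
  \<open>m = 0\<close> occurs.\<close>

definition idx :: "(nat \<times> nat) set"
  where "idx = {(m, u). m \<le> n - e \<and> u < p ^ e \<and> (m = 0 \<or> \<not> p dvd u)}"

definition rep :: "nat \<Rightarrow> nat \<Rightarrow> nat"
  where "rep m u = p ^ (n - e - m) * u"

lemma power_cong_one: "[D ^ k = 1] (mod p ^ e)"
  using order[of 0 k] by simp

lemma coprime_D: "coprime (D ^ k) (p ^ l)"
proof -
  have "[D = 1] (mod p)"
    using power_cong_one[of 1] e(1) by (metis cong_dvd_modulus_nat dvd_power power_one_right)
  then have "coprime D p" by (metis cong_imp_coprime cong_sym coprime_1_left)
  then show ?thesis by simp
qed

lemma not_dvd_power: "\<not> p dvd D ^ k"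
  using coprime_D[of k 1] p by (metis coprime_common_divisor_nat dvd_refl not_prime_1 power_one_right One_nat_def)

text \<open>Since \<open>p ^ n = p ^ (n - e - m) * p ^ (e + m)\<close>, the power of
  \<open>p\<close> in \<open>rep\<close> cancels and leaves a question modulo
  \<open>p ^ (e + m)\<close>, where \<open>order\<close> applies.\<close>

lemma cong_rep_iff:
  assumes "m \<le> n - e"
  shows "[x * rep m u = y * rep m v] (mod p ^ n) \<longleftrightarrow> [x * u = y * v] (mod p ^ (e + m))"
proof -
  have 1: "p ^ n = p ^ (n - e - m) * p ^ (e + m)"
    using assms e by (simp flip: power_add)
  have 2: "x * rep m u = p ^ (n - e - m) * (x * u)" "y * rep m v = p ^ (n - e - m) * (y * v)"
    by (simp_all add: rep_def)
  have "p ^ (n - e - m) \<noteq> 0" using p by (simp add: prime_gt_0_nat)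
  then show ?thesis
    by (simp only: cong_def 1 2 mult_mod_right[symmetric] mult_cancel1) simp
qed

text \<open>For positive \<open>m\<close> both \<open>u\<close> and the smaller power of
  \<open>D\<close> are units and cancel, so \<open>order\<close> decides; for \<open>m = 0\<close>
  every power of \<open>D\<close> is 1 modulo \<open>p ^ e\<close>. Hence the orbit of
  \<open>rep m u\<close> has exactly \<open>p ^ m\<close> elements.\<close>

lemma power_cong_iff:
  assumes m: "m \<le> n - e" and u: "m = 0 \<or> \<not> p dvd u"
  shows "[D ^ k * u = D ^ l * u] (mod p ^ (e + m)) \<longleftrightarrow> [k = l] (mod p ^ m)"
proof (cases "m = 0")
  case True
  then show ?thesis
    using power_cong_one by simp (meson cong_scalar_right cong_sym cong_trans)
next
  case False
  with u have u: "coprime u (p ^ (e + m))"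
    using p by (metis coprime_commute coprime_power_right_iff prime_imp_coprime)
  have *: "[D ^ k = D ^ l] (mod p ^ (e + m)) \<longleftrightarrow> [k = l] (mod p ^ m)" if "k \<le> l" for k l
  proof -
    have "D ^ l = D ^ k * D ^ (l - k)" using that by (simp flip: power_add)
    then have "[D ^ k = D ^ l] (mod p ^ (e + m)) \<longleftrightarrow> [D ^ (l - k) = 1] (mod p ^ (e + m))"
      using cong_mult_lcancel_nat[OF coprime_D, of k 1 "D ^ (l - k)"] by (simp add: cong_sym_eq)
    also have "\<dots> \<longleftrightarrow> p ^ m dvd l - k" by (rule order[OF m])
    also have "\<dots> \<longleftrightarrow> [k = l] (mod p ^ m)"
      using that by (metis cong_altdef_nat cong_sym_eq)
    finally show ?thesis .
  qed
  have "[D ^ k * u = D ^ l * u] (mod p ^ (e + m)) \<longleftrightarrow> [D ^ k = D ^ l] (mod p ^ (e + m))"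
    by (rule cong_mult_rcancel_nat[OF u])
  also have "\<dots> \<longleftrightarrow> [k = l] (mod p ^ m)"
    using *[of k l] *[of l k] by (metis cong_sym_eq nat_le_linear)
  finally show ?thesis .
qed

lemma rep_periodic:
  assumes "(m, u) \<in> idx"
  shows "[D ^ (p ^ m) * rep m u = rep m u] (mod p ^ n)"
proof -
  have "[D ^ (p ^ m) * u = D ^ 0 * u] (mod p ^ (e + m))"
    using assms power_cong_iff[of m u "p ^ m" 0] by (auto simp: idx_def cong_0_iff)
  then show ?thesis
    using assms cong_rep_iff[of m "D ^ (p ^ m)" u 1 u] by (simp add: idx_def)
qed

text \<open>Multiplication by the unit \<open>D\<close> preserves the valuation. It equals
  \<open>n - e - m\<close> for positive \<open>m\<close> but is only known to be at least
  \<open>n - e\<close> for \<open>m = 0\<close>, whence the cut-off at \<open>n - e\<close>.\<close>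

lemma dvd_rep_iff:
  assumes "(m, u) \<in> idx" "l \<le> n - e"
  shows "p ^ l dvd D ^ k * rep m u \<longleftrightarrow> l + m \<le> n - e \<or> m = 0"
proof (cases "m = 0")
  case True
  then show ?thesis using assms(2) by (simp add: rep_def le_imp_power_dvd dvd_mult)
next
  case False
  then have "\<not> p dvd D ^ k * u"
    using assms p not_dvd_power by (auto simp: idx_def prime_dvd_mult_iff)
  then show ?thesis
    using prime_power_dvd_exact_iff[OF p, of "D ^ k * u" l "n - e - m"] False assms
    by (auto simp: rep_def idx_def algebra_simps)
qed

text \<open>\<open>m\<close> is read off from the truncated valuation, \<open>u\<close> from the
  class modulo \<open>p ^ e\<close>, on which \<open>D\<close> acts trivially, and \<open>k\<close>
  from the length of the orbit.\<close>

lemma rep_unique: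
  assumes i: "(m, u) \<in> idx" "(m', u') \<in> idx"
    and eq: "[D ^ k * rep m u = D ^ k' * rep m' u'] (mod p ^ n)"
  shows "m = m' \<and> u = u' \<and> [k = k'] (mod p ^ m)"
proof -
  have "p ^ l dvd D ^ k * rep m u \<longleftrightarrow> p ^ l dvd D ^ k' * rep m' u'" if "l \<le> n - e" for l
    by (rule cong_dvd_iff) (use eq that e in \<open>meson cong_dvd_modulus_nat diff_le_self le_imp_power_dvd le_trans\<close>)
  then have iff: "(l + m \<le> n - e \<or> m = 0) \<longleftrightarrow> (l + m' \<le> n - e \<or> m' = 0)" if "l \<le> n - e" for l
    using dvd_rep_iff[OF i(1) that] dvd_rep_iff[OF i(2) that] that by blast
  have le: "m \<le> n - e" "m' \<le> n - e" using i by (auto simp: idx_def)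
  \<comment> \<open>The level \<open>l = n - e\<close> tells \<open>m = 0\<close> from positive
    \<open>m\<close>; the other two levels give both inequalities when \<open>m\<close> and
    \<open>m'\<close> are positive.\<close>
  have m: "m = m'"
    using iff[of "n - e - m"] iff[of "n - e - m'"] iff[of "n - e"] le by fastforce
  with eq cong_rep_iff[OF le(1)] have eq': "[D ^ k * u = D ^ k' * u'] (mod p ^ (e + m))" by simp
  then have "[D ^ k * u = D ^ k' * u'] (mod p ^ e)"
    by (rule cong_dvd_modulus_nat) (simp add: power_add)
  moreover have "[D ^ k * u = 1 * u] (mod p ^ e)" "[D ^ k' * u' = 1 * u'] (mod p ^ e)"
    by (intro cong_scalar_right power_cong_one)+
  ultimately have "[u = u'] (mod p ^ e)" by (simp add: cong_def)
  then have u: "u = u'" using i by (auto simp: idx_def cong_less_modulus_unique_nat)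
  with eq' i(1) show ?thesis using m power_cong_iff[OF le(1), of u k k'] by (auto simp: idx_def)
qed

text \<open>The powers of \<open>D\<close> times \<open>u\<close> fill the residue class of \<open>u\<close> modulo \<open>p\<^sup>e\<close>, because both sets have
  \<open>p\<^sup>m\<close> elements modulo \<open>p\<^bsup>e+m\<^esup>\<close>.\<close>

lemma unit_orbit:
  assumes m: "m \<le> n - e" and w: "\<not> p dvd w"
  shows "\<exists>k. [w = D ^ k * (w mod p ^ e)] (mod p ^ (e + m))"
proof -
  define u where "u = w mod p ^ e"
  have u: "\<not> p dvd u" using w e by (simp add: u_def dvd_mod_iff dvd_power)
  define S where "S = (\<lambda>k. D ^ k * u mod p ^ (e + m)) ` {..<p ^ m}"
  define T where "T = (\<lambda>y. u + p ^ e * y) ` {..<p ^ m}"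
  have pos: "0 < p ^ k" for k using p by (simp add: prime_gt_0_nat)
  have "inj_on (\<lambda>k. D ^ k * u mod p ^ (e + m)) {..<p ^ m}"
    using power_cong_iff[OF m, of u] u
    by (intro inj_onI) (auto simp: cong_def)
  then have cS: "card S = p ^ m" by (simp add: S_def card_image)
  have cT: "card T \<le> p ^ m" unfolding T_def by (metis card_image_le card_lessThan finite_lessThan)
  have in_T: "x mod p ^ (e + m) \<in> T" if "[x = u] (mod p ^ e)" for x
  proof -
    define y where "y = x mod p ^ (e + m)"
    have "y mod p ^ e = u"
      using that by (simp add: y_def u_def cong_def mod_mod_cancel power_add)
    then have "y = u + p ^ e * (y div p ^ e)" by (metis mod_mult_div_eq)
    moreover have "y div p ^ e < p ^ m"
    proof (rule less_mult_imp_div_less)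
      show "y < p ^ m * p ^ e"
        using pos[of "e + m"] by (simp add: y_def power_add mult.commute)
    qed
    ultimately show ?thesis by (auto simp: T_def y_def)
  qed
  have "S \<subseteq> T"
  proof -
    have "[D ^ k * u = u] (mod p ^ e)" for k
      using cong_scalar_right[OF power_cong_one, of k u] by simp
    then show ?thesis using in_T by (auto simp: S_def)
  qed
  moreover have "finite T" by (simp add: T_def)
  ultimately have "S = T" using cS cT by (intro card_seteq) auto
  moreover have "w mod p ^ (e + m) \<in> T" by (rule in_T) (simp add: u_def cong_def)
  ultimately obtain k where "w mod p ^ (e + m) = D ^ k * u mod p ^ (e + m)" by (auto simp: S_def)
  then show ?thesis unfolding cong_def u_def by blast
qed

lemma rep_exists:
  "\<exists>m u k. (m, u) \<in> idx \<and> [j = D ^ k * rep m u] (mod p ^ n)"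
proof (cases "p ^ (n - e) dvd j")
  case True
  then obtain x where x: "j = p ^ (n - e) * x" by blast
  define u where "u = x mod p ^ e"
  have "(0, u) \<in> idx" using p by (simp add: idx_def u_def prime_gt_0_nat)
  moreover have "[1 * rep 0 x = 1 * rep 0 u] (mod p ^ n)"
    unfolding cong_rep_iff[OF le0] by (simp add: u_def cong_def)
  then have "[j = D ^ 0 * rep 0 u] (mod p ^ n)"
    by (simp add: x rep_def)
  ultimately show ?thesis by blast
next
  case False
  then have "j \<noteq> 0" by (metis dvd_0_right)
  moreover have "\<not> is_unit p" using p not_prime_unit by blast
  ultimately obtain w where w: "j = p ^ multiplicity p j * w" "\<not> p dvd w"
    using multiplicity_decompose' by metis
  have "multiplicity p j < n - e" using False multiplicity_dvd' by (meson not_le)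
  \<comment> \<open>The valuation of \<open>j\<close> lies below \<open>n - e\<close>, and the gap
    determines the length of its orbit. The unit part \<open>w\<close> is then handled modulo
    \<open>p ^ (e + m)\<close>.\<close>
  define m where "m = n - e - multiplicity p j"
  have m: "m \<le> n - e" "n - e - m = multiplicity p j"
    using \<open>multiplicity p j < n - e\<close> by (auto simp: m_def)
  obtain k where k: "[w = D ^ k * (w mod p ^ e)] (mod p ^ (e + m))"
    using unit_orbit[OF m(1) w(2)] by blast
  have "(m, w mod p ^ e) \<in> idx"
    using m w(2) p e by (simp add: idx_def prime_gt_0_nat dvd_mod_iff dvd_power)
  moreover have "[1 * rep m w = D ^ k * rep m (w mod p ^ e)] (mod p ^ n)"
    unfolding cong_rep_iff[OF m(1)] using k by simp
  then have "[j = D ^ k * rep m (w mod p ^ e)] (mod p ^ n)"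
    using w(1) m(2) by (simp add: rep_def)
  ultimately show ?thesis by blast
qed

end


section \<open>Linear algebra over fields and cyclic extensions\<close>

lemma (in abelian_monoid) finsum_swap:
  assumes "finite A" "finite B" "\<And>a b. a \<in> A \<Longrightarrow> b \<in> B \<Longrightarrow> f a b \<in> carrier G"
  shows "(\<Oplus>a\<in>A. \<Oplus>b\<in>B. f a b) = (\<Oplus>b\<in>B. \<Oplus>a\<in>A. f a b)"
  using assms(1,3)
proof (induction A rule: finite_induct)
  case (insert x A)
  have "(\<Oplus>a\<in>insert x A. \<Oplus>b\<in>B. f a b) = (\<Oplus>b\<in>B. f x b) \<oplus> (\<Oplus>b\<in>B. \<Oplus>a\<in>A. f a b)"
    using insert by (subst finsum_insert) (auto simp: Pi_def intro!: finsum_closed)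
  also have "\<dots> = (\<Oplus>b\<in>B. f x b \<oplus> (\<Oplus>a\<in>A. f a b))"
    using insert by (subst finsum_addf) (auto simp: Pi_def intro!: finsum_closed)
  also have "\<dots> = (\<Oplus>b\<in>B. \<Oplus>a\<in>insert x A. f a b)"
    using insert by (intro finsum_cong') (auto simp: Pi_def finsum_insert intro!: finsum_closed)
  finally show ?case .
qed simp

lemma (in cring) ring_hom_finsum:
  assumes "\<phi> \<in> ring_hom R R" "f \<in> A \<rightarrow> carrier R"
  shows "\<phi> (\<Oplus>i\<in>A. f i) = (\<Oplus>i\<in>A. \<phi> (f i))"
proof -
  interpret ring_hom_cring R R \<phi> using assms(1) by unfold_locales
  show ?thesis using hom_finsum[OF assms(2)] by (simp add: comp_def)
qed

lemma (in ring) funpow_ring_hom: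
  assumes "\<tau> \<in> ring_hom R R"
  shows "\<tau> ^^ k \<in> ring_hom R R"
proof (induction k)
  case 0
  show ?case by (auto simp: ring_hom_def)
next
  case (Suc k)
  have "\<tau> \<circ> \<tau> ^^ k \<in> ring_hom R R" by (rule ring_hom_trans[OF Suc assms])
  then show ?case by (simp add: comp_def)
qed

lemma (in ring) combine_eq_finsum:
  assumes "set Us \<subseteq> carrier R" "\<And>i. i < length Us \<Longrightarrow> f i \<in> carrier R"
  shows "combine (map f [0..<length Us]) Us = (\<Oplus>i\<in>{..<length Us}. f i \<otimes> Us ! i)"
  using assms
proof (induction Us rule: rev_induct)
  case (snoc u Us)
  have "combine (map f [0..<length (Us @ [u])]) (Us @ [u])
      = combine (map f [0..<length Us]) Us \<oplus> combine [f (length Us)] [u]"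
    using snoc.prems by (subst combine_append) (auto simp: less_Suc_eq)
  also have "combine (map f [0..<length Us]) Us = (\<Oplus>i\<in>{..<length Us}. f i \<otimes> Us ! i)"
    using snoc by auto
  also have "\<dots> = (\<Oplus>i\<in>{..<length Us}. f i \<otimes> (Us @ [u]) ! i)"
    using snoc.prems by (intro finsum_cong') (auto simp: nth_append intro!: m_closed)
  finally show ?case
    using snoc.prems
    by (simp add: lessThan_Suc a_comm finsum_insert Pi_def nth_append subset_iff)
qed simp

context field
begin

text \<open>Gaussian elimination on the last row: a zero row is dropped, otherwise a pivot in column
  \<open>j0\<close> eliminates one equation and one unknown.\<close>

lemma homogeneous_system_nontrivial_solution:
  fixes a :: "nat \<Rightarrow> 'i \<Rightarrow> 'a"
  assumes "finite J" "m < card J" "\<And>i j. i < m \<Longrightarrow> j \<in> J \<Longrightarrow> a i j \<in> carrier R"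
  shows "\<exists>c. (\<forall>j\<in>J. c j \<in> carrier R) \<and> (\<exists>j\<in>J. c j \<noteq> \<zero>) \<and>
    (\<forall>i<m. (\<Oplus>j\<in>J. a i j \<otimes> c j) = \<zero>)"
  using assms
proof (induction m arbitrary: a J)
  case 0
  then have "J \<noteq> {}" by auto
  then show ?case by (intro exI[of _ "\<lambda>_. \<one>"]) auto
next
  case (Suc m)
  note a = Suc.prems(3)
  show ?case
  proof (cases "\<forall>j\<in>J. a m j = \<zero>")
    case True
    obtain c where c: "\<forall>j\<in>J. c j \<in> carrier R" "\<exists>j\<in>J. c j \<noteq> \<zero>"
        "\<forall>i<m. (\<Oplus>j\<in>J. a i j \<otimes> c j) = \<zero>"
      using Suc.IH[of J a] Suc.prems by auto
    have "(\<Oplus>j\<in>J. a m j \<otimes> c j) = (\<Oplus>j\<in>J. \<zero>)"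
      using True c(1) by (intro finsum_cong') auto
    with c show ?thesis by (intro exI[of _ c]) (auto simp: less_Suc_eq)
  next
    case False
    then obtain j0 where j0: "j0 \<in> J" "a m j0 \<noteq> \<zero>" by blast
    define J' where "J' = J - {j0}"
    have J: "J = insert j0 J'" "j0 \<notin> J'" "finite J'" using j0 Suc.prems(1) by (auto simp: J'_def)
    define b where "b = a m j0"
    have b: "b \<in> carrier R" "b \<noteq> \<zero>" "inv b \<in> carrier R" "inv b \<otimes> b = \<one>" "b \<otimes> inv b = \<one>"
      using j0 a[of m j0] field_Units unfolding b_def by auto
    \<comment> \<open>Subtracting \<open>t i\<close> times the pivot row \<open>m\<close> from row
      \<open>i\<close> clears column \<open>j0\<close>.\<close>
    define t where "t i = a i j0 \<otimes> inv b" for i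
    have t: "t i \<in> carrier R" if "i < m" for i using that a j0 b by (auto simp: t_def)
    define a' where "a' i j = a i j \<oplus> (\<ominus> t i) \<otimes> a m j" for i j
    have "m < card J'" using Suc.prems(2) J by simp
    moreover have "a' i j \<in> carrier R" if "i < m" "j \<in> J'" for i j
      using that a J t by (auto simp: a'_def)
    ultimately obtain c where c: "\<forall>j\<in>J'. c j \<in> carrier R" "\<exists>j\<in>J'. c j \<noteq> \<zero>"
        "\<forall>i<m. (\<Oplus>j\<in>J'. a' i j \<otimes> c j) = \<zero>"
      using Suc.IH[OF J(3)] by blast
    define S where "S i = (\<Oplus>j\<in>J'. a i j \<otimes> c j)" for i
    have S: "S i \<in> carrier R" if "i \<le> m" for i
      using that a J c unfolding S_def by (auto intro!: finsum_closed)
    \<comment> \<open>Back substitution: this is the value of the unknown \<open>j0\<close> forced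
      by the pivot row.\<close>
    define x where "x = \<ominus> (inv b \<otimes> S m)"
    have x: "x \<in> carrier R" using S b by (auto simp: x_def)
    define c' where "c' j = (if j = j0 then x else c j)" for j
    have sum: "(\<Oplus>j\<in>J. a i j \<otimes> c' j) = a i j0 \<otimes> x \<oplus> S i" if "i \<le> m" for i
    proof -
      have "(\<Oplus>j\<in>J. a i j \<otimes> c' j) = a i j0 \<otimes> c' j0 \<oplus> (\<Oplus>j\<in>J'. a i j \<otimes> c' j)"
        unfolding J(1) using a that J c(1) x by (subst finsum_insert) (auto simp: c'_def)
      also have "(\<Oplus>j\<in>J'. a i j \<otimes> c' j) = S i"
        unfolding S_def using a that J c(1) by (intro finsum_cong') (auto simp: c'_def)
      finally show ?thesis by (simp add: c'_def)
    qed
    have m0: "(\<Oplus>j\<in>J. a m j \<otimes> c' j) = \<zero>"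
    proof -
      have "b \<otimes> x = \<ominus> (b \<otimes> (inv b \<otimes> S m))"
        using b S by (simp add: x_def r_minus)
      also have "\<dots> = \<ominus> S m" using b S by (simp add: m_assoc[symmetric])
      finally show ?thesis using sum[of m] S by (simp add: b_def l_neg)
    qed
    have i0: "(\<Oplus>j\<in>J. a i j \<otimes> c' j) = \<zero>" if i: "i < m" for i
    proof -
      have "(\<Oplus>j\<in>J'. a' i j \<otimes> c j) = (\<Oplus>j\<in>J'. a i j \<otimes> c j \<oplus> (\<ominus> t i) \<otimes> (a m j \<otimes> c j))"
        using a i J c(1) t[OF i] by (intro finsum_cong') (auto simp: a'_def l_distr m_assoc)
      also have "\<dots> = S i \<oplus> (\<Oplus>j\<in>J'. (\<ominus> t i) \<otimes> (a m j \<otimes> c j))"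
        unfolding S_def using a i J c(1) t[OF i] by (subst finsum_addf) (auto intro!: finsum_closed)
      also have "(\<Oplus>j\<in>J'. (\<ominus> t i) \<otimes> (a m j \<otimes> c j)) = (\<ominus> t i) \<otimes> S m"
        unfolding S_def using a i J c(1) t[OF i] by (subst finsum_rdistr) auto
      finally have eq: "S i \<oplus> (\<ominus> t i) \<otimes> S m = \<zero>" using c(3) i by simp
      have ai: "a i j0 \<in> carrier R" using a[of i j0] i j0 by simp
      have "a i j0 \<otimes> x = (\<ominus> t i) \<otimes> S m"
        using ai b S[of m] by (simp add: x_def t_def r_minus l_minus m_assoc)
      with sum[of i] eq i S t[OF i] show ?thesis by (simp add: a_comm)
    qed
    show ?thesis
    proof (intro exI[of _ c'] conjI)
      show "\<forall>j\<in>J. c' j \<in> carrier R" using c(1) x J by (auto simp: c'_def)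
      show "\<exists>j\<in>J. c' j \<noteq> \<zero>" using c(2) J unfolding c'_def by (metis insertCI)
      show "\<forall>i<Suc m. (\<Oplus>j\<in>J. a i j \<otimes> c' j) = \<zero>" using i0 m0 by (auto simp: less_Suc_eq)
    qed
  qed
qed

text \<open>Subtracting \<open>\<phi> k y\<close> times the relation at \<open>x\<close> from the
  relation at \<open>op y x\<close> removes the term \<open>k\<close>. The coefficients
  \<open>c i \<otimes> (\<phi> i y \<ominus> \<phi> k y)\<close> of the shorter relation vanish by
  induction, and a \<open>y\<close> that separates \<open>i\<close> from \<open>k\<close> yields
  \<open>c i = \<zero>\<close>.\<close>

lemma dedekind_independence:
  fixes \<phi> :: "'i \<Rightarrow> 's \<Rightarrow> 'a" and op :: "'s \<Rightarrow> 's \<Rightarrow> 's" and S :: "'s set"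
  assumes "finite I"
    and S: "\<And>x y. x \<in> S \<Longrightarrow> y \<in> S \<Longrightarrow> op x y \<in> S" "u \<in> S"
    and "\<And>i x. i \<in> I \<Longrightarrow> x \<in> S \<Longrightarrow> \<phi> i x \<in> carrier R"
    and "\<And>i x y. i \<in> I \<Longrightarrow> x \<in> S \<Longrightarrow> y \<in> S \<Longrightarrow> \<phi> i (op x y) = \<phi> i x \<otimes> \<phi> i y"
    and "\<And>i. i \<in> I \<Longrightarrow> \<phi> i u = \<one>"
    and "\<And>i j. i \<in> I \<Longrightarrow> j \<in> I \<Longrightarrow> i \<noteq> j \<Longrightarrow> \<exists>x\<in>S. \<phi> i x \<noteq> \<phi> j x"
    and "\<And>i. i \<in> I \<Longrightarrow> c i \<in> carrier R"
    and "\<And>x. x \<in> S \<Longrightarrow> (\<Oplus>i\<in>I. c i \<otimes> \<phi> i x) = \<zero>"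
  shows "\<forall>i\<in>I. c i = \<zero>"
  using assms(1,4-)
proof (induction I arbitrary: c rule: finite_induct)
  case (insert k I)
  note closed = insert.prems(1) and mult = insert.prems(2) and one = insert.prems(3)
    and dist = insert.prems(4) and c = insert.prems(5) and zero = insert.prems(6)
  have sum: "c k \<otimes> \<phi> k x \<oplus> (\<Oplus>i\<in>I. c i \<otimes> \<phi> i x) = \<zero>" if "x \<in> S" for x
    using zero[OF that] insert.hyps c closed that by (subst (asm) finsum_insert) auto
  have "\<forall>i\<in>I. c i \<otimes> (\<phi> i y \<ominus> \<phi> k y) = \<zero>" if y: "y \<in> S" for y
  proof (rule insert.IH)
    fix x assume x: "x \<in> S"
    define A where "A = (\<Oplus>i\<in>I. c i \<otimes> \<phi> i x)"
    define B where "B = (\<Oplus>i\<in>I. c i \<otimes> \<phi> i (op y x))"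
    have AB: "A \<in> carrier R" "B \<in> carrier R"
      using c closed x y S by (auto simp: A_def B_def intro!: finsum_closed)
    have ck: "c k \<in> carrier R" "\<phi> k x \<in> carrier R" "\<phi> k y \<in> carrier R" using c closed x y by auto
    have "(\<Oplus>i\<in>I. c i \<otimes> (\<phi> i y \<ominus> \<phi> k y) \<otimes> \<phi> i x)
        = (\<Oplus>i\<in>I. c i \<otimes> \<phi> i (op y x) \<oplus> (\<ominus> \<phi> k y) \<otimes> (c i \<otimes> \<phi> i x))"
    proof (rule finsum_cong')
      fix i assume i: "i \<in> I"
      have "c i \<in> carrier R" "\<phi> i x \<in> carrier R" "\<phi> i y \<in> carrier R" "\<phi> k y \<in> carrier R"
        using c closed x y i by auto
      moreover have "\<phi> i (op y x) = \<phi> i y \<otimes> \<phi> i x" using mult i x y by blast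
      ultimately show "c i \<otimes> (\<phi> i y \<ominus> \<phi> k y) \<otimes> \<phi> i x
          = c i \<otimes> \<phi> i (op y x) \<oplus> (\<ominus> \<phi> k y) \<otimes> (c i \<otimes> \<phi> i x)"
        by (simp add: minus_eq) algebra
    qed (use c closed x y S in \<open>auto intro!: m_closed\<close>)
    also have "\<dots> = B \<oplus> (\<ominus> \<phi> k y) \<otimes> A"
      using insert.hyps c closed x y S unfolding A_def B_def
      by (subst finsum_addf) (auto simp: finsum_rdistr Pi_def)
    also have "\<dots> = \<zero>"
    proof -
      have 1: "c k \<otimes> (\<phi> k y \<otimes> \<phi> k x) \<oplus> B = \<zero>"
        using sum[of "op y x"] S x y mult[of k y x] by (simp add: B_def)
      have 2: "c k \<otimes> \<phi> k x \<oplus> A = \<zero>" using sum[OF x] by (simp add: A_def)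
      have "B \<oplus> (\<ominus> \<phi> k y) \<otimes> A
          = (c k \<otimes> (\<phi> k y \<otimes> \<phi> k x) \<oplus> B) \<oplus> (\<ominus> \<phi> k y) \<otimes> (c k \<otimes> \<phi> k x \<oplus> A)"
        using AB ck by algebra
      then show ?thesis using 1 2 ck by simp
    qed
    finally show "(\<Oplus>i\<in>I. c i \<otimes> (\<phi> i y \<ominus> \<phi> k y) \<otimes> \<phi> i x) = \<zero>" .
  qed (use closed mult one dist c y in \<open>auto simp: minus_eq\<close>)
  note * = this
  have cI: "c i = \<zero>" if i: "i \<in> I" for i
  proof -
    have "i \<noteq> k" using i insert.hyps by auto
    then obtain y where y: "y \<in> S" "\<phi> i y \<noteq> \<phi> k y" using dist[of i k] i by auto
    have cl: "c i \<in> carrier R" "\<phi> i y \<in> carrier R" "\<phi> k y \<in> carrier R" using c closed i y by auto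
    have "\<phi> i y \<ominus> \<phi> k y \<noteq> \<zero>" using cl y(2) by (metis r_right_minus_eq)
    moreover have "c i \<otimes> (\<phi> i y \<ominus> \<phi> k y) = \<zero>" using *[OF y(1)] i by blast
    ultimately show ?thesis using cl by (metis integral minus_closed)
  qed
  \<comment> \<open>Only the term \<open>k\<close> is left, and at \<open>u\<close> it is
    \<open>c k\<close> itself.\<close>
  have "(\<Oplus>i\<in>I. c i \<otimes> \<phi> i u) = (\<Oplus>i\<in>I. \<zero>)"
    using cI closed S(2) by (intro finsum_cong') auto
  then have "c k = \<zero>" using sum[OF S(2)] one[of k] c[of k] by simp
  with cI show ?case by auto
qed simp

text \<open>With more than \<open>n\<close> embeddings, the \<open>n\<close> equations at the basis
  vectors have a nontrivial solution \<open>c\<close>. The resulting \<open>K\<close>-linear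
  combination of embeddings vanishes on a basis and so on all of \<open>F\<close>, against
  Dedekind.\<close>

lemma card_embeddings_le_dimension:
  assumes K: "subfield K R" and F: "subring F R" "K \<subseteq> F" and dim: "dimension n K F"
    and I: "finite I" and hom: "\<And>i. i \<in> I \<Longrightarrow> \<phi> i \<in> ring_hom (R\<lparr>carrier := F\<rparr>) R"
    and fixK: "\<And>i k. i \<in> I \<Longrightarrow> k \<in> K \<Longrightarrow> \<phi> i k = k"
    and dist: "\<And>i j. i \<in> I \<Longrightarrow> j \<in> I \<Longrightarrow> i \<noteq> j \<Longrightarrow> \<exists>x\<in>F. \<phi> i x \<noteq> \<phi> j x"
  shows "card I \<le> n"
proof (rule ccontr)
  assume "\<not> card I \<le> n"
  then have less: "n < card I" by simp
  obtain Us where Us: "set Us \<subseteq> carrier R" "length Us = n" "Span K Us = F"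
    using exists_base[OF K dim] by blast
  have UF: "set Us \<subseteq> F" using Span_base_incl[OF K Us(1)] Us(3) by simp
  note Fc = subringE(1)[OF F(1)] and Fs = subringE[OF F(1)]
  have h: "\<phi> i x \<in> carrier R" "\<phi> i (x \<otimes> y) = \<phi> i x \<otimes> \<phi> i y" "\<phi> i (x \<oplus> y) = \<phi> i x \<oplus> \<phi> i y"
      "\<phi> i \<one> = \<one>" if "i \<in> I" "x \<in> F" "y \<in> F" for i x y
    using hom[OF that(1)] that(2,3) by (auto simp: ring_hom_def)
  have "Us ! l \<in> F" if "l < n" for l using UF Us(2) that by auto
  then have "\<phi> i (Us ! l) \<in> carrier R" if "l < n" "i \<in> I" for l i using h(1) that by blast
  then have "\<exists>c. (\<forall>i\<in>I. c i \<in> carrier R) \<and> (\<exists>i\<in>I. c i \<noteq> \<zero>) \<and>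
      (\<forall>l<n. (\<Oplus>i\<in>I. \<phi> i (Us ! l) \<otimes> c i) = \<zero>)"
    by (intro homogeneous_system_nontrivial_solution[OF I less]) auto
  then obtain c where c: "\<forall>i\<in>I. c i \<in> carrier R" "\<exists>i\<in>I. c i \<noteq> \<zero>"
      "\<forall>l<n. (\<Oplus>i\<in>I. \<phi> i (Us ! l) \<otimes> c i) = \<zero>" by blast
  define T where "T x = (\<Oplus>i\<in>I. c i \<otimes> \<phi> i x)" for x
  have T_closed: "T x \<in> carrier R" if "x \<in> F" for x
    using that c(1) h(1) by (auto simp: T_def intro!: finsum_closed)
  have T_add: "T (x \<oplus> y) = T x \<oplus> T y" if "x \<in> F" "y \<in> F" for x y
  proof -
    have "T (x \<oplus> y) = (\<Oplus>i\<in>I. c i \<otimes> \<phi> i x \<oplus> c i \<otimes> \<phi> i y)"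
      unfolding T_def using that c(1) h by (intro finsum_cong') (auto simp: r_distr)
    then show ?thesis
      using that c(1) h(1) by (simp add: T_def finsum_addf Pi_def)
  qed
  have T_smult: "T (k \<otimes> x) = k \<otimes> T x" if "k \<in> K" "x \<in> F" for k x
  proof -
    have "T (k \<otimes> x) = (\<Oplus>i\<in>I. k \<otimes> (c i \<otimes> \<phi> i x))"
      unfolding T_def
    proof (rule finsum_cong')
      fix i assume i: "i \<in> I"
      have "\<phi> i (k \<otimes> x) = k \<otimes> \<phi> i x" using h(2) fixK that i F(2) by auto
      then show "c i \<otimes> \<phi> i (k \<otimes> x) = k \<otimes> (c i \<otimes> \<phi> i x)"
        using i that c(1) h(1) F(2) Fc by (simp add: m_lcomm subset_iff)
    qed (use that c(1) h(1) F(2) Fc in auto)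
    then show ?thesis
      using that c(1) h(1) I F(2) Fc by (simp add: T_def finsum_rdistr Pi_def subset_iff)
  qed
  have T0: "T \<zero> = \<zero>"
    using T_add[of \<zero> \<zero>] T_closed[of \<zero>] Fs(2) by (metis Units_one_closed add.r_cancel_one' r_zero zero_closed)
  \<comment> \<open>\<open>subalgebra\<close> only asks for an additive subgroup stable under
    scaling by \<open>K\<close>, so the kernel of the linear map \<open>T\<close> qualifies and
    contains the span of the basis.\<close>
  have "subalgebra K {x \<in> F. T x = \<zero>} R"
  proof (intro subalgebra.intro subalgebra_axioms.intro add.subgroupI)
    fix x assume x: "x \<in> {x \<in> F. T x = \<zero>}"
    have "T (\<ominus> x) = T x \<oplus> T (\<ominus> x)" using x T_closed[of "\<ominus> x"] Fs by auto
    also have "\<dots> = T (x \<oplus> \<ominus> x)" using x Fs by (subst T_add) auto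
    also have "\<dots> = \<zero>" using x Fc T0 by (auto simp: r_neg)
    finally show "\<ominus> x \<in> {x \<in> F. T x = \<zero>}" using x Fs by auto
  qed (use Fs T_add T_smult T0 F(2) Fc in auto)
  moreover have "set Us \<subseteq> {x \<in> F. T x = \<zero>}"
  proof
    fix x assume "x \<in> set Us"
    then obtain l where l: "l < n" "x = Us ! l" using Us(2) by (metis in_set_conv_nth)
    have x: "x \<in> F" using \<open>x \<in> set Us\<close> UF by auto
    have "T x = (\<Oplus>i\<in>I. \<phi> i (Us ! l) \<otimes> c i)"
      unfolding T_def l(2)[symmetric] using c(1) h(1) x by (intro finsum_cong') (auto simp: m_comm)
    then show "x \<in> {x \<in> F. T x = \<zero>}" using c(3) l x by simp
  qed
  ultimately have "F \<subseteq> {x \<in> F. T x = \<zero>}"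
    using subalgebra_Span_incl[OF K] Us(3) by blast
  then have "\<And>x. x \<in> F \<Longrightarrow> (\<Oplus>i\<in>I. c i \<otimes> \<phi> i x) = \<zero>" by (auto simp: T_def)
  then have "\<forall>i\<in>I. c i = \<zero>"
    using I c(1) h(1,2,4) dist Fs(3,6) by (intro dedekind_independence[where op = "(\<otimes>)" and S = F and u = \<one> and \<phi> = \<phi>]) auto
  with c(2) show False by blast
qed

end

section \<open>Degree over the fixed field of an automorphism of finite order\<close>

lemma funpow_mult_fixed:
  assumes "(f ^^ k) x = x"
  shows "(f ^^ (k * j)) x = x"
proof -
  have "((f ^^ k) ^^ j) x = x" using assms by (induction j) auto
  then show ?thesis by (simp add: funpow_mult)
qed

context field
begin

lemma fixed_subfield:
  assumes "\<tau> \<in> ring_hom R R"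
  shows "subfield {x \<in> carrier R. \<tau> x = x} R"
proof -
  interpret \<tau>: ring_hom_cring R R \<tau> using assms by unfold_locales
  show ?thesis
  proof (intro subfieldI' subringI)
    fix k assume "k \<in> {x \<in> carrier R. \<tau> x = x} - {\<zero>}"
    then have k: "k \<in> carrier R" "\<tau> k = k" "k \<in> Units R" using field_Units by auto
    then have "inv k \<in> carrier R" "k \<otimes> \<tau> (inv k) = \<one>"
      by (auto simp flip: \<tau>.hom_mult[of k "inv k", unfolded k(2)])
    then have "\<tau> (inv k) = inv k" using k by (metis comm_inv_char \<tau>.hom_closed)
    then show "inv k \<in> {x \<in> carrier R. \<tau> x = x}" using k by auto
  qed auto
qed

context
  fixes \<tau> and d :: nat
  assumes hom: "\<tau> \<in> ring_hom R R" and d: "0 < d"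
    and period: "\<And>x. x \<in> carrier R \<Longrightarrow> (\<tau> ^^ d) x = x"
    and exact: "\<And>k. 0 < k \<Longrightarrow> k < d \<Longrightarrow> \<exists>x\<in>carrier R. (\<tau> ^^ k) x \<noteq> x"
begin

interpretation pow: ring_hom_cring R R "\<tau> ^^ k" for k
  using funpow_ring_hom[OF hom] by unfold_locales

lemma funpow_distinct:
  assumes "i < d" "j < d" "i \<noteq> j"
  shows "\<exists>x\<in>carrier R. (\<tau> ^^ i) x \<noteq> (\<tau> ^^ j) x"
proof -
  have *: "\<exists>x\<in>carrier R. (\<tau> ^^ i) x \<noteq> (\<tau> ^^ j) x" if ij: "i < j" "j < d" for i j
  proof (rule ccontr)
    assume "\<not> ?thesis"
    then have eq: "(\<tau> ^^ i) x = (\<tau> ^^ j) x" if "x \<in> carrier R" for x using that by blast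
    have "(\<tau> ^^ (j - i)) x = x" if x: "x \<in> carrier R" for x
    proof -
      \<comment> \<open>Inserting the trivial iterate \<open>\<tau> ^^ d\<close> replaces an inverse
        of \<open>\<tau> ^^ i\<close>: the exponents satisfy (j - i) + d = (d - i) + j.\<close>
      have "(\<tau> ^^ (j - i)) x = (\<tau> ^^ (j - i)) ((\<tau> ^^ d) x)" using period x by simp
      also have "\<dots> = (\<tau> ^^ (d - i)) ((\<tau> ^^ j) x)"
        using ij by (simp add: add.commute flip: funpow_add comp_apply[of "\<tau> ^^ _"])
      also have "\<dots> = (\<tau> ^^ (d - i)) ((\<tau> ^^ i) x)" using eq x by simp
      also have "\<dots> = (\<tau> ^^ d) x"
        using ij by (simp flip: funpow_add comp_apply[of "\<tau> ^^ _"])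
      finally show ?thesis using period x by simp
    qed
    moreover have "0 < j - i" "j - i < d" using ij by linarith+
    ultimately show False using exact by blast
  qed
  show ?thesis
  proof (cases "i < j")
    case False
    then have "j < i" using assms(3) by simp
    from *[OF this assms(1)] show ?thesis by metis
  qed (use * assms in blast)
qed

text \<open>The trace to the fixed field of \<open>\<tau>\<close>.\<close>

definition orbit_trace :: "'a \<Rightarrow> 'a"
  where "orbit_trace x = (\<Oplus>k\<in>{..<d}. (\<tau> ^^ k) x)"

lemma orbit_trace_closed: "x \<in> carrier R \<Longrightarrow> orbit_trace x \<in> carrier R"
  unfolding orbit_trace_def by (auto intro!: finsum_closed)

lemma orbit_trace_fixed:
  assumes x: "x \<in> carrier R"
  shows "\<tau> (orbit_trace x) = orbit_trace x"
proof -
  obtain c where c: "d = Suc c" using d by (cases d) auto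
  have fc: "(\<lambda>k. (\<tau> ^^ k) x) \<in> A \<rightarrow> carrier R" for A using x by auto
  have "\<tau> (orbit_trace x) = (\<Oplus>k\<in>{..c}. (\<tau> ^^ Suc k) x)"
    using ring_hom_finsum[OF hom fc] by (simp add: orbit_trace_def flip: lessThan_Suc_atMost c)
  \<comment> \<open>The sum of the iterates 0 to \<open>d\<close> is split in two ways: without its
    first term \<open>x\<close> it is the image of the trace, without its last term, again
    \<open>x\<close> by periodicity, it is the trace.\<close>
  then have "\<tau> (orbit_trace x) \<oplus> x = (\<Oplus>k\<in>{..Suc c}. (\<tau> ^^ k) x)"
    using finsum_Suc2[OF fc, of c] by simp
  also have "\<dots> = x \<oplus> orbit_trace x"
    using finsum_Suc[OF fc, of c] period[OF x] by (simp add: orbit_trace_def flip: lessThan_Suc_atMost c)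
  finally show ?thesis
    using x orbit_trace_closed[OF x] ring_hom_closed[OF hom] by (metis a_comm add.r_cancel)
qed

text \<open>A vanishing trace would be a linear relation with all coefficients 1 between the
  distinct characters \<open>\<tau> ^^ k\<close>.\<close>

lemma orbit_trace_nonzero: "\<exists>y\<in>carrier R. orbit_trace y \<noteq> \<zero>"
proof (rule ccontr)
  assume no: "\<not> (\<exists>y\<in>carrier R. orbit_trace y \<noteq> \<zero>)"
  have *: "(\<Oplus>k\<in>{..<d}. \<one> \<otimes> (\<tau> ^^ k) y) = \<zero>" if "y \<in> carrier R" for y
  proof -
    have "(\<Oplus>k\<in>{..<d}. \<one> \<otimes> (\<tau> ^^ k) y) = orbit_trace y"
      unfolding orbit_trace_def using that by (intro finsum_cong') auto
    with no that show ?thesis by simp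
  qed
  have "\<forall>k\<in>{..<d}. \<one> = \<zero>"
    by (rule dedekind_independence[where op = "(\<otimes>)" and S = "carrier R" and u = \<one> and \<phi> = "\<lambda>k. \<tau> ^^ k"])
      (use * funpow_distinct in auto)
  then show False using d by auto
qed

text \<open>Artin's argument: if \<open>c\<close> solves the conjugated system, so does every conjugate of \<open>c\<close>. After
  scaling one entry to have nonzero trace, the sum of the conjugates is a nontrivial relation with
  coefficients in the fixed field.\<close>

lemma dimension_over_fixed_le:
  assumes dim: "dimension D {x \<in> carrier R. \<tau> x = x} (carrier R)"
  shows "D \<le> d"
proof (rule ccontr)
  let ?F = "{x \<in> carrier R. \<tau> x = x}"
  assume "\<not> D \<le> d"
  then have less: "d < card {..<D}" by simp
  note F = fixed_subfield[OF hom]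
  obtain Us where Us: "set Us \<subseteq> carrier R" "independent ?F Us" "length Us = D"
    using exists_base[OF F dim] by blast
  have U: "Us ! i \<in> carrier R" if "i < D" for i using that Us by auto
  have "\<exists>c. (\<forall>i\<in>{..<D}. c i \<in> carrier R) \<and> (\<exists>i\<in>{..<D}. c i \<noteq> \<zero>) \<and>
      (\<forall>j<d. (\<Oplus>i\<in>{..<D}. (\<tau> ^^ j) (Us ! i) \<otimes> c i) = \<zero>)"
    using U by (intro homogeneous_system_nontrivial_solution less) auto
  then obtain c i0 where c: "\<And>i. i < D \<Longrightarrow> c i \<in> carrier R" and i0: "i0 < D" "c i0 \<noteq> \<zero>"
    and sol: "\<And>j. j < d \<Longrightarrow> (\<Oplus>i\<in>{..<D}. (\<tau> ^^ j) (Us ! i) \<otimes> c i) = \<zero>" by auto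
  obtain y where y: "y \<in> carrier R" "orbit_trace y \<noteq> \<zero>" using orbit_trace_nonzero by blast
  have inv: "inv (c i0) \<in> carrier R" "c i0 \<otimes> inv (c i0) = \<one>"
    using c[OF i0(1)] i0(2) field_Units by auto
  define z where "z = inv (c i0) \<otimes> y"
  define b where "b i = c i \<otimes> z" for i
  have z: "z \<in> carrier R" using inv y by (simp add: z_def)
  have b: "b i \<in> carrier R" if "i < D" for i using c[OF that] z by (simp add: b_def)
  have "b i0 = y" using c[OF i0(1)] inv y by (simp add: b_def z_def m_assoc[symmetric])
  have bsol: "(\<Oplus>i\<in>{..<D}. (\<tau> ^^ j) (Us ! i) \<otimes> b i) = \<zero>" if j: "j < d" for j
  proof -
    have "(\<Oplus>i\<in>{..<D}. (\<tau> ^^ j) (Us ! i) \<otimes> b i) = (\<Oplus>i\<in>{..<D}. ((\<tau> ^^ j) (Us ! i) \<otimes> c i) \<otimes> z)"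
      using U c z by (intro finsum_cong') (auto simp: b_def m_assoc)
    also have "\<dots> = (\<Oplus>i\<in>{..<D}. (\<tau> ^^ j) (Us ! i) \<otimes> c i) \<otimes> z"
      using U c z by (subst finsum_ldistr) auto
    finally show ?thesis using sol[OF j] z by simp
  qed
  have conjugate: "(\<Oplus>i\<in>{..<D}. (\<tau> ^^ k) (b i) \<otimes> Us ! i) = \<zero>" if k: "k < d" for k
  proof -
    \<comment> \<open>\<open>\<tau> ^^ j\<close> inverts \<open>\<tau> ^^ k\<close>, so applying
      \<open>\<tau> ^^ k\<close> to equation \<open>j\<close> moves the conjugation from the basis
      vectors to the coefficients.\<close>
    define j where "j = (if k = 0 then 0 else d - k)"
    have j: "j < d" using k d by (auto simp: j_def)
    have inverse: "(\<tau> ^^ k) ((\<tau> ^^ j) x) = x" if "x \<in> carrier R" for x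
      using period[OF that] k by (auto simp: j_def simp flip: funpow_add comp_apply[of "\<tau> ^^ _"])
    have "\<zero> = (\<tau> ^^ k) (\<Oplus>i\<in>{..<D}. (\<tau> ^^ j) (Us ! i) \<otimes> b i)" using bsol[OF j] by simp
    also have "\<dots> = (\<Oplus>i\<in>{..<D}. (\<tau> ^^ k) ((\<tau> ^^ j) (Us ! i) \<otimes> b i))"
      using U b by (intro ring_hom_finsum funpow_ring_hom hom) auto
    also have "\<dots> = (\<Oplus>i\<in>{..<D}. (\<tau> ^^ k) (b i) \<otimes> Us ! i)"
      using U b by (intro finsum_cong') (auto simp: inverse m_comm)
    finally show ?thesis by simp
  qed
  have "combine (map (\<lambda>i. orbit_trace (b i)) [0..<length Us]) Us
      = (\<Oplus>i\<in>{..<D}. orbit_trace (b i) \<otimes> Us ! i)"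
    using combine_eq_finsum[OF Us(1), of "\<lambda>i. orbit_trace (b i)"] b orbit_trace_closed Us(3) by simp
  also have "\<dots> = (\<Oplus>i\<in>{..<D}. \<Oplus>k\<in>{..<d}. (\<tau> ^^ k) (b i) \<otimes> Us ! i)"
    using U b by (intro finsum_cong') (auto simp: orbit_trace_def finsum_ldistr Pi_def intro!: finsum_closed)
  also have "\<dots> = (\<Oplus>k\<in>{..<d}. \<Oplus>i\<in>{..<D}. (\<tau> ^^ k) (b i) \<otimes> Us ! i)"
    using U b by (intro finsum_swap) auto
  also have "\<dots> = (\<Oplus>k\<in>{..<d}. \<zero>)"
    using conjugate by (intro finsum_cong') auto
  finally have "combine (map (\<lambda>i. orbit_trace (b i)) [0..<length Us]) Us = \<zero>" by simp
  moreover have "set (map (\<lambda>i. orbit_trace (b i)) [0..<length Us]) \<subseteq> ?F"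
    using b orbit_trace_closed orbit_trace_fixed Us(3) by auto
  ultimately have "set (map (\<lambda>i. orbit_trace (b i)) [0..<length Us]) \<subseteq> {\<zero>}"
    using independent_imp_trivial_combine[OF F Us(2), of "map (\<lambda>i. orbit_trace (b i)) [0..<length Us]"]
    by (simp only: length_map length_upt take_all_iff diff_zero order_refl take_all)
  then have "orbit_trace (b i0) = \<zero>" using i0(1) Us(3) by (simp add: image_subset_iff)
  with \<open>b i0 = y\<close> y(2) show False by simp
qed

text \<open>Artin's argument bounds the degree above; below, the \<open>d\<close> distinct iterates
  of \<open>\<tau>\<close> are embeddings over the fixed field.\<close>

lemma dimension_over_fixed:
  assumes dim: "dimension D {x \<in> carrier R. \<tau> x = x} (carrier R)"
  shows "D = d"
proof (rule antisym)
  show "D \<le> d" by (rule dimension_over_fixed_le[OF dim])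
  have "card {..<d} \<le> D"
  proof (rule card_embeddings_le_dimension[OF fixed_subfield[OF hom] carrier_is_subring _ dim, where \<phi> = "\<lambda>k. \<tau> ^^ k"])
    fix k x assume "x \<in> {x \<in> carrier R. \<tau> x = x}"
    then show "(\<tau> ^^ k) x = x" using funpow_mult_fixed[where f = \<tau> and k = 1 and j = k] by simp
  qed (use funpow_distinct pow.homh in auto)
  then show "d \<le> D" by simp
qed

end

end

section \<open>Intermediate fields of a cyclic extension of prime power degree\<close>

locale cyclic_extension = field L for L :: "('a, 'm) ring_scheme" (structure) +
  fixes K :: "'a set" and \<sigma> :: "'a \<Rightarrow> 'a" and p n :: nat
  assumes hom: "\<sigma> \<in> ring_hom L L"
    and fixed: "K = {x \<in> carrier L. \<sigma> x = x}"
    and period: "\<And>x. x \<in> carrier L \<Longrightarrow> (\<sigma> ^^ (p ^ n)) x = x"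
    and exact: "\<And>k. 0 < k \<Longrightarrow> k < p ^ n \<Longrightarrow> \<exists>x\<in>carrier L. (\<sigma> ^^ k) x \<noteq> x"
    and dim: "dimension (p ^ n) K (carrier L)"
    and p: "Factorial_Ring.prime p"
begin

lemma K_subfield: "subfield K L"
  unfolding fixed by (rule fixed_subfield[OF hom])

lemma pos: "0 < p ^ m"
  using p by (simp add: prime_gt_0_nat)

definition layer :: "nat \<Rightarrow> 'a set"
  where "layer m = {x \<in> carrier L. (\<sigma> ^^ (p ^ m)) x = x}"

lemma layer_subfield: "subfield (layer m) L"
  unfolding layer_def by (rule fixed_subfield[OF funpow_ring_hom[OF hom]])

lemma layer_0: "layer 0 = K"
  by (simp add: layer_def fixed)

lemma K_subset_layer: "K \<subseteq> layer m"
  using funpow_mult_fixed[where f = \<sigma> and k = 1 and j = "p ^ m"] by (auto simp: layer_def fixed)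

text \<open>The iterate of \<sigma> defining \<open>layer m\<close> has exact period
  \<open>p ^ (n - m)\<close>, which is therefore the degree of \<open>L\<close> over
  \<open>layer m\<close>; the tower law leaves \<open>p ^ m\<close> for the lower step.\<close>

lemma layer_dimension:
  assumes m: "m \<le> n"
  shows "dimension (p ^ m) K (layer m)"
proof -
  let ?E = "layer m"
  have fdL: "finite_dimension K (carrier L)" using dim by (rule finite_dimensionI)
  note E = layer_subfield[of m]
  have Es: "subring ?E L" using subfieldE(1)[OF E] .
  have "subgroup ?E (add_monoid L)" using Es by (simp add: subring.axioms(1))
  then have "subalgebra K ?E L"
    using K_subset_layer[of m] subringE(6)[OF Es] by (auto simp: subalgebra_def subalgebra_axioms_def)
  then have "finite_dimension K ?E"
    using subalbegra_incl_imp_finite_dimension[OF K_subfield fdL] subringE(1)[OF Es] by blast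
  then obtain a where a: "dimension a K ?E" by (rule finite_dimensionE')
  obtain Us where Us: "set Us \<subseteq> carrier L" "Span K Us = carrier L"
    using exists_base[OF K_subfield dim] by blast
  \<comment> \<open>A finite spanning set over \<open>K\<close> also spans over the larger field.
    This provides a finite degree \<open>b\<close>, to which the theorem on fixed fields can then be
    applied.\<close>
  have "Span K Us \<subseteq> Span ?E Us"
    using K_subset_layer[of m] unfolding Span_eq_combine_set[OF K_subfield Us(1)] Span_eq_combine_set[OF E Us(1)]
    by blast
  then have "Span ?E Us = carrier L"
    using Us Span_in_carrier[OF subringE(1)[OF Es] Us(1)] by auto
  then obtain b where b: "dimension b ?E (carrier L)"
    using Span_finite_dimension[OF E Us(1)] by (auto elim: finite_dimensionE')
  have pm: "p ^ m * p ^ (n - m) = p ^ n" using m by (simp flip: power_add)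
  have "b = p ^ (n - m)"
  proof (rule dimension_over_fixed)
    show "\<sigma> ^^ (p ^ m) \<in> ring_hom L L" by (rule funpow_ring_hom[OF hom])
    show "0 < p ^ (n - m)" by (rule pos)
    show "\<And>x. x \<in> carrier L \<Longrightarrow> ((\<sigma> ^^ p ^ m) ^^ p ^ (n - m)) x = x"
      using period by (simp add: funpow_mult pm)
    show "\<exists>x\<in>carrier L. ((\<sigma> ^^ p ^ m) ^^ k) x \<noteq> x" if "0 < k" "k < p ^ (n - m)" for k
    proof -
      have "p ^ m * k < p ^ m * p ^ (n - m)" using that pos[of m] by simp
      then show ?thesis using exact[of "p ^ m * k"] that pos[of m] by (simp add: funpow_mult pm)
    qed
    show "dimension b {x \<in> carrier L. (\<sigma> ^^ p ^ m) x = x} (carrier L)"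
      using b by (simp add: layer_def)
  qed
  then have "dimension (a * p ^ (n - m)) K (carrier L)"
    using telescopic_base[OF K_subfield E a] b by blast
  then have "a * p ^ (n - m) = p ^ m * p ^ (n - m)"
    unfolding pm by (rule dimension_is_inj[OF K_subfield _ dim])
  then have "a = p ^ m" using pos[of "n - m"] by (metis mult_cancel2 less_numeral_extra(3))
  with a show ?thesis by simp
qed

lemma funpow_inj:
  assumes "x \<in> carrier L" "y \<in> carrier L" "(\<sigma> ^^ k) x = (\<sigma> ^^ k) y"
  shows "x = y"
proof -
  have hk: "\<sigma> ^^ k \<in> ring_hom L L" by (rule funpow_ring_hom[OF hom])
  interpret ring_hom_cring L L "\<sigma> ^^ k" using hk by unfold_locales
  have "inj_on (\<sigma> ^^ k) (carrier L)" by (rule non_trivial_field_hom_is_inj) (auto intro: field_axioms)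
  then show ?thesis using assms by (meson inj_onD)
qed

text \<open>Since there are at most \<open>p\<^sup>m\<close> embeddings of \<open>F\<close> over \<open>K\<close>, some \<open>\<sigma>\<^sup>k\<close> with \<open>0 < k \<le> p\<^sup>m\<close> fixes \<open>F\<close>,
  and so does \<open>\<sigma>\<^bsup>gcd(k, p^n)\<^esup>\<close>.\<close>

lemma subset_layer:
  assumes F: "subfield F L" "K \<subseteq> F" and dimF: "dimension (p ^ m) K F"
  shows "F \<subseteq> layer m"
proof -
  have Fs: "subring F L" using subfieldE(1)[OF F(1)] .
  note Fc = subringE(1)[OF Fs]
  have "\<exists>i j. i \<le> p ^ m \<and> j \<le> p ^ m \<and> i < j \<and> (\<forall>x\<in>F. (\<sigma> ^^ i) x = (\<sigma> ^^ j) x)"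
  proof (rule ccontr)
    assume no: "\<not> ?thesis"
    have "card {..p ^ m} \<le> p ^ m"
    proof (rule card_embeddings_le_dimension[OF K_subfield Fs F(2) dimF, where \<phi> = "\<lambda>k. \<sigma> ^^ k"])
      fix i assume "i \<in> {..p ^ m}"
      show "\<sigma> ^^ i \<in> ring_hom (L\<lparr>carrier := F\<rparr>) L"
        using funpow_ring_hom[OF hom, of i] Fc by (auto simp: ring_hom_def Pi_def subset_iff)
    next
      fix i k assume "k \<in> K"
      then show "(\<sigma> ^^ i) k = k" using funpow_mult_fixed[where f = \<sigma> and k = 1 and j = i] by (simp add: fixed)
    next
      fix i j assume "i \<in> {..p ^ m}" "j \<in> {..p ^ m}" "i \<noteq> j"
      then show "\<exists>x\<in>F. (\<sigma> ^^ i) x \<noteq> (\<sigma> ^^ j) x" using no by (metis atMost_iff linorder_neqE_nat)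
    qed simp
    then show False by simp
  qed
  then obtain i j where ij: "j \<le> p ^ m" "i < j" "\<And>x. x \<in> F \<Longrightarrow> (\<sigma> ^^ i) x = (\<sigma> ^^ j) x" by blast
  define k where "k = j - i"
  have k: "0 < k" "k \<le> p ^ m" using ij by (auto simp: k_def)
  have kF: "(\<sigma> ^^ k) x = x" if x: "x \<in> F" for x
  proof -
    have "(\<sigma> ^^ i) ((\<sigma> ^^ k) x) = (\<sigma> ^^ i) x"
      using ij(2) ij(3)[OF x] by (simp add: k_def flip: funpow_add comp_apply[of "\<sigma> ^^ _"])
    then show ?thesis
      using funpow_inj[of "(\<sigma> ^^ k) x" x i] x Fc funpow_ring_hom[OF hom, of k]
      by (meson ring_hom_closed subsetD)
  qed
  define g where "g = gcd k (p ^ n)"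
  \<comment> \<open>Bezout's identity without subtraction can be read as an identity between
    iterates of \<sigma>.\<close>
  obtain a b where ab: "k * a = p ^ n * b + g" using bezout_nat[of k "p ^ n"] k by (auto simp: g_def)
  have gF: "(\<sigma> ^^ g) x = x" if x: "x \<in> F" for x
  proof -
    have "(\<sigma> ^^ g) x = (\<sigma> ^^ g) ((\<sigma> ^^ (p ^ n * b)) x)"
      using funpow_mult_fixed[OF period] x Fc by auto
    also have "\<dots> = (\<sigma> ^^ (k * a)) x"
      unfolding ab by (simp add: add.commute flip: funpow_add comp_apply[of "\<sigma> ^^ _"])
    finally show ?thesis using funpow_mult_fixed[OF kF[OF x]] by simp
  qed
  have "g dvd p ^ n" by (simp add: g_def)
  then obtain t where t: "g = p ^ t" using p by (metis divides_primepow_nat)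
  have "p ^ t \<le> p ^ m" using k t by (metis dvd_imp_le g_def gcd_dvd1 le_trans)
  then have "p ^ m = g * p ^ (m - t)"
    using prime_gt_1_nat[OF p] by (simp add: t flip: power_add)
  then show ?thesis using funpow_mult_fixed[OF gF] Fc by (auto simp: layer_def)
qed

text \<open>Any other candidate is contained in \<open>layer m\<close> and has the same dimension
  over \<open>K\<close>, so a basis of it is already a basis of \<open>layer m\<close>.\<close>

lemma intermediate_field_eq_layer:
  assumes m: "m \<le> n"
  shows "intermediate_field L K (p ^ m) = layer m"
  unfolding intermediate_field_def
proof (rule the_equality)
  show "subfield (layer m) L \<and> K \<subseteq> layer m \<and> dimension (p ^ m) K (layer m)"
    using layer_subfield K_subset_layer layer_dimension[OF m] by blast
next
  fix F assume F: "subfield F L \<and> K \<subseteq> F \<and> dimension (p ^ m) K F"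
  then have sub: "F \<subseteq> layer m" using subset_layer by blast
  obtain Us where Us: "independent K Us" "length Us = p ^ m" "Span K Us = F" "set Us \<subseteq> carrier L"
    using exists_base[OF K_subfield] F by blast
  then have "set Us \<subseteq> layer m" using Span_base_incl[OF K_subfield Us(4)] sub by simp
  then show "F = layer m"
    using independent_length_eq_dimension[OF K_subfield layer_dimension[OF m] Us(1)] Us by simp
qed

end


section \<open>Products of algebras\<close>

lemma cring_axiomsI:
  fixes M (structure)
  assumes "\<And>x y. x \<in> carrier M \<Longrightarrow> y \<in> carrier M \<Longrightarrow> x \<oplus> y \<in> carrier M"
    and "\<zero> \<in> carrier M"
    and "\<And>x y z. x \<in> carrier M \<Longrightarrow> y \<in> carrier M \<Longrightarrow> z \<in> carrier M \<Longrightarrow> (x \<oplus> y) \<oplus> z = x \<oplus> (y \<oplus> z)"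
    and "\<And>x y. x \<in> carrier M \<Longrightarrow> y \<in> carrier M \<Longrightarrow> x \<oplus> y = y \<oplus> x"
    and "\<And>x. x \<in> carrier M \<Longrightarrow> \<zero> \<oplus> x = x"
    and "\<And>x. x \<in> carrier M \<Longrightarrow> \<exists>y\<in>carrier M. y \<oplus> x = \<zero>"
    and "\<And>x y. x \<in> carrier M \<Longrightarrow> y \<in> carrier M \<Longrightarrow> x \<otimes> y \<in> carrier M"
    and "\<one> \<in> carrier M"
    and "\<And>x y z. x \<in> carrier M \<Longrightarrow> y \<in> carrier M \<Longrightarrow> z \<in> carrier M \<Longrightarrow> (x \<otimes> y) \<otimes> z = x \<otimes> (y \<otimes> z)"
    and "\<And>x. x \<in> carrier M \<Longrightarrow> \<one> \<otimes> x = x"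
    and "\<And>x y. x \<in> carrier M \<Longrightarrow> y \<in> carrier M \<Longrightarrow> x \<otimes> y = y \<otimes> x"
    and "\<And>x y z. x \<in> carrier M \<Longrightarrow> y \<in> carrier M \<Longrightarrow> z \<in> carrier M \<Longrightarrow> (x \<oplus> y) \<otimes> z = x \<otimes> z \<oplus> y \<otimes> z"
  shows "cring M"
  by (intro cringI abelian_groupI comm_monoidI; fact assms)

lemma algebra_field_alg:
  assumes L: "field L" and K: "subfield K L" and F: "subfield F L" "K \<subseteq> F"
  shows "algebra (L\<lparr>carrier := K\<rparr>) (field_alg L F)"
proof -
  interpret field L by fact
  have Fs: "subring F L" using subfieldE(1)[OF F(1)] .
  have Fc: "x \<in> carrier L" if "x \<in> F" for x using subringE(1)[OF Fs] that by auto
  note Fp = subringE[OF Fs]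
  have cK: "cring (L\<lparr>carrier := K\<rparr>)"
    using K subfield_iff(2) fieldE(1) by blast
  have cF: "cring (field_alg L F)"
  proof (rule cring_axiomsI)
    fix x assume x: "x \<in> carrier (field_alg L F)"
    show "\<exists>y\<in>carrier (field_alg L F). y \<oplus>\<^bsub>field_alg L F\<^esub> x = \<zero>\<^bsub>field_alg L F\<^esub>"
      by (rule bexI[of _ "\<ominus>\<^bsub>L\<^esub> x"]) (use x Fp(5) in \<open>simp_all add: field_alg_def Fc l_neg\<close>)
  qed (simp_all add: field_alg_def Fp(2,3,6,7) Fc a_ac m_ac l_distr r_distr)
  show ?thesis
    by (rule algebraI[OF cK cF])
      (simp_all add: field_alg_def Fp(6) Fc subsetD[OF F(2)] m_assoc l_distr r_distr)
qed

lemma algebra_alg_prod: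
  assumes R: "cring R" and A: "\<And>i. i \<in> I \<Longrightarrow> algebra R (A i)"
  shows "algebra R (alg_prod I A)"
proof -
  have c: "cring (A i)" and m: "module R (A i)" if "i \<in> I" for i
    using A[OF that] by (auto intro: algebra.axioms algebra.M_cring)
  have r_one: "x \<otimes>\<^bsub>A i\<^esub> \<one>\<^bsub>A i\<^esub> = x" if "i \<in> I" "x \<in> carrier (A i)" for i x
    using c[OF that(1)] that(2) by (metis cring.cring_simprules(6,12,14))
  have cP: "cring (alg_prod I A)"
  proof (rule cring_axiomsI)
    fix x assume x: "x \<in> carrier (alg_prod I A)"
    show "\<exists>y\<in>carrier (alg_prod I A). y \<oplus>\<^bsub>alg_prod I A\<^esub> x = \<zero>\<^bsub>alg_prod I A\<^esub>"
      by (rule bexI[of _ "\<lambda>i\<in>I. \<ominus>\<^bsub>A i\<^esub> x i"])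
        (use x c in \<open>auto simp: alg_prod_def fun_eq_iff restrict_def PiE_iff extensional_def cring.cring_simprules\<close>)
  qed (use c in \<open>auto simp: alg_prod_def fun_eq_iff restrict_def PiE_iff extensional_def r_one cring.cring_simprules\<close>)
  show ?thesis
    by (rule algebraI[OF R cP])
      (auto simp: alg_prod_def fun_eq_iff restrict_def PiE_iff extensional_def module.smult_closed[OF m]
        module.smult_l_distr[OF m] module.smult_r_distr[OF m] module.smult_assoc1[OF m]
        module.smult_one[OF m] algebra.smult_assoc2[OF A])
qed

lemma algebra_alg_times:
  assumes A: "algebra R A" and B: "algebra R B"
  shows "algebra R (alg_times A B)"
proof -
  interpret A: algebra R A by fact
  interpret B: algebra R B by fact
  have cP: "cring (alg_times A B)"
  proof (rule cring_axiomsI)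
    fix x assume x: "x \<in> carrier (alg_times A B)"
    show "\<exists>y\<in>carrier (alg_times A B). y \<oplus>\<^bsub>alg_times A B\<^esub> x = \<zero>\<^bsub>alg_times A B\<^esub>"
      by (rule bexI[of _ "(\<ominus>\<^bsub>A\<^esub> fst x, \<ominus>\<^bsub>B\<^esub> snd x)"])
        (use x in \<open>auto simp: alg_times_def A.M_cring B.M_cring cring.cring_simprules\<close>)
  qed (auto simp: alg_times_def cring.cring_simprules[OF A.M_cring] cring.cring_simprules[OF B.M_cring])
  show ?thesis
    by (rule algebraI[OF A.R_cring cP])
      (auto simp: alg_times_def A.smult_l_distr B.smult_l_distr A.smult_r_distr B.smult_r_distr
        A.smult_assoc1 B.smult_assoc1 A.smult_assoc2 B.smult_assoc2)
qed

text \<open>Injectivity of \<open>h\<close> pulls every algebra axiom back from \<open>B\<close> to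
  \<open>A\<close>. Applied to the Hopf algebra, it yields associativity and commutativity of
  convolution from those of pointwise products.\<close>

lemma alg_isomorphic_transport:
  fixes A (structure)
  assumes B: "algebra R B" and bij: "bij_betw h (carrier A) (carrier B)"
    and add: "\<And>x y. x \<in> carrier A \<Longrightarrow> y \<in> carrier A \<Longrightarrow>
      x \<oplus> y \<in> carrier A \<and> h (x \<oplus> y) = h x \<oplus>\<^bsub>B\<^esub> h y"
    and mult: "\<And>x y. x \<in> carrier A \<Longrightarrow> y \<in> carrier A \<Longrightarrow>
      x \<otimes> y \<in> carrier A \<and> h (x \<otimes> y) = h x \<otimes>\<^bsub>B\<^esub> h y"
    and zero: "\<zero> \<in> carrier A" "h \<zero> = \<zero>\<^bsub>B\<^esub>" and one: "\<one> \<in> carrier A" "h \<one> = \<one>\<^bsub>B\<^esub>"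
    and smult: "\<And>k x. k \<in> carrier R \<Longrightarrow> x \<in> carrier A \<Longrightarrow>
      k \<odot>\<^bsub>A\<^esub> x \<in> carrier A \<and> h (k \<odot>\<^bsub>A\<^esub> x) = k \<odot>\<^bsub>B\<^esub> h x"
  shows "alg_isomorphic R A B"
proof -
  interpret B: algebra R B by fact
  have cl: "h x \<in> carrier B" if "x \<in> carrier A" for x
    using bij that by (auto simp: bij_betw_def)
  have eqI: "x = y" if "x \<in> carrier A" "y \<in> carrier A" "h x = h y" for x y
    using bij that by (auto simp: bij_betw_def inj_on_def)
  note rules = add mult zero one smult cl
  note B_rules = cring.cring_simprules[OF B.M_cring]
  have cA: "cring A"
  proof (rule cring_axiomsI)
    fix x assume x: "x \<in> carrier A"
    have "\<ominus>\<^bsub>B\<^esub> h x \<in> carrier B" using x cl by simp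
    then obtain y where y: "y \<in> carrier A" "h y = \<ominus>\<^bsub>B\<^esub> h x" using bij by (metis bij_betwE bij_betw_imp_surj_on imageE)
    show "\<exists>y\<in>carrier A. y \<oplus> x = \<zero>"
      by (rule bexI[OF _ y(1)], rule eqI) (use x y in \<open>auto simp: rules B.M.l_neg\<close>)
  qed (rule eqI | simp add: rules B_rules)+
  have "algebra R A"
    by (rule algebraI[OF B.R_cring cA])
      (rule eqI | simp add: rules B_rules(1) B.smult_l_distr B.smult_r_distr B.smult_assoc1 B.smult_assoc2)+
  moreover have "h \<in> ring_iso A B"
    using bij by (auto simp: ring_iso_def ring_hom_def rules)
  ultimately show ?thesis
    unfolding alg_isomorphic_def using B smult by blast
qed


section \<open>The discrete Fourier transform\<close>

text \<open>An injective self-map of the residues modulo \<open>q\<close> permutes them. It is used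
  for shifts and for multiplication by a unit.\<close>

lemma (in abelian_monoid) finsum_mod_reindex:
  fixes q :: nat
  assumes q: "0 < q" and F: "\<And>x. F x \<in> carrier G" "\<And>x y. [x = y] (mod q) \<Longrightarrow> F x = F y"
    and h: "\<And>x y. x < q \<Longrightarrow> y < q \<Longrightarrow> [h x = h y] (mod q) \<Longrightarrow> x = y"
  shows "(\<Oplus>y\<in>{..<q}. F (h y)) = (\<Oplus>x\<in>{..<q}. F x)"
proof -
  have inj: "inj_on (\<lambda>y. h y mod q) {..<q}"
    by (intro inj_onI h) (auto simp: cong_def)
  have "(\<lambda>y. h y mod q) ` {..<q} = {..<q}"
    by (rule endo_inj_surj) (use q inj in auto)
  then have "(\<Oplus>x\<in>{..<q}. F x) = (\<Oplus>x\<in>(\<lambda>y. h y mod q) ` {..<q}. F x)" by simp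
  also have "\<dots> = (\<Oplus>y\<in>{..<q}. F (h y mod q))"
    by (rule finsum_reindex) (use F inj in auto)
  also have "\<dots> = (\<Oplus>y\<in>{..<q}. F (h y))"
  proof (rule finsum_cong')
    show "F (h y mod q) = F (h y)" for y by (rule F(2)) (simp add: cong_def)
  qed (use F(1) in auto)
  finally show ?thesis by simp
qed

locale cyclic_dft = L?: field L + M: cyclic_gen M \<omega> q
  for L :: "('a, 'm) ring_scheme" (structure) and M :: "('g, 'n) monoid_scheme" and \<omega> q +
  fixes \<zeta> :: 'a
  assumes \<zeta>: "\<zeta> \<in> carrier L" and \<zeta>_one: "\<And>j :: nat. \<zeta> [^] j = \<one> \<longleftrightarrow> q dvd j"
    and char: "[q] \<cdot> \<one> \<noteq> \<zero>"
begin

lemmas q = M.pos and \<omega> = M.gen M.carrier_eq and \<omega>_eq = M.pow_eq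

text \<open>The value of the group algebra element \<open>f\<close> under the character of
  \<open>M\<close> that sends \<omega> to the \<open>j\<close>-th power of \<zeta>.\<close>

definition dft :: "('g \<Rightarrow> 'a) \<Rightarrow> nat \<Rightarrow> 'a"
  where "dft f j = (\<Oplus>i\<in>{..<q}. f (\<omega> [^]\<^bsub>M\<^esub> i) \<otimes> \<zeta> [^] (i * j))"

lemma \<zeta>_closed [simp]: "\<zeta> [^] (i :: nat) \<in> carrier L"
  using \<zeta> by simp

lemma \<zeta>_cong:
  assumes "[i = j] (mod q)"
  shows "\<zeta> [^] i = \<zeta> [^] j"
proof -
  have *: "\<zeta> [^] i = \<zeta> [^] (i mod q)" for i :: nat
  proof -
    have "\<zeta> [^] i = \<zeta> [^] (q * (i div q)) \<otimes> \<zeta> [^] (i mod q)"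
      using \<zeta> by (simp add: nat_pow_mult)
    moreover have "\<zeta> [^] (q * (i div q)) = \<one>" using \<zeta>_one by simp
    ultimately show ?thesis using \<zeta> by simp
  qed
  show ?thesis using *[of i] *[of j] assms by (simp add: cong_def)
qed

lemma group_alg_eval_closed:
  "f \<in> carrier (group_alg L M) \<Longrightarrow> x \<in> carrier M \<Longrightarrow> f x \<in> carrier L"
  by (auto simp: group_alg_def)

lemma dft_closed:
  assumes "f \<in> carrier (group_alg L M)"
  shows "dft f j \<in> carrier L"
  unfolding dft_def using group_alg_eval_closed[OF assms] by (auto intro!: finsum_closed)

lemma dft_cong:
  assumes f: "f \<in> carrier (group_alg L M)" and "[j = k] (mod q)"
  shows "dft f j = dft f k"
  unfolding dft_def
proof (intro finsum_cong')
  fix i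
  have "\<zeta> [^] (i * j) = \<zeta> [^] (i * k)" using assms(2) by (intro \<zeta>_cong cong_scalar_left)
  then show "f (\<omega> [^]\<^bsub>M\<^esub> i) \<otimes> \<zeta> [^] (i * j) = f (\<omega> [^]\<^bsub>M\<^esub> i) \<otimes> \<zeta> [^] (i * k)" by simp
qed (use group_alg_eval_closed[OF f] in auto)

lemma dft_zero: "dft \<zero>\<^bsub>group_alg L M\<^esub> j = \<zero>"
proof -
  have "dft \<zero>\<^bsub>group_alg L M\<^esub> j = (\<Oplus>i\<in>{..<q}. \<zero>)"
    unfolding dft_def by (intro finsum_cong') (auto simp: group_alg_def)
  then show ?thesis by simp
qed

lemma dft_one: "dft \<one>\<^bsub>group_alg L M\<^esub> j = \<one>"
proof -
  have "\<omega> [^]\<^bsub>M\<^esub> i = \<one>\<^bsub>M\<^esub> \<longleftrightarrow> i = 0" if "i < q" for i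
    using \<omega>_eq[of i 0] that by (auto simp: cong_def)
  then have "dft \<one>\<^bsub>group_alg L M\<^esub> j = (\<Oplus>i\<in>{..<q}. if 0 = i then \<one> else \<zero>)"
    unfolding dft_def by (intro finsum_cong') (auto simp: group_alg_def)
  also have "\<dots> = \<one>" using finsum_singleton[of 0 "{..<q}" "\<lambda>_. \<one>"] q by simp
  finally show ?thesis .
qed

lemma dft_add:
  assumes "f \<in> carrier (group_alg L M)" "g \<in> carrier (group_alg L M)"
  shows "dft (f \<oplus>\<^bsub>group_alg L M\<^esub> g) j = dft f j \<oplus> dft g j"
proof -
  note cl = group_alg_eval_closed[OF assms(1)] group_alg_eval_closed[OF assms(2)]
  have "dft (f \<oplus>\<^bsub>group_alg L M\<^esub> g) j = (\<Oplus>i\<in>{..<q}. f (\<omega> [^]\<^bsub>M\<^esub> i) \<otimes> \<zeta> [^] (i * j)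
      \<oplus> g (\<omega> [^]\<^bsub>M\<^esub> i) \<otimes> \<zeta> [^] (i * j))"
    unfolding dft_def using cl by (intro finsum_cong') (auto simp: group_alg_def l_distr)
  then show ?thesis using cl by (simp add: dft_def finsum_addf)
qed

lemma dft_smult:
  assumes k: "k \<in> carrier L" and f: "f \<in> carrier (group_alg L M)"
  shows "dft (k \<odot>\<^bsub>group_alg L M\<^esub> f) j = k \<otimes> dft f j"
proof -
  note cl = group_alg_eval_closed[OF f]
  have "dft (k \<odot>\<^bsub>group_alg L M\<^esub> f) j = (\<Oplus>i\<in>{..<q}. k \<otimes> (f (\<omega> [^]\<^bsub>M\<^esub> i) \<otimes> \<zeta> [^] (i * j)))"
    unfolding dft_def using cl k by (intro finsum_cong') (auto simp: group_alg_def m_assoc)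
  then show ?thesis using cl k by (simp add: dft_def finsum_rdistr)
qed

lemma group_alg_mult_closed:
  assumes "f \<in> carrier (group_alg L M)" "g \<in> carrier (group_alg L M)"
  shows "f \<otimes>\<^bsub>group_alg L M\<^esub> g \<in> carrier (group_alg L M)"
  using group_alg_eval_closed[OF assms(1)] group_alg_eval_closed[OF assms(2)]
  by (auto simp: group_alg_def intro!: finsum_closed)

text \<open>A character of \<open>M\<close> extends to an algebra homomorphism. In sums, shifting
  the inner index by \<open>i\<close> splits the root of unity into a factor for each of
  \<open>f\<close> and \<open>g\<close>.\<close>

lemma dft_mult:
  assumes f: "f \<in> carrier (group_alg L M)" and g: "g \<in> carrier (group_alg L M)"
  shows "dft (f \<otimes>\<^bsub>group_alg L M\<^esub> g) j = dft f j \<otimes> dft g j"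
proof -
  note cl = group_alg_eval_closed[OF f] group_alg_eval_closed[OF g]
  let ?w = "\<lambda>i::nat. \<omega> [^]\<^bsub>M\<^esub> i"
  let ?g = "\<lambda>i x::nat. g (inv\<^bsub>M\<^esub> ?w i \<otimes>\<^bsub>M\<^esub> ?w x)"
  have inj: "inj_on ?w {..<q}" using \<omega>_eq by (auto simp: inj_on_def cong_def)
  have conv: "(f \<otimes>\<^bsub>group_alg L M\<^esub> g) (?w x) = (\<Oplus>i\<in>{..<q}. f (?w i) \<otimes> ?g i x)" for x
  proof -
    have "(f \<otimes>\<^bsub>group_alg L M\<^esub> g) (?w x) = (\<Oplus>y\<in>carrier M. f y \<otimes> g (inv\<^bsub>M\<^esub> y \<otimes>\<^bsub>M\<^esub> ?w x))"
      by (simp add: group_alg_def)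
    also have "\<dots> = (\<Oplus>i\<in>{..<q}. f (?w i) \<otimes> ?g i x)"
      unfolding \<omega>(2) by (rule finsum_reindex) (use inj cl in auto)
    finally show ?thesis .
  qed
  have inner: "(\<Oplus>x\<in>{..<q}. ?g i x \<otimes> \<zeta> [^] (x * j)) = \<zeta> [^] (i * j) \<otimes> dft g j" for i
  proof -
    have "(\<Oplus>x\<in>{..<q}. ?g i x \<otimes> \<zeta> [^] (x * j)) = (\<Oplus>x\<in>{..<q}. ?g i (i + x) \<otimes> \<zeta> [^] ((i + x) * j))"
    proof (rule finsum_mod_reindex[OF q, symmetric])
      fix x y assume "[x = y] (mod q)"
      then have "?w x = ?w y" "\<zeta> [^] (x * j) = \<zeta> [^] (y * j)"
        using \<omega>_eq by (auto intro!: \<zeta>_cong cong_scalar_right)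
      then show "?g i x \<otimes> \<zeta> [^] (x * j) = ?g i y \<otimes> \<zeta> [^] (y * j)" by simp
    qed (use cl in \<open>auto simp: cong_add_lcancel_nat cong_less_modulus_unique_nat\<close>)
    also have "\<dots> = (\<Oplus>x\<in>{..<q}. \<zeta> [^] (i * j) \<otimes> (g (?w x) \<otimes> \<zeta> [^] (x * j)))"
    proof (rule finsum_cong')
      fix x
      have "inv\<^bsub>M\<^esub> ?w i \<otimes>\<^bsub>M\<^esub> ?w (i + x) = ?w x"
        using \<omega>(1) by (simp add: M.nat_pow_mult[symmetric] M.m_assoc[symmetric])
      moreover have "\<zeta> [^] ((i + x) * j) = \<zeta> [^] (i * j) \<otimes> \<zeta> [^] (x * j)"
        using \<zeta> by (simp add: nat_pow_mult add_mult_distrib)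
      ultimately show "?g i (i + x) \<otimes> \<zeta> [^] ((i + x) * j) = \<zeta> [^] (i * j) \<otimes> (g (?w x) \<otimes> \<zeta> [^] (x * j))"
        using cl by (simp add: m_lcomm)
    qed (use cl in auto)
    finally show ?thesis using cl by (simp add: dft_def finsum_rdistr)
  qed
  have "dft (f \<otimes>\<^bsub>group_alg L M\<^esub> g) j = (\<Oplus>x\<in>{..<q}. \<Oplus>i\<in>{..<q}. f (?w i) \<otimes> (?g i x \<otimes> \<zeta> [^] (x * j)))"
    unfolding dft_def conv using cl
    by (intro finsum_cong') (auto simp: finsum_ldistr m_assoc intro!: finsum_closed finsum_cong')
  also have "\<dots> = (\<Oplus>i\<in>{..<q}. \<Oplus>x\<in>{..<q}. f (?w i) \<otimes> (?g i x \<otimes> \<zeta> [^] (x * j)))"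
    using cl by (intro finsum_swap) auto
  also have "\<dots> = (\<Oplus>i\<in>{..<q}. f (?w i) \<otimes> \<zeta> [^] (i * j) \<otimes> dft g j)"
  proof (rule finsum_cong')
    fix i
    have "(\<Oplus>x\<in>{..<q}. f (?w i) \<otimes> (?g i x \<otimes> \<zeta> [^] (x * j)))
        = f (?w i) \<otimes> (\<Oplus>x\<in>{..<q}. ?g i x \<otimes> \<zeta> [^] (x * j))"
      using cl by (subst finsum_rdistr) auto
    then show "(\<Oplus>x\<in>{..<q}. f (?w i) \<otimes> (?g i x \<otimes> \<zeta> [^] (x * j)))
        = f (?w i) \<otimes> \<zeta> [^] (i * j) \<otimes> dft g j"
      using cl dft_closed[OF g] by (simp add: inner m_assoc)
  qed (use cl dft_closed[OF g] in auto)
  also have "\<dots> = dft f j \<otimes> dft g j"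
    using cl dft_closed[OF g] by (simp add: dft_def[of f] finsum_ldistr)
  finally show ?thesis .
qed

text \<open>Shifting the index multiplies the sum by the \<open>a\<close>-th power of \<zeta>; when
  this is not 1, the sum must vanish.\<close>

lemma root_sum: "(\<Oplus>i\<in>{..<q}. \<zeta> [^] (i * a)) = (if q dvd a then [q] \<cdot> \<one> else \<zero>)"
proof (cases "q dvd a")
  case True
  have "(\<Oplus>i\<in>{..<q}. \<zeta> [^] (i * a)) = (\<Oplus>i\<in>{..<q}. \<one>)"
    using True \<zeta>_one by (intro finsum_cong') auto
  also have "\<dots> = [q] \<cdot> \<one>" using add.finprod_const[of \<one> "{..<q}"] by simp
  finally show ?thesis using True by simp
next
  case False
  define S where "S = (\<Oplus>i\<in>{..<q}. \<zeta> [^] (i * a))"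
  have S: "S \<in> carrier L" unfolding S_def by (auto intro!: finsum_closed)
  have "S = (\<Oplus>i\<in>{..<q}. \<zeta> [^] ((1 + i) * a))"
    unfolding S_def by (rule finsum_mod_reindex[OF q, symmetric])
      (auto intro!: \<zeta>_cong cong_scalar_right
        simp only: \<zeta>_closed cong_add_lcancel_nat cong_less_modulus_unique_nat)
  also have "\<dots> = (\<Oplus>i\<in>{..<q}. \<zeta> [^] a \<otimes> \<zeta> [^] (i * a))"
    using \<zeta> by (intro finsum_cong') (auto simp: nat_pow_mult)
  also have "\<dots> = \<zeta> [^] a \<otimes> S" unfolding S_def by (subst finsum_rdistr) auto
  finally have "(\<zeta> [^] a \<ominus> \<one>) \<otimes> S = \<zero>"
    using S by (simp add: minus_eq l_distr l_minus r_neg)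
  moreover have "\<zeta> [^] a \<ominus> \<one> \<noteq> \<zero>" using False \<zeta>_one by (simp add: r_right_minus_eq)
  ultimately have "S = \<zero>" using S integral by (metis \<zeta>_closed minus_closed one_closed)
  then show ?thesis using False by (simp add: S_def)
qed

text \<open>The computation shared by both directions of Fourier inversion: \<open>c\<close> and
  \<open>c'\<close> will be 1 and \<open>q - 1\<close>, in either order.\<close>

lemma double_root_sum:
  assumes F: "\<And>i. i < q \<Longrightarrow> F i \<in> carrier L" and x: "x < q"
  shows "(\<Oplus>j\<in>{..<q}. (\<Oplus>i\<in>{..<q}. F i \<otimes> \<zeta> [^] (i * (c * j))) \<otimes> \<zeta> [^] (x * (c' * j)))
    = (\<Oplus>i\<in>{..<q}. F i \<otimes> (if q dvd i * c + x * c' then [q] \<cdot> \<one> else \<zero>))"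
proof -
  have "(\<Oplus>j\<in>{..<q}. (\<Oplus>i\<in>{..<q}. F i \<otimes> \<zeta> [^] (i * (c * j))) \<otimes> \<zeta> [^] (x * (c' * j)))
      = (\<Oplus>j\<in>{..<q}. \<Oplus>i\<in>{..<q}. F i \<otimes> \<zeta> [^] (j * (i * c + x * c')))"
  proof (rule finsum_cong')
    fix j
    have "(\<Oplus>i\<in>{..<q}. F i \<otimes> \<zeta> [^] (i * (c * j))) \<otimes> \<zeta> [^] (x * (c' * j))
        = (\<Oplus>i\<in>{..<q}. F i \<otimes> \<zeta> [^] (i * (c * j)) \<otimes> \<zeta> [^] (x * (c' * j)))"
      using F by (intro finsum_ldistr) auto
    also have "\<dots> = (\<Oplus>i\<in>{..<q}. F i \<otimes> \<zeta> [^] (j * (i * c + x * c')))"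
      using F \<zeta> by (intro finsum_cong') (auto simp: m_assoc nat_pow_mult algebra_simps)
    finally show "(\<Oplus>i\<in>{..<q}. F i \<otimes> \<zeta> [^] (i * (c * j))) \<otimes> \<zeta> [^] (x * (c' * j))
        = (\<Oplus>i\<in>{..<q}. F i \<otimes> \<zeta> [^] (j * (i * c + x * c')))" .
  qed (use F in \<open>auto intro!: finsum_closed\<close>)
  also have "\<dots> = (\<Oplus>i\<in>{..<q}. \<Oplus>j\<in>{..<q}. F i \<otimes> \<zeta> [^] (j * (i * c + x * c')))"
    using F by (intro finsum_swap) auto
  also have "\<dots> = (\<Oplus>i\<in>{..<q}. F i \<otimes> (if q dvd i * c + x * c' then [q] \<cdot> \<one> else \<zero>))"
  proof (rule finsum_cong')
    fix i assume i: "i \<in> {..<q}"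
    have "(\<Oplus>j\<in>{..<q}. F i \<otimes> \<zeta> [^] (j * (i * c + x * c')))
        = F i \<otimes> (\<Oplus>j\<in>{..<q}. \<zeta> [^] (j * (i * c + x * c')))"
      using F i by (subst finsum_rdistr) auto
    then show "(\<Oplus>j\<in>{..<q}. F i \<otimes> \<zeta> [^] (j * (i * c + x * c')))
        = F i \<otimes> (if q dvd i * c + x * c' then [q] \<cdot> \<one> else \<zero>)"
      by (simp only: root_sum)
  qed (use F in auto)
  finally show ?thesis .
qed

lemma dvd_inverse_iff:
  assumes "i < q" "x < q"
  shows "q dvd i + x * (q - 1) \<longleftrightarrow> x = i"
proof -
  have "[i + x * (q - 1) + x = i + x * q] (mod q)"
    using q by (cases q) (auto simp: algebra_simps)
  also have "[i + x * q = i] (mod q)" by (simp add: cong_def)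
  finally have *: "[i + x * (q - 1) + x = i] (mod q)" .
  have "q dvd i + x * (q - 1) \<longleftrightarrow> [i + x * (q - 1) + x = 0 + x] (mod q)"
    by (simp only: cong_add_rcancel_nat cong_0_iff)
  also have "\<dots> \<longleftrightarrow> [i = x] (mod q)" using * by (simp add: cong_def)
  also have "\<dots> \<longleftrightarrow> x = i" using assms by (auto simp: cong_def)
  finally show ?thesis .
qed

lemma finsum_delta:
  assumes F: "\<And>i. i < q \<Longrightarrow> F i \<in> carrier L" and x: "x < q"
  shows "(\<Oplus>i\<in>{..<q}. F i \<otimes> (if x = i then [q] \<cdot> \<one> else \<zero>)) = F x \<otimes> [q] \<cdot> \<one>"
proof -
  have "(\<Oplus>i\<in>{..<q}. F i \<otimes> (if x = i then [q] \<cdot> \<one> else \<zero>))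
      = (\<Oplus>i\<in>{..<q}. if x = i then F i \<otimes> [q] \<cdot> \<one> else \<zero>)"
    using F by (intro finsum_cong') auto
  also have "\<dots> = F x \<otimes> [q] \<cdot> \<one>"
    using F x by (intro finsum_singleton) auto
  finally show ?thesis .
qed

lemma dft_inversion:
  assumes f: "f \<in> carrier (group_alg L M)" and x: "x < q"
  shows "(\<Oplus>j\<in>{..<q}. dft f j \<otimes> \<zeta> [^] (x * ((q - 1) * j))) = f (\<omega> [^]\<^bsub>M\<^esub> x) \<otimes> [q] \<cdot> \<one>"
proof -
  note cl = group_alg_eval_closed[OF f]
  have "(\<Oplus>j\<in>{..<q}. dft f j \<otimes> \<zeta> [^] (x * ((q - 1) * j)))
      = (\<Oplus>i\<in>{..<q}. f (\<omega> [^]\<^bsub>M\<^esub> i) \<otimes> (if q dvd i + x * (q - 1) then [q] \<cdot> \<one> else \<zero>))"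
    using double_root_sum[of "\<lambda>i. f (\<omega> [^]\<^bsub>M\<^esub> i)" x 1 "q - 1"] x cl
    by (simp add: dft_def del: One_nat_def)
  also have "\<dots> = (\<Oplus>i\<in>{..<q}. f (\<omega> [^]\<^bsub>M\<^esub> i) \<otimes> (if x = i then [q] \<cdot> \<one> else \<zero>))"
    using cl x by (intro finsum_cong') (auto simp del: One_nat_def simp: dvd_inverse_iff)
  finally show ?thesis using finsum_delta[of "\<lambda>i. f (\<omega> [^]\<^bsub>M\<^esub> i)" x] x cl by simp
qed

lemma q_unit: "[q] \<cdot> \<one> \<in> Units L"
  using char field_Units by simp

lemma dft_inject:
  assumes f: "f \<in> carrier (group_alg L M)" and g: "g \<in> carrier (group_alg L M)"
    and eq: "\<And>j. j < q \<Longrightarrow> dft f j = dft g j"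
  shows "f = g"
proof (rule PiE_ext[of f "carrier M" "\<lambda>_. carrier L" g])
  fix y assume "y \<in> carrier M"
  then obtain x where x: "x < q" "y = \<omega> [^]\<^bsub>M\<^esub> x" using \<omega>(2) by auto
  have "(\<Oplus>j\<in>{..<q}. dft f j \<otimes> \<zeta> [^] (x * ((q - 1) * j))) = (\<Oplus>j\<in>{..<q}. dft g j \<otimes> \<zeta> [^] (x * ((q - 1) * j)))"
    using eq dft_closed[OF g] by (intro finsum_cong') auto
  then have "f y \<otimes> [q] \<cdot> \<one> = g y \<otimes> [q] \<cdot> \<one>"
    by (simp only: dft_inversion[OF f x(1)] dft_inversion[OF g x(1)] x(2))
  then show "f y = g y"
    using q_unit group_alg_eval_closed[OF f \<open>y \<in> carrier M\<close>] group_alg_eval_closed[OF g \<open>y \<in> carrier M\<close>]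
    by (metis Units_closed char m_rcancel)
qed (use f g in \<open>simp_all add: group_alg_def\<close>)

lemma dft_surj:
  assumes F: "\<And>i. i < q \<Longrightarrow> F i \<in> carrier L"
  shows "\<exists>f\<in>carrier (group_alg L M). \<forall>j<q. dft f j = F j"
proof -
  define \<kappa> where "\<kappa> = inv ([q] \<cdot> \<one>)"
  have \<kappa>: "\<kappa> \<in> carrier L" "[q] \<cdot> \<one> \<otimes> \<kappa> = \<one>" using q_unit by (auto simp: \<kappa>_def)
  define lg where "lg y = (THE i. i < q \<and> y = \<omega> [^]\<^bsub>M\<^esub> i)" for y
  have lg: "lg (\<omega> [^]\<^bsub>M\<^esub> i) = i" if "i < q" for i
    unfolding lg_def using that \<omega>_eq by (intro the_equality) (auto simp: cong_def)
  \<comment> \<open>The inverse transform of \<open>F\<close>: \<open>lg\<close> is the discrete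
    logarithm to base \<omega>, \<open>q - 1\<close> stands for the sign in the kernel, and \<kappa>
    is the normalisation 1/q.\<close>
  define f where "f = (\<lambda>y\<in>carrier M. (\<Oplus>i\<in>{..<q}. F i \<otimes> \<zeta> [^] (i * ((q - 1) * lg y))) \<otimes> \<kappa>)"
  have f: "f \<in> carrier (group_alg L M)"
    using F \<kappa> by (auto simp: f_def group_alg_def intro!: finsum_closed m_closed)
  have "dft f j = F j" if j: "j < q" for j
  proof -
    have "dft f j = (\<Oplus>x\<in>{..<q}. (\<Oplus>i\<in>{..<q}. F i \<otimes> \<zeta> [^] (i * ((q - 1) * x))) \<otimes> \<zeta> [^] (j * (1 * x)) \<otimes> \<kappa>)"
      unfolding dft_def
    proof (rule finsum_cong')
      fix x assume "x \<in> {..<q}"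
      moreover have "(\<Oplus>i\<in>{..<q}. F i \<otimes> \<zeta> [^] (i * ((q - 1) * x))) \<in> carrier L"
        using F by (auto intro!: finsum_closed)
      ultimately show "f (\<omega> [^]\<^bsub>M\<^esub> x) \<otimes> \<zeta> [^] (x * j)
          = (\<Oplus>i\<in>{..<q}. F i \<otimes> \<zeta> [^] (i * ((q - 1) * x))) \<otimes> \<zeta> [^] (j * (1 * x)) \<otimes> \<kappa>"
        using \<kappa>(1) by (simp add: f_def lg mult.commute m_ac)
    qed (use F \<kappa> in \<open>auto intro!: finsum_closed m_closed\<close>)
    also have "\<dots> = (\<Oplus>x\<in>{..<q}. (\<Oplus>i\<in>{..<q}. F i \<otimes> \<zeta> [^] (i * ((q - 1) * x))) \<otimes> \<zeta> [^] (j * (1 * x))) \<otimes> \<kappa>"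
      using F \<kappa> by (intro finsum_ldistr[symmetric]) (auto intro!: finsum_closed m_closed)
    also have "\<dots> = (\<Oplus>i\<in>{..<q}. F i \<otimes> (if q dvd i * (q - 1) + j * 1 then [q] \<cdot> \<one> else \<zero>)) \<otimes> \<kappa>"
      using F j by (subst double_root_sum) auto
    also have "(\<Oplus>i\<in>{..<q}. F i \<otimes> (if q dvd i * (q - 1) + j * 1 then [q] \<cdot> \<one> else \<zero>))
        = (\<Oplus>i\<in>{..<q}. F i \<otimes> (if j = i then [q] \<cdot> \<one> else \<zero>))"
    proof (rule finsum_cong')
      fix i assume "i \<in> {..<q}"
      then have "q dvd i * (q - 1) + j * 1 \<longleftrightarrow> j = i" using dvd_inverse_iff[of j i] j by (auto simp: add.commute)
      then show "F i \<otimes> (if q dvd i * (q - 1) + j * 1 then [q] \<cdot> \<one> else \<zero>) = F i \<otimes> (if j = i then [q] \<cdot> \<one> else \<zero>)"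
        by simp
    qed (use F in auto)
    also have "\<dots> = F j \<otimes> [q] \<cdot> \<one>" using finsum_delta[of F j] F j by simp
    finally show ?thesis using F[OF j] \<kappa> by (simp add: m_assoc)
  qed
  with f show ?thesis by blast
qed

section \<open>The transform of a semilinear twist\<close>

context
  fixes \<sigma> :: "'a \<Rightarrow> 'a" and D :: nat
  assumes \<sigma>: "\<sigma> \<in> ring_hom L L" "\<sigma> \<zeta> = \<zeta>" and D: "coprime D q"
begin

interpretation \<sigma>: ring_hom_cring L L \<sigma>
  using \<sigma>(1) by unfold_locales

lemma \<sigma>_\<zeta>_pow: "\<sigma> (\<zeta> [^] (i::nat)) = \<zeta> [^] i"
  using \<zeta> \<sigma>(2) by (induction i) auto

lemma D_cancel: "[D * x = D * y] (mod q) \<longleftrightarrow> [x = y] (mod q)"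
  using D by (simp add: cong_mult_lcancel_nat)

text \<open>\<sigma> fixes \<zeta> and so acts on the coefficients alone; substituting
  \<open>D * i\<close> for \<open>i\<close> moves \<open>D\<close> from the group element to the
  frequency.\<close>

lemma dft_twist:
  assumes f: "f \<in> carrier (group_alg L M)"
  defines "g \<equiv> \<lambda>y\<in>carrier M. \<sigma> (f (y [^]\<^bsub>M\<^esub> D))"
  shows "g \<in> carrier (group_alg L M)" "dft g (D * j) = \<sigma> (dft f j)"
proof -
  note cl = group_alg_eval_closed[OF f]
  show "g \<in> carrier (group_alg L M)" using cl by (auto simp: g_def group_alg_def)
  have "\<sigma> (dft f j) = (\<Oplus>i\<in>{..<q}. \<sigma> (f (\<omega> [^]\<^bsub>M\<^esub> i) \<otimes> \<zeta> [^] (i * j)))"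
    unfolding dft_def using cl by (intro ring_hom_finsum \<sigma>) auto
  also have "\<dots> = (\<Oplus>i\<in>{..<q}. \<sigma> (f (\<omega> [^]\<^bsub>M\<^esub> i)) \<otimes> \<zeta> [^] (i * j))"
    using cl by (intro finsum_cong') (auto simp: \<sigma>_\<zeta>_pow)
  also have "\<dots> = (\<Oplus>i\<in>{..<q}. \<sigma> (f (\<omega> [^]\<^bsub>M\<^esub> (D * i))) \<otimes> \<zeta> [^] (D * i * j))"
  proof (rule finsum_mod_reindex[OF q, symmetric])
    fix x y assume xy: "[x = y] (mod q)"
    then have "\<omega> [^]\<^bsub>M\<^esub> x = \<omega> [^]\<^bsub>M\<^esub> y" using \<omega>_eq by blast
    moreover have "\<zeta> [^] (x * j) = \<zeta> [^] (y * j)" using xy by (intro \<zeta>_cong cong_scalar_right)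
    ultimately show "\<sigma> (f (\<omega> [^]\<^bsub>M\<^esub> x)) \<otimes> \<zeta> [^] (x * j) = \<sigma> (f (\<omega> [^]\<^bsub>M\<^esub> y)) \<otimes> \<zeta> [^] (y * j)" by simp
  qed (use cl D_cancel in \<open>auto simp: cong_def\<close>)
  also have "\<dots> = dft g (D * j)"
    unfolding dft_def g_def using cl \<omega>(1)
    by (intro finsum_cong') (auto simp: M.nat_pow_pow mult.commute mult.left_commute)
  finally show "dft g (D * j) = \<sigma> (dft f j)" by simp
qed

text \<open>Both conditions say that \<open>f\<close> equals its twist \<open>g\<close>: the first
  pointwise, the second because the transform is injective and every frequency is
  \<open>D * j\<close> modulo \<open>q\<close> for some \<open>j\<close>.\<close>

lemma dft_equivariant_iff:
  assumes f: "f \<in> carrier (group_alg L M)"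
  shows "(\<forall>i. \<sigma> (f (\<omega> [^]\<^bsub>M\<^esub> (D * i))) = f (\<omega> [^]\<^bsub>M\<^esub> i)) \<longleftrightarrow> (\<forall>j. dft f (D * j) = \<sigma> (dft f j))"
proof -
  define g where "g = (\<lambda>y\<in>carrier M. \<sigma> (f (y [^]\<^bsub>M\<^esub> D)))"
  note g = dft_twist[OF f, folded g_def]
  have gw: "g (\<omega> [^]\<^bsub>M\<^esub> i) = \<sigma> (f (\<omega> [^]\<^bsub>M\<^esub> (D * i)))" for i :: nat
    using \<omega>(1) by (simp add: g_def M.nat_pow_pow mult.commute)
  have "(\<forall>i. \<sigma> (f (\<omega> [^]\<^bsub>M\<^esub> (D * i))) = f (\<omega> [^]\<^bsub>M\<^esub> i)) \<longleftrightarrow> g = f"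
  proof
    assume *: "\<forall>i. \<sigma> (f (\<omega> [^]\<^bsub>M\<^esub> (D * i))) = f (\<omega> [^]\<^bsub>M\<^esub> i)"
    show "g = f"
    proof (rule PiE_ext[of g "carrier M" "\<lambda>_. carrier L" f])
      fix y assume "y \<in> carrier M"
      then show "g y = f y" using \<omega>(2) gw * by auto
    qed (use f g in \<open>simp_all add: group_alg_def\<close>)
  next
    assume "g = f"
    show "\<forall>i. \<sigma> (f (\<omega> [^]\<^bsub>M\<^esub> (D * i))) = f (\<omega> [^]\<^bsub>M\<^esub> i)"
      unfolding gw[symmetric] \<open>g = f\<close> by blast
  qed
  also have "\<dots> \<longleftrightarrow> (\<forall>j. dft f (D * j) = \<sigma> (dft f j))"
  proof
    assume *: "\<forall>j. dft f (D * j) = \<sigma> (dft f j)"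
    obtain E where E: "[D * E = 1] (mod q)" using cong_solve_coprime_nat[OF D] unfolding One_nat_def by blast
    show "g = f"
    proof (rule dft_inject[OF g(1) f])
      fix j
      have Ej: "[D * (E * j) = j] (mod q)"
        using cong_scalar_right[OF E, of j] by (simp add: mult.assoc)
      have "dft g j = dft g (D * (E * j))" by (rule dft_cong[OF g(1) cong_sym[OF Ej]])
      also have "\<dots> = dft f (D * (E * j))" using g(2) * by simp
      also have "\<dots> = dft f j" by (rule dft_cong[OF f Ej])
      finally show "dft g j = dft f j" .
    qed
  qed (use g(2) in metis)
  finally show ?thesis .
qed

end

end


section \<open>The regular embedding of a cyclic group\<close>

lemma BijGroup_mult_apply:
  assumes "f \<in> Bij S" "g \<in> Bij S" "x \<in> S"
  shows "(f \<otimes>\<^bsub>BijGroup S\<^esub> g) x = f (g x)"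
  using assms by (simp add: BijGroup_def compose_eq)

lemma BijGroup_carrier: "carrier (BijGroup S) = Bij S"
  by (simp add: BijGroup_def)

lemma Bij_closed: "f \<in> Bij S \<Longrightarrow> x \<in> S \<Longrightarrow> f x \<in> S"
  by (auto simp: Bij_def bij_betw_def)

lemma Bij_eqI:
  assumes "f \<in> Bij S" "g \<in> Bij S" "\<And>x. x \<in> S \<Longrightarrow> f x = g x"
  shows "f = g"
  using assms by (auto simp: Bij_def intro: extensionalityI)

lemma (in group) left_reg_Bij:
  assumes "g \<in> carrier G"
  shows "left_reg G g \<in> Bij (carrier G)"
proof -
  have "bij_betw (\<lambda>x. g \<otimes> x) (carrier G) (carrier G)"
    by (rule bij_betw_byWitness[where f' = "\<lambda>x. inv g \<otimes> x"]) (use assms in \<open>auto simp: m_assoc[symmetric]\<close>)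
  then show ?thesis by (simp add: left_reg_def Bij_def)
qed

lemma (in group) right_reg_Bij:
  assumes "g \<in> carrier G"
  shows "right_reg G g \<in> Bij (carrier G)"
proof -
  have "bij_betw (\<lambda>x. x \<otimes> inv g) (carrier G) (carrier G)"
    by (rule bij_betw_byWitness[where f' = "\<lambda>x. x \<otimes> g"]) (use assms in \<open>auto simp: m_assoc\<close>)
  then show ?thesis by (simp add: right_reg_def Bij_def)
qed

text \<open>The assumption \<open>geometric\<close> says that the affine map x to d x - 1 brings 0
  back to 0 modulo \<open>q\<close> only after a multiple of \<open>q\<close> steps, which is
  regularity in arithmetic form.\<close>

locale regular_embedding = N: cyclic_gen N \<eta> q + G: cyclic_gen G \<sigma> q
  for N :: "('c, 'n) monoid_scheme" and \<eta> q and G :: "('g, 'm) monoid_scheme" and \<sigma> +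
  fixes \<delta> :: "'c \<Rightarrow> 'c" and s d :: nat
  assumes \<delta>_auto: "\<delta> [^]\<^bsub>AutoGroup N\<^esub> s \<in> carrier (AutoGroup N)"
    and \<delta>_gen: "(\<delta> [^]\<^bsub>AutoGroup N\<^esub> s) \<eta> = \<eta> [^]\<^bsub>N\<^esub> d"
    and geometric: "\<And>k. q dvd (\<Sum>i<k. d ^ i) \<longleftrightarrow> q dvd k"
begin

abbreviation "BN \<equiv> BijGroup (carrier N)"
abbreviation "BG \<equiv> BijGroup (carrier G)"

interpretation BN: group BN by (rule group_BijGroup)
interpretation BG: group BG by (rule group_BijGroup)

text \<open>The prescribed value of \<open>beta s\<close> at \<sigma>.\<close>

definition T :: "'c \<Rightarrow> 'c"
  where "T = right_reg N \<eta> \<otimes>\<^bsub>BN\<^esub> (\<delta> [^]\<^bsub>AutoGroup N\<^esub> s)"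

text \<open>On exponents of \<open>\<eta>\<close>, \<open>T\<^sup>k\<close> is the affine map \<open>x \<mapsto> d\<^sup>k x + B k\<close>; the factor \<open>q - 1\<close> stands for \<open>-1\<close>.\<close>

definition B :: "nat \<Rightarrow> nat"
  where "B k = (q - 1) * (\<Sum>i<k. d ^ i)"

lemma \<delta>_Bij: "\<delta> [^]\<^bsub>AutoGroup N\<^esub> s \<in> Bij (carrier N)"
  and \<delta>_hom: "\<delta> [^]\<^bsub>AutoGroup N\<^esub> s \<in> hom N N"
  using \<delta>_auto by (auto simp: AutoGroup_def auto_def)

lemma \<delta>_pow: "(\<delta> [^]\<^bsub>AutoGroup N\<^esub> s) (\<eta> [^]\<^bsub>N\<^esub> x) = \<eta> [^]\<^bsub>N\<^esub> (d * x)" for x :: nat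
proof -
  interpret group_hom N N "\<delta> [^]\<^bsub>AutoGroup N\<^esub> s" using \<delta>_hom by unfold_locales
  show ?thesis using N.gen \<delta>_gen by (simp add: hom_nat_pow N.nat_pow_pow)
qed

lemma T_Bij: "T \<in> Bij (carrier N)"
  using BN.m_closed[of "right_reg N \<eta>"] N.right_reg_Bij[OF N.gen] \<delta>_Bij
  unfolding T_def BijGroup_carrier by blast

lemma T_pow: "T (\<eta> [^]\<^bsub>N\<^esub> x) = \<eta> [^]\<^bsub>N\<^esub> (d * x + (q - 1))" for x :: nat
proof -
  have "T (\<eta> [^]\<^bsub>N\<^esub> x) = right_reg N \<eta> (\<eta> [^]\<^bsub>N\<^esub> (d * x))"
    using BijGroup_mult_apply[OF N.right_reg_Bij[OF N.gen] \<delta>_Bij N.pow_closed] \<delta>_pow by (simp add: T_def)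
  also have "\<dots> = \<eta> [^]\<^bsub>N\<^esub> (d * x) \<otimes>\<^bsub>N\<^esub> inv\<^bsub>N\<^esub> \<eta>" by (simp add: right_reg_def)
  also have "inv\<^bsub>N\<^esub> \<eta> = \<eta> [^]\<^bsub>N\<^esub> (q - 1)" using N.inv_pow[of 1] N.gen by simp
  finally show ?thesis using N.gen by (simp add: N.nat_pow_mult)
qed

lemma Tk_Bij: "T [^]\<^bsub>BN\<^esub> k \<in> Bij (carrier N)" for k :: nat
  using BN.nat_pow_closed[of T k] T_Bij by (simp add: BijGroup_carrier)

lemma Tk_pow: "(T [^]\<^bsub>BN\<^esub> k) (\<eta> [^]\<^bsub>N\<^esub> x) = \<eta> [^]\<^bsub>N\<^esub> (d ^ k * x + B k)" for k x :: nat
proof (induction k arbitrary: x)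
  case 0
  have "\<one>\<^bsub>BN\<^esub> = (\<lambda>x\<in>carrier N. x)" by (simp add: BijGroup_def)
  then show ?case by (simp add: B_def)
next
  case (Suc k)
  have "(T [^]\<^bsub>BN\<^esub> Suc k) (\<eta> [^]\<^bsub>N\<^esub> x) = (T [^]\<^bsub>BN\<^esub> k) (T (\<eta> [^]\<^bsub>N\<^esub> x))"
    using BijGroup_mult_apply[OF Tk_Bij T_Bij N.pow_closed] by simp
  also have "\<dots> = \<eta> [^]\<^bsub>N\<^esub> (d ^ k * (d * x + (q - 1)) + B k)" by (simp only: T_pow Suc)
  also have "d ^ k * (d * x + (q - 1)) + B k = d ^ Suc k * x + B (Suc k)"
    by (simp add: B_def algebra_simps)
  finally show ?case .
qed

lemma geometric_identity: "1 + (d - 1) * (\<Sum>i<k. d ^ i) = d ^ k" if "0 < d"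
proof (induction k)
  case (Suc k)
  have "d ^ Suc k = d ^ k + (d - 1) * d ^ k" using that by (cases d) auto
  with Suc show ?case by (simp add: algebra_simps)
qed simp

text \<open>\<open>q\<close> divides the geometric sum of length \<open>q\<close> and hence its
  product with \<open>d - 1\<close>. For \<open>d = 0\<close> that sum is 1, which leaves only
  \<open>q = 1\<close>.\<close>

lemma d_pow_q: "[d ^ q = 1] (mod q)"
proof (cases "d = 0")
  case True
  have "(\<Sum>i<q. d ^ i) = 1"
    using True N.pos by (cases q) (auto simp: lessThan_Suc_eq_insert_0 sum.reindex)
  then have "q = 1" using geometric[of q] by simp
  then show ?thesis by simp
next
  case False
  have "q dvd (d - 1) * (\<Sum>i<q. d ^ i)" using geometric[of q] by simp
  then have "[1 + (d - 1) * (\<Sum>i<q. d ^ i) = 1 + 0] (mod q)"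
    unfolding cong_add_lcancel_nat cong_0_iff .
  then show ?thesis using geometric_identity[of q] False by simp
qed

lemma d_coprime: "coprime (d ^ k) q"
proof -
  have "coprime (d ^ q) q" using d_pow_q by (metis cong_imp_coprime cong_sym coprime_1_left)
  then have "coprime d q" using N.pos by (simp add: coprime_power_left_iff)
  then show ?thesis by simp
qed

lemma T_q: "T [^]\<^bsub>BN\<^esub> q = \<one>\<^bsub>BN\<^esub>"
proof (rule Bij_eqI[OF Tk_Bij])
  show "\<one>\<^bsub>BN\<^esub> \<in> Bij (carrier N)" using BN.one_closed by (simp add: BijGroup_carrier)
  fix y assume y: "y \<in> carrier N"
  then obtain x :: nat where x: "y = \<eta> [^]\<^bsub>N\<^esub> x" using N.exists_pow by blast
  have "q dvd B q" using geometric[of q] by (simp add: B_def)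
  then have "[d ^ q * x + B q = 1 * x + 0] (mod q)"
    by (intro cong_add cong_scalar_right d_pow_q) (simp add: cong_0_iff)
  then have "(T [^]\<^bsub>BN\<^esub> q) y = y" unfolding x Tk_pow N.pow_eq by simp
  then show "(T [^]\<^bsub>BN\<^esub> q) y = \<one>\<^bsub>BN\<^esub> y" using y by (simp add: BijGroup_def)
qed

lemma Tk_mod: "T [^]\<^bsub>BN\<^esub> (k mod q) = T [^]\<^bsub>BN\<^esub> k" for k :: nat
proof -
  have T: "T \<in> carrier BN" using T_Bij by (simp add: BijGroup_carrier)
  have "T [^]\<^bsub>BN\<^esub> (q * (k div q) + k mod q) = (T [^]\<^bsub>BN\<^esub> q) [^]\<^bsub>BN\<^esub> (k div q) \<otimes>\<^bsub>BN\<^esub> T [^]\<^bsub>BN\<^esub> (k mod q)"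
    using T by (simp only: BN.nat_pow_mult BN.nat_pow_pow)
  then show ?thesis using T by (simp add: T_q)
qed

abbreviation "\<beta> \<equiv> beta N \<eta> \<delta> G \<sigma> s"
abbreviation "b \<equiv> bmap N \<eta> \<delta> G \<sigma> s"
abbreviation "\<alpha> \<equiv> alpha N \<eta> \<delta> G \<sigma> s"

text \<open>As \<open>T\<close> has trivial \<open>q\<close>-th power, \<open>T\<close> to the
  discrete logarithm is a well-defined homomorphism. It is the only one with this value at the
  generator \<sigma>, and extensionality fixes it off the carrier; so the definite description in
  \<open>beta\<close> is resolved.\<close>

lemma beta_pow: "\<beta> (\<sigma> [^]\<^bsub>G\<^esub> k) = T [^]\<^bsub>BN\<^esub> k" for k :: nat
proof -
  define lg where "lg y = (THE i. i < q \<and> y = \<sigma> [^]\<^bsub>G\<^esub> i)" for y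
  have lg: "lg (\<sigma> [^]\<^bsub>G\<^esub> i) = i mod q" for i
    unfolding lg_def using N.pos G.pow_eq by (intro the_equality) (auto simp: cong_def)
  define \<beta>0 where "\<beta>0 = (\<lambda>g\<in>carrier G. T [^]\<^bsub>BN\<^esub> lg g)"
  have T: "T \<in> carrier BN" using T_Bij by (simp add: BijGroup_carrier)
  have \<beta>0: "\<beta>0 (\<sigma> [^]\<^bsub>G\<^esub> i) = T [^]\<^bsub>BN\<^esub> i" for i :: nat
    by (simp add: \<beta>0_def lg Tk_mod)
  have "\<beta> = \<beta>0"
    unfolding beta_def T_def[symmetric]
  proof (rule the_equality, intro conjI)
    show "\<beta>0 \<in> hom G BN"
    proof (rule homI)
      fix g assume "g \<in> carrier G"
      then obtain i :: nat where "g = \<sigma> [^]\<^bsub>G\<^esub> i" using G.exists_pow by blast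
      then show "\<beta>0 g \<in> carrier BN" using T by (simp add: \<beta>0)
    next
      fix g h assume "g \<in> carrier G" "h \<in> carrier G"
      then obtain i j :: nat where "g = \<sigma> [^]\<^bsub>G\<^esub> i" "h = \<sigma> [^]\<^bsub>G\<^esub> j" using G.exists_pow by metis
      then show "\<beta>0 (g \<otimes>\<^bsub>G\<^esub> h) = \<beta>0 g \<otimes>\<^bsub>BN\<^esub> \<beta>0 h"
        using T G.gen by (simp add: \<beta>0 G.nat_pow_mult BN.nat_pow_mult)
    qed
    show "\<beta>0 \<in> extensional (carrier G)" by (simp add: \<beta>0_def)
    show "\<beta>0 \<sigma> = T" using \<beta>0[of 1] G.gen T by simp
  next
    fix \<beta>' assume \<beta>': "\<beta>' \<in> hom G BN \<and> \<beta>' \<in> extensional (carrier G) \<and> \<beta>' \<sigma> = T"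
    interpret group_hom G BN \<beta>' using \<beta>' by unfold_locales simp
    show "\<beta>' = \<beta>0"
    proof (rule extensionalityI[of _ "carrier G"])
      fix g assume "g \<in> carrier G"
      then obtain i :: nat where "g = \<sigma> [^]\<^bsub>G\<^esub> i" using G.exists_pow by blast
      then show "\<beta>' g = \<beta>0 g" using \<beta>' G.gen by (simp add: \<beta>0 hom_nat_pow)
    qed (use \<beta>' in \<open>auto simp: \<beta>0_def\<close>)
  qed
  then show ?thesis by (simp add: \<beta>0)
qed

lemma b_pow: "b (\<sigma> [^]\<^bsub>G\<^esub> k) = \<eta> [^]\<^bsub>N\<^esub> B k" for k :: nat
  using Tk_pow[of k 0] by (simp add: bmap_def beta_pow)

text \<open>The composition law of the affine maps with linear part \<open>d ^ k\<close> and
  constant part \<open>B k\<close>.\<close>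

lemma B_add: "B (k + l) = d ^ k * B l + B k"
  by (induction l) (simp_all add: B_def algebra_simps power_add)

text \<open>By \<open>B_add\<close>, the difference of two values is a unit times
  \<open>B (l - k)\<close>; the factor \<open>q - 1\<close> is a unit as well, so
  \<open>geometric\<close> decides.\<close>

lemma b_cong: "[B k = B l] (mod q) \<Longrightarrow> [k = l] (mod q)"
proof -
  have *: "[k = l] (mod q)" if eq: "[B k = B l] (mod q)" and kl: "k \<le> l" for k l
  proof -
    have "[B k = d ^ k * B (l - k) + B k] (mod q)" using eq B_add[of k "l - k"] kl by simp
    then have "[d ^ k * B (l - k) = 0] (mod q)"
      by (metis add.commute add.right_neutral cong_add_lcancel_nat cong_sym_eq)
    then have "q dvd B (l - k)"
      using d_coprime[of k] by (simp add: cong_0_iff coprime_commute coprime_dvd_mult_right_iff)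
    moreover have "coprime q (q - 1)"
      using N.pos by (metis Suc_diff_1 coprime_Suc_left_nat)
    ultimately have "q dvd l - k"
      unfolding B_def using geometric by (simp add: coprime_dvd_mult_right_iff)
    then show ?thesis using kl by (metis cong_altdef_nat cong_sym_eq)
  qed
  assume "[B k = B l] (mod q)"
  then show ?thesis using *[of k l] *[of l k] by (metis cong_sym_eq nat_le_linear)
qed

lemma b_bij: "bij_betw b (carrier G) (carrier N)"
proof -
  have inj: "inj_on b (carrier G)"
  proof (rule inj_onI)
    fix g h assume gh: "g \<in> carrier G" "h \<in> carrier G" "b g = b h"
    then obtain i j :: nat where ij: "g = \<sigma> [^]\<^bsub>G\<^esub> i" "h = \<sigma> [^]\<^bsub>G\<^esub> j" using G.exists_pow by metis
    then have "[B i = B j] (mod q)" using gh(3) by (simp add: b_pow N.pow_eq)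
    then show "g = h" using b_cong ij G.pow_eq by blast
  qed
  have "b ` carrier G \<subseteq> carrier N"
    using G.exists_pow b_pow by (metis N.pow_closed image_subsetI)
  moreover have "card (b ` carrier G) = card (carrier N)"
    using inj by (simp add: card_image N.card_carrier G.card_carrier)
  moreover have "finite (carrier N)" by (simp add: N.carrier_eq)
  ultimately show ?thesis using inj by (metis bij_betw_def card_subset_eq)
qed

lemma b_closed: "g \<in> carrier G \<Longrightarrow> b g \<in> carrier N"
  using b_bij by (auto simp: bij_betw_def)

lemma b_mult: "g \<in> carrier G \<Longrightarrow> b (\<sigma> [^]\<^bsub>G\<^esub> k \<otimes>\<^bsub>G\<^esub> g) = (T [^]\<^bsub>BN\<^esub> k) (b g)" for k :: nat
proof -
  assume "g \<in> carrier G"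
  then obtain l :: nat where g: "g = \<sigma> [^]\<^bsub>G\<^esub> l" using G.exists_pow by metis
  show ?thesis using G.gen by (simp add: g G.nat_pow_mult b_pow Tk_pow B_add)
qed

section \<open>The image of \<open>alpha\<close> and its conjugates under left translations\<close>

lemma alpha_apply:
  assumes "\<nu> \<in> carrier N" "g \<in> carrier G"
  shows "\<alpha> \<nu> g \<in> carrier G" "b (\<alpha> \<nu> g) = \<nu> \<otimes>\<^bsub>N\<^esub> b g"
proof -
  have "\<nu> \<otimes>\<^bsub>N\<^esub> b g \<in> b ` carrier G"
    using b_bij assms b_closed by (simp add: bij_betw_def)
  then show "\<alpha> \<nu> g \<in> carrier G" "b (\<alpha> \<nu> g) = \<nu> \<otimes>\<^bsub>N\<^esub> b g"
    using assms b_closed by (auto simp: alpha_def left_reg_def inv_into_into f_inv_into_f)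
qed

lemma b_inj: "g \<in> carrier G \<Longrightarrow> h \<in> carrier G \<Longrightarrow> b g = b h \<Longrightarrow> g = h"
  using b_bij by (auto simp: bij_betw_def inj_on_def)

lemma alpha_Bij:
  assumes \<nu>: "\<nu> \<in> carrier N"
  shows "\<alpha> \<nu> \<in> Bij (carrier G)"
proof -
  have inj: "inj_on (\<alpha> \<nu>) (carrier G)"
  proof (rule inj_onI)
    fix g h assume gh: "g \<in> carrier G" "h \<in> carrier G" "\<alpha> \<nu> g = \<alpha> \<nu> h"
    then have "\<nu> \<otimes>\<^bsub>N\<^esub> b g = \<nu> \<otimes>\<^bsub>N\<^esub> b h" using alpha_apply(2) \<nu> by metis
    then show "g = h" using b_inj b_closed gh \<nu> by (simp add: N.l_cancel)
  qed
  moreover have "finite (carrier G)" by (simp add: G.carrier_eq)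
  moreover have "\<alpha> \<nu> ` carrier G \<subseteq> carrier G" using alpha_apply(1) \<nu> by auto
  ultimately have "bij_betw (\<alpha> \<nu>) (carrier G) (carrier G)"
    by (simp add: bij_betw_def endo_inj_surj)
  then show ?thesis by (simp add: Bij_def alpha_def)
qed

lemma alpha_mult:
  assumes "\<nu> \<in> carrier N" "\<mu> \<in> carrier N"
  shows "\<alpha> \<nu> \<otimes>\<^bsub>BG\<^esub> \<alpha> \<mu> = \<alpha> (\<nu> \<otimes>\<^bsub>N\<^esub> \<mu>)"
proof (rule Bij_eqI[of _ "carrier G"])
  show "\<alpha> \<nu> \<otimes>\<^bsub>BG\<^esub> \<alpha> \<mu> \<in> Bij (carrier G)"
    using BG.m_closed alpha_Bij assms by (simp add: BijGroup_carrier)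
  fix g assume g: "g \<in> carrier G"
  have "(\<alpha> \<nu> \<otimes>\<^bsub>BG\<^esub> \<alpha> \<mu>) g = \<alpha> \<nu> (\<alpha> \<mu> g)"
    using g alpha_Bij assms by (simp add: BijGroup_mult_apply)
  moreover have "b (\<alpha> \<nu> (\<alpha> \<mu> g)) = b (\<alpha> (\<nu> \<otimes>\<^bsub>N\<^esub> \<mu>) g)"
    using g assms alpha_apply b_closed by (simp add: N.m_assoc)
  ultimately show "(\<alpha> \<nu> \<otimes>\<^bsub>BG\<^esub> \<alpha> \<mu>) g = \<alpha> (\<nu> \<otimes>\<^bsub>N\<^esub> \<mu>) g"
    using g assms alpha_apply(1) by (intro b_inj) auto
qed (use alpha_Bij assms in simp)

lemma alpha_inj:
  assumes "\<nu> \<in> carrier N" "\<mu> \<in> carrier N" "\<alpha> \<nu> = \<alpha> \<mu>"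
  shows "\<nu> = \<mu>"
proof -
  have "b \<one>\<^bsub>G\<^esub> = \<one>\<^bsub>N\<^esub>" using b_pow[of 0] by (simp add: B_def)
  then have "b (\<alpha> \<nu> \<one>\<^bsub>G\<^esub>) = \<nu>" "b (\<alpha> \<mu> \<one>\<^bsub>G\<^esub>) = \<mu>"
    using alpha_apply(2)[OF assms(1) G.one_closed] alpha_apply(2)[OF assms(2) G.one_closed] assms(1,2)
    by simp_all
  then show ?thesis unfolding assms(3) by metis
qed

lemma alpha_group_hom: "group_hom N BG \<alpha>"
  by unfold_locales (use alpha_Bij alpha_mult in \<open>auto simp: hom_def BijGroup_carrier\<close>)

abbreviation "M \<equiv> BG\<lparr>carrier := \<alpha> ` carrier N\<rparr>"

lemma cyclic_gen_image: "cyclic_gen M (\<alpha> \<eta>) q"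
  and alpha_pow: "\<alpha> (\<eta> [^]\<^bsub>N\<^esub> i) = \<alpha> \<eta> [^]\<^bsub>M\<^esub> (i::nat)"
proof -
  interpret \<alpha>: group_hom N BG \<alpha> by (rule alpha_group_hom)
  have sub: "subgroup (\<alpha> ` carrier N) BG" by (rule \<alpha>.img_is_subgroup)
  have pow: "\<alpha> \<eta> [^]\<^bsub>M\<^esub> i = \<alpha> (\<eta> [^]\<^bsub>N\<^esub> i)" for i :: nat
    using \<alpha>.hom_nat_pow[OF N.gen, of i] BG.nat_pow_consistent[of "\<alpha> \<eta>" i "\<alpha> ` carrier N"] by simp
  then show "\<alpha> (\<eta> [^]\<^bsub>N\<^esub> i) = \<alpha> \<eta> [^]\<^bsub>M\<^esub> (i::nat)" by simp
  interpret M: group M by (rule BG.subgroup_imp_group[OF sub])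
  show "cyclic_gen M (\<alpha> \<eta>) q"
  proof
    show "\<alpha> \<eta> [^]\<^bsub>M\<^esub> i = \<alpha> \<eta> [^]\<^bsub>M\<^esub> j \<longleftrightarrow> [i = j] (mod q)" for i j :: nat
      unfolding pow N.pow_eq[symmetric] using alpha_inj by auto
    show "carrier M = (\<lambda>i. \<alpha> \<eta> [^]\<^bsub>M\<^esub> i) ` {..<q}"
      unfolding pow by (simp add: N.carrier_eq image_image)
  qed (use N.pos N.gen in auto)
qed

text \<open>Through \<open>b\<close>, left translation by the \<open>k\<close>-th power of \<sigma>
  becomes an affine map with linear part \<open>d ^ k\<close>, and \<open>\<alpha>\<close> of the
  \<open>i\<close>-th power of \<eta> becomes translation by \<open>i\<close>. Conjugating a
  translation by an affine map applies the linear part to it.\<close>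

lemma conj_act_alpha:
  "conj_act G (\<sigma> [^]\<^bsub>G\<^esub> k) (\<alpha> (\<eta> [^]\<^bsub>N\<^esub> i)) = \<alpha> (\<eta> [^]\<^bsub>N\<^esub> (d ^ k * i))" for k i :: nat
proof -
  let ?g = "\<sigma> [^]\<^bsub>G\<^esub> k" and ?a = "\<alpha> (\<eta> [^]\<^bsub>N\<^esub> i)" and ?a' = "\<alpha> (\<eta> [^]\<^bsub>N\<^esub> (d ^ k * i))"
  have l: "left_reg G ?g \<in> Bij (carrier G)" by (simp add: G.left_reg_Bij)
  have a: "?a \<in> Bij (carrier G)" "?a' \<in> Bij (carrier G)" by (simp_all add: alpha_Bij)
  have "left_reg G ?g \<otimes>\<^bsub>BG\<^esub> ?a = ?a' \<otimes>\<^bsub>BG\<^esub> left_reg G ?g"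
  proof (rule Bij_eqI[of _ "carrier G"])
    fix h assume h: "h \<in> carrier G"
    obtain x :: nat where x: "b h = \<eta> [^]\<^bsub>N\<^esub> x" using b_closed[OF h] N.exists_pow by blast
    have ah: "?a h \<in> carrier G" "b (?a h) = \<eta> [^]\<^bsub>N\<^esub> (i + x)"
      using alpha_apply[OF N.pow_closed h, of i] N.gen by (simp_all add: x N.nat_pow_mult)
    have gh: "?g \<otimes>\<^bsub>G\<^esub> h \<in> carrier G" using h by simp
    have "b (?g \<otimes>\<^bsub>G\<^esub> ?a h) = \<eta> [^]\<^bsub>N\<^esub> (d ^ k * (i + x) + B k)"
      by (simp add: b_mult ah Tk_pow)
    also have "\<dots> = b (?a' (?g \<otimes>\<^bsub>G\<^esub> h))"
      using alpha_apply(2)[OF N.pow_closed gh, of "d ^ k * i"] N.gen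
      by (simp add: b_mult h x Tk_pow N.nat_pow_mult algebra_simps)
    finally have "?g \<otimes>\<^bsub>G\<^esub> ?a h = ?a' (?g \<otimes>\<^bsub>G\<^esub> h)"
      using ah(1) alpha_apply(1)[OF N.pow_closed gh] by (intro b_inj) auto
    then show "(left_reg G ?g \<otimes>\<^bsub>BG\<^esub> ?a) h = (?a' \<otimes>\<^bsub>BG\<^esub> left_reg G ?g) h"
      using h l a ah(1) gh by (simp add: BijGroup_mult_apply) (simp add: left_reg_def)
  qed (use BG.m_closed l a in \<open>simp_all add: BijGroup_carrier\<close>)
  then show ?thesis
    unfolding conj_act_def using l a BG.m_assoc[of ?a' "left_reg G ?g" "inv\<^bsub>BG\<^esub> left_reg G ?g"]
    by (simp add: BijGroup_carrier[symmetric])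
qed

end


section \<open>Galois groups and automorphisms of cyclic groups\<close>

lemma (in ring) subgroup_Gal:
  assumes K: "K \<subseteq> carrier R"
  shows "subgroup (carrier (Gal R K)) (BijGroup (carrier R))"
proof (rule group.subgroupI[OF group_BijGroup])
  show "carrier (Gal R K) \<subseteq> carrier (BijGroup (carrier R))"
    by (auto simp: Gal_def BijGroup_def)
  have "(\<lambda>x\<in>carrier R. x) \<in> carrier (Gal R K)"
    using K by (auto simp: Gal_def id_Bij ring_hom_def)
  then show "carrier (Gal R K) \<noteq> {}" by blast
next
  fix f assume "f \<in> carrier (Gal R K)"
  then have f: "f \<in> Bij (carrier R)" "f \<in> ring_hom R R" "\<And>x. x \<in> K \<Longrightarrow> f x = x"
    by (auto simp: Gal_def)
  let ?g = "\<lambda>x\<in>carrier R. inv_into (carrier R) f x"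
  have inj: "inj_on f (carrier R)" using f(1) by (simp add: Bij_def bij_betw_def)
  have "?g \<in> ring_hom R R"
  proof (rule ring_hom_memI)
    fix x y assume xy: "x \<in> carrier R" "y \<in> carrier R"
    show "?g x \<in> carrier R" using f(1) xy by (simp add: Bij_inv_into_mem)
    show "?g (x \<otimes> y) = ?g x \<otimes> ?g y"
      using Bij_inv_into_lemma[of "carrier R" f "(\<otimes>)" x y] f xy ring_hom_mult[OF f(2)] by auto
    show "?g (x \<oplus> y) = ?g x \<oplus> ?g y"
      using Bij_inv_into_lemma[of "carrier R" f "(\<oplus>)" x y] f xy ring_hom_add[OF f(2)] by auto
  next
    show "?g \<one> = \<one>" using inj ring_hom_one[OF f(2)] by (simp add: inv_into_f_eq)
  qed
  moreover have "?g x = x" if "x \<in> K" for x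
    using that K f(3) inj by (auto simp: inv_into_f_eq)
  moreover have "?g \<in> Bij (carrier R)" by (rule restrict_inv_into_Bij[OF f(1)])
  ultimately show "inv\<^bsub>BijGroup (carrier R)\<^esub> f \<in> carrier (Gal R K)"
    using inv_BijGroup[OF f(1)] by (simp add: Gal_def)
next
  fix f g assume "f \<in> carrier (Gal R K)" "g \<in> carrier (Gal R K)"
  then have f: "f \<in> Bij (carrier R)" "f \<in> ring_hom R R" "\<And>x. x \<in> K \<Longrightarrow> f x = x"
    and g: "g \<in> Bij (carrier R)" "g \<in> ring_hom R R" "\<And>x. x \<in> K \<Longrightarrow> g x = x"
    by (auto simp: Gal_def)
  have "compose (carrier R) f g \<in> ring_hom R R"
    using f(2) g(2) by (auto simp: ring_hom_def compose_eq Pi_iff)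
  moreover have "compose (carrier R) f g x = x" if "x \<in> K" for x
    using that f(3) g(3) K by (simp add: compose_eq subset_iff)
  ultimately show "f \<otimes>\<^bsub>BijGroup (carrier R)\<^esub> g \<in> carrier (Gal R K)"
    using f g by (simp add: Gal_def BijGroup_def compose_Bij)
qed

lemma (in ring) group_Gal:
  assumes "K \<subseteq> carrier R"
  shows "group (Gal R K)"
proof -
  have "Gal R K = BijGroup (carrier R)\<lparr>carrier := carrier (Gal R K)\<rparr>" by (simp add: Gal_def)
  then show ?thesis
    using group.subgroup_imp_group[OF group_BijGroup subgroup_Gal[OF assms]] by simp
qed

text \<open>The product in \<open>Gal\<close> is composition restricted to the carrier, so group
  powers and iterates are compared on the carrier only.\<close>

lemma (in ring) Gal_pow_apply:
  assumes \<phi>: "\<phi> \<in> carrier (Gal R K)" and x: "x \<in> carrier R" and K: "K \<subseteq> carrier R"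
  shows "(\<phi> [^]\<^bsub>Gal R K\<^esub> (k::nat)) x = (\<phi> ^^ k) x"
  using x
proof (induction k arbitrary: x)
  case 0
  then show ?case by (simp add: Gal_def BijGroup_def)
next
  case (Suc k)
  interpret group "Gal R K" by (rule group_Gal[OF K])
  have Bij: "\<psi> \<in> Bij (carrier R)" if "\<psi> \<in> carrier (Gal R K)" for \<psi> using that by (simp add: Gal_def)
  have "(\<phi> [^]\<^bsub>Gal R K\<^esub> Suc k) x = (\<phi> [^]\<^bsub>Gal R K\<^esub> k \<otimes>\<^bsub>BijGroup (carrier R)\<^esub> \<phi>) x"
    by (simp add: Gal_def)
  also have "\<dots> = (\<phi> [^]\<^bsub>Gal R K\<^esub> k) (\<phi> x)"
    by (rule BijGroup_mult_apply) (use Bij \<phi> Suc.prems in auto)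
  also have "\<dots> = (\<phi> ^^ k) (\<phi> x)"
    using Suc.IH[of "\<phi> x"] Bij_closed[OF Bij[OF \<phi>] Suc.prems] by simp
  finally show ?case by (simp add: funpow_swap1)
qed

text \<open>Two iterates of \<sigma> coincide, since at most \<open>p ^ n\<close> embeddings over
  \<open>K\<close> exist. Thus \<sigma> has finite order; its fixed field is that of the whole
  group, namely \<open>K\<close>, and Artin's theorem identifies the order with the degree.\<close>

lemma cyclic_galois:
  assumes p: "Factorial_Ring.prime p"
    and galois: "finite_galois L K" "ring.dimension L (p ^ n) K (carrier L)"
    and G: "\<sigma> \<in> carrier (Gal L K)" "carrier (Gal L K) = generate (Gal L K) {\<sigma>}"
  shows "cyclic_extension L K \<sigma> p n" "cyclic_gen (Gal L K) \<sigma> (p ^ n)"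
proof -
  interpret L: field L using galois(1) by (simp add: finite_galois_def)
  have K: "subfield K L" using galois(1) by (simp add: finite_galois_def)
  have Kc: "K \<subseteq> carrier L" using subringE(1)[OF subfieldE(1)[OF K]] .
  interpret G: group "Gal L K" by (rule L.group_Gal[OF Kc])
  note pow = L.Gal_pow_apply[OF G(1) _ Kc]
  have \<sigma>: "\<sigma> \<in> Bij (carrier L)" "\<sigma> \<in> ring_hom L L" "\<And>x. x \<in> K \<Longrightarrow> \<sigma> x = x"
    using G(1) by (auto simp: Gal_def)
  have hom: "\<sigma> ^^ k \<in> ring_hom L L" for k by (rule L.funpow_ring_hom[OF \<sigma>(2)])
  have one: "\<sigma> [^]\<^bsub>Gal L K\<^esub> k = \<one>\<^bsub>Gal L K\<^esub> \<longleftrightarrow> (\<forall>x\<in>carrier L. (\<sigma> ^^ k) x = x)" for k :: nat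
  proof -
    have o: "\<one>\<^bsub>Gal L K\<^esub> = (\<lambda>x\<in>carrier L. x)" by (simp add: Gal_def BijGroup_def)
    have "\<sigma> [^]\<^bsub>Gal L K\<^esub> k \<in> Bij (carrier L)"
      using G.nat_pow_closed[OF G(1), of k] by (simp add: Gal_def)
    then have "\<sigma> [^]\<^bsub>Gal L K\<^esub> k = \<one>\<^bsub>Gal L K\<^esub> \<longleftrightarrow> (\<forall>x\<in>carrier L. (\<sigma> [^]\<^bsub>Gal L K\<^esub> k) x = x)"
      unfolding o by (auto intro!: Bij_eqI[where S = "carrier L"] id_Bij)
    then show ?thesis by (simp add: pow)
  qed
  have "\<exists>i j. i < j \<and> (\<forall>x\<in>carrier L. (\<sigma> ^^ i) x = (\<sigma> ^^ j) x)"
  proof (rule ccontr)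
    assume no: "\<not> ?thesis"
    have "card {..p ^ n} \<le> p ^ n"
    proof (rule L.card_embeddings_le_dimension[OF K L.carrier_is_subring Kc galois(2), where \<phi> = "\<lambda>k. \<sigma> ^^ k"])
      fix i k assume "k \<in> K"
      then show "(\<sigma> ^^ i) k = k" using \<sigma>(3) funpow_mult_fixed[where f = \<sigma> and k = 1 and j = i] by simp
    next
      fix i j :: nat assume "i \<noteq> j"
      then show "\<exists>x\<in>carrier L. (\<sigma> ^^ i) x \<noteq> (\<sigma> ^^ j) x" using no by (metis linorder_neqE_nat)
    qed (use hom in auto)
    then show False by simp
  qed
  then obtain i j where ij: "i < j" "\<And>x. x \<in> carrier L \<Longrightarrow> (\<sigma> ^^ i) x = (\<sigma> ^^ j) x" by blast
  have "(\<sigma> ^^ (j - i)) x = x" if x: "x \<in> carrier L" for x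
  proof -
    have eq: "(\<sigma> ^^ i) ((\<sigma> ^^ (j - i)) x) = (\<sigma> ^^ i) x"
      using ij(1) ij(2)[OF x] by (simp flip: funpow_add comp_apply[of "\<sigma> ^^ _"])
    interpret ring_hom_cring L L "\<sigma> ^^ i" using hom by unfold_locales
    have "inj_on (\<sigma> ^^ i) (carrier L)"
      by (rule non_trivial_field_hom_is_inj) (auto intro: L.field_axioms)
    then show ?thesis using eq x ring_hom_closed[OF hom x] by (meson inj_onD)
  qed
  then have "\<sigma> [^]\<^bsub>Gal L K\<^esub> (j - i) = \<one>\<^bsub>Gal L K\<^esub>" by (simp add: one)
  \<comment> \<open>\<open>ord\<close> takes the value 0 on elements of infinite order, so
    positivity is the finiteness statement.\<close>
  then have ord: "0 < G.ord \<sigma>" using G.ord_eq_0[OF G(1)] ij(1) by (metis gr0I zero_less_diff less_numeral_extra(3))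
  have fixed: "K = {x \<in> carrier L. \<sigma> x = x}"
  proof (intro equalityI subsetI)
    fix x assume x: "x \<in> {x \<in> carrier L. \<sigma> x = x}"
    have "\<phi> x = x" if "\<phi> \<in> carrier (Gal L K)" for \<phi>
    proof -
      have "carrier (Gal L K) = {\<sigma> [^]\<^bsub>Gal L K\<^esub> k | k. k \<in> (UNIV :: nat set)}"
        using G.generate_pow_nat[OF G(1)] ord G(2) by simp
      with that obtain k :: nat where "\<phi> = \<sigma> [^]\<^bsub>Gal L K\<^esub> k" by blast
      then show ?thesis
        using x pow[of x k] funpow_mult_fixed[where f = \<sigma> and k = 1 and j = k] by simp
    qed
    then have "x \<in> {x \<in> carrier L. \<forall>\<phi>\<in>carrier (Gal L K). \<phi> x = x}" using x by auto
    then show "x \<in> K" using galois(1) unfolding finite_galois_def by blast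
  qed (use \<sigma>(3) Kc in auto)
  have period: "(\<sigma> ^^ G.ord \<sigma>) x = x" if "x \<in> carrier L" for x
    using one[of "G.ord \<sigma>"] G.pow_ord_eq_1[OF G(1)] that by blast
  have exact: "\<exists>x\<in>carrier L. (\<sigma> ^^ k) x \<noteq> x" if "0 < k" "k < G.ord \<sigma>" for k
    using one[of k] G.pow_eq_id[OF G(1), of k] that by (auto dest: dvd_imp_le)
  have ordq: "p ^ n = G.ord \<sigma>"
    using L.dimension_over_fixed[OF \<sigma>(2) ord period exact] galois(2) fixed by simp
  show "cyclic_gen (Gal L K) \<sigma> (p ^ n)"
    using G.cyclic_genI[OF G] ord ordq by simp
  show "cyclic_extension L K \<sigma> p n"
    by unfold_locales (use \<sigma>(2) fixed period exact ordq galois(2) p in auto)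
qed

section \<open>Automorphisms of a cyclic group of odd prime power order\<close>

context cyclic_gen
begin

lemma comm: "y \<in> carrier G \<Longrightarrow> z \<in> carrier G \<Longrightarrow> y \<otimes> z = z \<otimes> y"
  using exists_pow gen by (metis add.commute nat_pow_mult)

lemma pow_auto:
  assumes c: "coprime c q"
  shows "(\<lambda>y\<in>carrier G. y [^] c) \<in> carrier (AutoGroup G)"
proof -
  have "inj_on (\<lambda>y. y [^] c) (carrier G)"
  proof (rule inj_onI)
    fix y z assume yz: "y \<in> carrier G" "z \<in> carrier G" "y [^] c = z [^] c"
    then obtain i j :: nat where ij: "y = x [^] i" "z = x [^] j" using exists_pow by metis
    then have "[i * c = j * c] (mod q)" using yz(3) gen pow_eq by (simp add: nat_pow_pow)
    then have "[i = j] (mod q)" using c by (simp add: cong_mult_rcancel_nat)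
    then show "y = z" using ij pow_eq by simp
  qed
  moreover have "finite (carrier G)" by (simp add: carrier_eq)
  ultimately have "bij_betw (\<lambda>y. y [^] c) (carrier G) (carrier G)"
    by (simp add: bij_betw_def endo_inj_surj image_subset_iff)
  moreover have "(y \<otimes> z) [^] c = y [^] c \<otimes> z [^] c" if "y \<in> carrier G" "z \<in> carrier G" for y z
    using that comm by (intro pow_mult_distrib) auto
  ultimately show ?thesis by (auto simp: AutoGroup_def auto_def Bij_def hom_def)
qed

lemma finite_AutoGroup: "finite (carrier (AutoGroup G))"
proof (rule finite_subset)
  show "carrier (AutoGroup G) \<subseteq> carrier G \<rightarrow>\<^sub>E carrier G"
    by (auto simp: AutoGroup_def auto_def Bij_def PiE_def bij_betw_def)
  show "finite (carrier G \<rightarrow>\<^sub>E carrier G)" by (intro finite_PiE) (auto simp: carrier_eq)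
qed

lemma AutoGroup_pow_apply:
  assumes \<gamma>: "\<gamma> \<in> carrier (AutoGroup G)" "\<gamma> x = x [^] (g::nat)"
  shows "(\<gamma> [^]\<^bsub>AutoGroup G\<^esub> (k::nat)) x = x [^] (g ^ k)"
proof (induction k)
  case 0
  show ?case using gen by (simp add: AutoGroup_def BijGroup_def)
next
  case (Suc k)
  interpret A: group "AutoGroup G" by (rule AutoGroup)
  have Bij: "\<psi> \<in> Bij (carrier G)" and hom: "\<psi> \<in> hom G G" if "\<psi> \<in> carrier (AutoGroup G)" for \<psi>
    using that by (simp_all add: AutoGroup_def auto_def)
  have k: "\<gamma> [^]\<^bsub>AutoGroup G\<^esub> k \<in> carrier (AutoGroup G)" using \<gamma> by simp
  interpret h: group_hom G G "\<gamma> [^]\<^bsub>AutoGroup G\<^esub> k" using hom[OF k] by unfold_locales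
  have "(\<gamma> [^]\<^bsub>AutoGroup G\<^esub> Suc k) x = (\<gamma> [^]\<^bsub>AutoGroup G\<^esub> k \<otimes>\<^bsub>BijGroup (carrier G)\<^esub> \<gamma>) x"
    by (simp add: AutoGroup_def)
  also have "\<dots> = (\<gamma> [^]\<^bsub>AutoGroup G\<^esub> k) (\<gamma> x)"
    by (rule BijGroup_mult_apply[OF Bij[OF k] Bij[OF \<gamma>(1)] gen])
  also have "\<dots> = x [^] (g ^ Suc k)"
    using gen by (simp add: \<gamma>(2) h.hom_nat_pow Suc.IH nat_pow_pow mult.commute)
  finally show ?case .
qed

text \<open>Surjectivity of \<gamma> makes \<open>g\<close> a unit modulo \<open>p\<close>, so
  Fermat's theorem provides \<open>a\<close>. Because \<gamma> generates all automorphisms,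
  \<open>1 + p\<close> is a power of \<open>g\<close> modulo \<open>p ^ n\<close>, which rules out
  \<open>p\<close> dividing \<open>a\<close>.\<close>

lemma AutoGroup_generator:
  assumes q: "q = p ^ n" and p: "Factorial_Ring.prime p" "odd p" "1 \<le> n"
    and \<gamma>: "\<gamma> \<in> carrier (AutoGroup G)" "carrier (AutoGroup G) = generate (AutoGroup G) {\<gamma>}"
  shows "\<exists>g a :: nat. \<gamma> x = x [^] g \<and> g ^ (p - 1) = 1 + p * a \<and> (2 \<le> n \<longrightarrow> \<not> p dvd a)"
proof -
  interpret A: group "AutoGroup G" by (rule AutoGroup)
  have \<gamma>': "\<gamma> \<in> Bij (carrier G)" "\<gamma> \<in> hom G G"
    using \<gamma>(1) by (simp_all add: AutoGroup_def auto_def)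
  obtain g :: nat where g: "\<gamma> x = x [^] g" using Bij_closed[OF \<gamma>'(1) gen] exists_pow by blast
  interpret h: group_hom G G \<gamma> using \<gamma>'(2) by unfold_locales
  have "x \<in> \<gamma> ` carrier G" using \<gamma>'(1) gen by (simp add: Bij_def bij_betw_def)
  then obtain y where y: "y \<in> carrier G" "x = \<gamma> y" by blast
  obtain i :: nat where i: "y = x [^] i" using exists_pow[OF y(1)] by blast
  have xi: "x = \<gamma> (x [^] i)" unfolding i[symmetric] by (rule y(2))
  have "\<gamma> (x [^] i) = x [^] (g * i)" using gen g by (simp add: h.hom_nat_pow nat_pow_pow)
  then have "x [^] (1::nat) = x [^] (g * i)" using gen xi by (metis nat_pow_eone)
  then have "[1 = g * i] (mod p ^ n)" using pow_eq q by blast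
  then have "[g * i = 1] (mod p)"
    using p(3) by (metis cong_dvd_modulus_nat cong_sym dvd_power less_le_trans zero_less_one)
  then have "\<not> p dvd g"
    using p(1) by (metis cong_dvd_iff dvd_mult2 nat_dvd_1_iff_1 not_prime_1)
  then have "[g ^ (p - 1) = 1] (mod p)" using fermat_theorem[OF p(1)] by blast
  moreover have "1 \<le> g ^ (p - 1)" using \<open>\<not> p dvd g\<close> by (cases "g = 0") auto
  ultimately obtain a where a: "g ^ (p - 1) = 1 + p * a"
    by (metis cong_altdef_nat dvdE le_add_diff_inverse)
  have "\<not> p dvd a" if n: "2 \<le> n"
  proof -
    \<comment> \<open>\<open>1 + p\<close> is the test element: a unit with order exactly
      \<open>p\<close> modulo \<open>p ^ 2\<close>.\<close>
    have "coprime (1 + p) q"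
      unfolding q by (simp add: coprime_power_right_iff)
    then have "(\<lambda>y\<in>carrier G. y [^] (1 + p)) \<in> carrier (AutoGroup G)" by (rule pow_auto)
    then obtain k :: nat where k: "(\<lambda>y\<in>carrier G. y [^] (1 + p)) = \<gamma> [^]\<^bsub>AutoGroup G\<^esub> k"
      using A.generate_pow_on_finite_carrier[OF finite_AutoGroup \<gamma>(1)] \<gamma>(2) by auto
    have "x [^] (1 + p) = x [^] (g ^ k)"
      using AutoGroup_pow_apply[OF \<gamma>(1) g, of k] k[symmetric] gen by simp
    then have "[g ^ k = 1 + p] (mod p ^ n)" using pow_eq q cong_sym by blast
    then show ?thesis by (rule primitive_multiplier_exact[OF p(1,2) n a])
  qed
  with g a show ?thesis by blast
qed

end


section \<open>The Hopf algebra as an algebra of equivariant functions\<close>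

lemma alg_prod_cong:
  assumes "\<And>i. i \<in> I \<Longrightarrow> A i = A' i"
  shows "alg_prod I A = alg_prod I A'"
  unfolding alg_prod_def using assms by (auto simp: fun_eq_iff restrict_def intro!: PiE_cong)

locale hopf_descent =
  E: cyclic_extension L K \<sigma> p n + R: regular_embedding N \<eta> "p ^ n" "Gal L K" \<sigma> \<delta> s d +
  O: orbit_transversal p n e "d ^ (p ^ n - 1)"
  for L :: "('a, 'm) ring_scheme" and K \<sigma> p n and N :: "('c, 'n) monoid_scheme" and \<eta> \<delta> s d e +
  fixes \<zeta>
  assumes \<zeta>: "\<zeta> \<in> K" "\<And>j :: nat. \<zeta> [^]\<^bsub>L\<^esub> j = \<one>\<^bsub>L\<^esub> \<longleftrightarrow> p ^ n dvd j"
    and char: "[(p ^ n)] \<cdot>\<^bsub>L\<^esub> \<one>\<^bsub>L\<^esub> \<noteq> \<zero>\<^bsub>L\<^esub>"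
begin

text \<open>The action of a group element reads coefficients at the conjugate by its inverse, and
  \<open>inv_pow\<close> writes the inverse of \<sigma> as its power of exponent
  \<open>p ^ n - 1\<close>; this power conjugates by the multiplier \<open>D\<close>.\<close>

abbreviation "D \<equiv> d ^ (p ^ n - 1)"

lemma \<zeta>_fixed: "\<zeta> \<in> carrier L" "\<sigma> \<zeta> = \<zeta>"
  using \<zeta>(1) by (auto simp: E.fixed)

sublocale F: cyclic_dft L R.M "R.\<alpha> \<eta>" "p ^ n" \<zeta>
proof -
  interpret M: cyclic_gen R.M "R.\<alpha> \<eta>" "p ^ n" by (rule R.cyclic_gen_image)
  show "cyclic_dft L R.M (R.\<alpha> \<eta>) (p ^ n) \<zeta>"
    by unfold_locales (use \<zeta>_fixed \<zeta>(2) char in auto)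
qed

abbreviation "H \<equiv> hopf_alg L (Gal L K) \<sigma> N \<eta> \<delta> s"
abbreviation "A \<equiv> group_alg L R.M"

lemma D_coprime: "coprime D (p ^ n)"
  by (rule R.d_coprime)

lemma semilinear_act_apply:
  fixes k i :: nat
  assumes f: "f \<in> carrier A"
  shows "semilinear_act (Gal L K) (R.\<alpha> ` carrier N) (\<sigma> [^]\<^bsub>Gal L K\<^esub> k) f (R.\<alpha> \<eta> [^]\<^bsub>R.M\<^esub> i)
    = (\<sigma> ^^ k) (f (R.\<alpha> \<eta> [^]\<^bsub>R.M\<^esub> (D ^ k * i)))"
proof -
  have "conj_act (Gal L K) (inv\<^bsub>Gal L K\<^esub> (\<sigma> [^]\<^bsub>Gal L K\<^esub> k)) (R.\<alpha> (\<eta> [^]\<^bsub>N\<^esub> i)) = R.\<alpha> (\<eta> [^]\<^bsub>N\<^esub> (D ^ k * i))"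
    unfolding R.G.inv_pow R.conj_act_alpha by (simp add: power_mult)
  moreover have "f (R.\<alpha> (\<eta> [^]\<^bsub>N\<^esub> (D ^ k * i))) \<in> carrier L"
    using F.group_alg_eval_closed[OF f] by auto
  moreover have "K \<subseteq> carrier L" using E.K_subfield subfieldE(3) by blast
  ultimately show ?thesis
    unfolding R.alpha_pow[symmetric] by (simp add: semilinear_act_def E.Gal_pow_apply[OF R.G.gen])
qed

text \<open>Invariance under the generator \<sigma> implies invariance under all its powers; for
  \<sigma> alone, \<open>dft_equivariant_iff\<close> carries the condition to the transform.\<close>

lemma carrier_hopf_alg:
  "carrier H = {f \<in> carrier A. \<forall>j. F.dft f (D * j) = \<sigma> (F.dft f j)}"
proof -
  let ?w = "\<lambda>i::nat. R.\<alpha> \<eta> [^]\<^bsub>R.M\<^esub> i"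
  let ?P = "R.\<alpha> ` carrier N"
  have "(\<forall>g\<in>carrier (Gal L K). semilinear_act (Gal L K) ?P g f = f) \<longleftrightarrow> (\<forall>i. \<sigma> (f (?w (D * i))) = f (?w i))"
    if f: "f \<in> carrier A" for f
  proof
    assume *: "\<forall>g\<in>carrier (Gal L K). semilinear_act (Gal L K) ?P g f = f"
    have "(\<sigma> ^^ 1) (f (?w (D ^ 1 * i))) = f (?w i)" for i
      using semilinear_act_apply[OF f, of 1 i] * R.G.pow_closed[of 1] by simp
    then show "\<forall>i. \<sigma> (f (?w (D * i))) = f (?w i)" by simp
  next
    assume *: "\<forall>i. \<sigma> (f (?w (D * i))) = f (?w i)"
    have pow: "(\<sigma> ^^ k) (f (?w (D ^ k * i))) = f (?w i)" for k i
    proof (induction k)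
      case (Suc k)
      have "(\<sigma> ^^ Suc k) (f (?w (D ^ Suc k * i))) = (\<sigma> ^^ k) (\<sigma> (f (?w (D * (D ^ k * i)))))"
        by (simp add: funpow_swap1 mult.assoc)
      then show ?case using Suc * by simp
    qed simp
    show "\<forall>g\<in>carrier (Gal L K). semilinear_act (Gal L K) ?P g f = f"
    proof
      fix g assume "g \<in> carrier (Gal L K)"
      then obtain k :: nat where g: "g = \<sigma> [^]\<^bsub>Gal L K\<^esub> k" using R.G.exists_pow by blast
      show "semilinear_act (Gal L K) ?P g f = f"
      proof (rule extensionalityI[of _ ?P])
        show "semilinear_act (Gal L K) ?P g f \<in> extensional ?P" by (simp add: semilinear_act_def)
        show "f \<in> extensional ?P" using f by (simp add: group_alg_def PiE_iff)
        fix \<pi> assume "\<pi> \<in> ?P"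
        then obtain i :: nat where "\<pi> = ?w i" using F.M.exists_pow[of \<pi>] by auto
        then show "semilinear_act (Gal L K) ?P g f \<pi> = f \<pi>"
          using semilinear_act_apply[OF f, of k i] pow g by simp
      qed
    qed
  qed
  then show ?thesis
    using F.dft_equivariant_iff[OF E.hom \<zeta>_fixed(2) D_coprime]
    by (auto simp: hopf_alg_def descent_alg_def Let_def)
qed

lemma hopf_alg_ops:
  "monoid.mult H = monoid.mult A" "one H = one A" "ring.zero H = ring.zero A"
  "ring.add H = ring.add A" "smult H = smult A"
  by (simp_all add: hopf_alg_def descent_alg_def Let_def)

lemma hopf_alg_group_alg: "f \<in> carrier H \<Longrightarrow> f \<in> carrier A"
  by (simp add: carrier_hopf_alg)

lemma dft_D_pow:
  assumes "f \<in> carrier H"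
  shows "F.dft f (D ^ k * j) = (\<sigma> ^^ k) (F.dft f j)"
  using assms by (induction k) (simp_all add: carrier_hopf_alg mult.assoc)

lemma dft_rep_layer:
  assumes f: "f \<in> carrier H" and i: "(m, u) \<in> O.idx"
  shows "F.dft f (O.rep m u) \<in> E.layer m"
proof -
  note f' = hopf_alg_group_alg[OF f]
  have "(\<sigma> ^^ (p ^ m)) (F.dft f (O.rep m u)) = F.dft f (D ^ (p ^ m) * O.rep m u)"
    by (simp only: dft_D_pow[OF f])
  also have "\<dots> = F.dft f (O.rep m u)" by (rule F.dft_cong[OF f' O.rep_periodic[OF i]])
  finally show ?thesis using F.dft_closed[OF f'] by (simp add: E.layer_def)
qed

lemma hopf_alg_eqI:
  assumes f: "f \<in> carrier H" and g: "g \<in> carrier H"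
    and eq: "\<And>m u. (m, u) \<in> O.idx \<Longrightarrow> F.dft f (O.rep m u) = F.dft g (O.rep m u)"
  shows "f = g"
proof (rule F.dft_inject[OF hopf_alg_group_alg[OF f] hopf_alg_group_alg[OF g]])
  fix j
  obtain m u k where j: "(m, u) \<in> O.idx" "[j = D ^ k * O.rep m u] (mod p ^ n)" using O.rep_exists by blast
  have "F.dft f j = (\<sigma> ^^ k) (F.dft f (O.rep m u))"
    using F.dft_cong[OF hopf_alg_group_alg[OF f] j(2)] by (simp only: dft_D_pow[OF f])
  moreover have "F.dft g j = (\<sigma> ^^ k) (F.dft g (O.rep m u))"
    using F.dft_cong[OF hopf_alg_group_alg[OF g] j(2)] by (simp only: dft_D_pow[OF g])
  ultimately show "F.dft f j = F.dft g j" using eq[OF j(1)] by simp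
qed

lemma layer_funpow_cong:
  assumes x: "x \<in> E.layer m" and "[k = l] (mod p ^ m)"
  shows "(\<sigma> ^^ k) x = (\<sigma> ^^ l) x"
proof -
  have "(\<sigma> ^^ k) x = (\<sigma> ^^ (k mod p ^ m)) x" for k
  proof -
    have "(\<sigma> ^^ k) x = (\<sigma> ^^ (k mod p ^ m + p ^ m * (k div p ^ m))) x" by simp
    also have "\<dots> = (\<sigma> ^^ (k mod p ^ m)) ((\<sigma> ^^ (p ^ m * (k div p ^ m))) x)"
      unfolding funpow_add by simp
    also have "(\<sigma> ^^ (p ^ m * (k div p ^ m))) x = x"
      using x by (intro funpow_mult_fixed) (simp add: E.layer_def)
    finally show ?thesis .
  qed
  then show ?thesis using assms(2) unfolding cong_def by metis
qed

text \<open>The values on representatives extend along the orbits to an equivariant function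
  \<open>W\<close>, whose inverse transform lies in \<open>H\<close>.\<close>

lemma hopf_alg_interpolation:
  assumes V: "\<And>m u. (m, u) \<in> O.idx \<Longrightarrow> V m u \<in> E.layer m"
  shows "\<exists>f\<in>carrier H. \<forall>m u. (m, u) \<in> O.idx \<longrightarrow> F.dft f (O.rep m u) = V m u"
proof -
  \<comment> \<open>A residue \<open>j\<close> has several exponents \<open>k\<close>, but they
    agree modulo \<open>p ^ m\<close>, and \<open>V m u\<close> is fixed by the
    \<open>p ^ m\<close>-th iterate of \<sigma>; hence \<open>Q\<close> determines
    \<open>z\<close>.\<close>
  define Q where "Q j z \<longleftrightarrow> (\<exists>m u k. (m, u) \<in> O.idx \<and> [j = D ^ k * O.rep m u] (mod p ^ n) \<and> z = (\<sigma> ^^ k) (V m u))" for j z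
  define W where "W j = (THE z. Q j z)" for j
  have W: "W j = (\<sigma> ^^ k) (V m u)" if i: "(m, u) \<in> O.idx" "[j = D ^ k * O.rep m u] (mod p ^ n)" for j m u k
    unfolding W_def
  proof (rule the_equality)
    show "Q j ((\<sigma> ^^ k) (V m u))" using i by (auto simp: Q_def)
    fix z assume "Q j z"
    then obtain m' u' k' where i': "(m', u') \<in> O.idx" "[j = D ^ k' * O.rep m' u'] (mod p ^ n)"
        "z = (\<sigma> ^^ k') (V m' u')" by (auto simp: Q_def)
    have "[D ^ k' * O.rep m' u' = D ^ k * O.rep m u] (mod p ^ n)"
      using i(2) i'(2) by (metis cong_sym cong_trans)
    from O.rep_unique[OF i'(1) i(1) this] show "z = (\<sigma> ^^ k) (V m u)"
      using i'(3) layer_funpow_cong[OF V[OF i(1)]] by auto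
  qed
  have Wc: "W j \<in> carrier L" for j
  proof -
    obtain m u k where j: "(m, u) \<in> O.idx" "[j = D ^ k * O.rep m u] (mod p ^ n)" using O.rep_exists by blast
    have "V m u \<in> carrier L" using V[OF j(1)] by (simp add: E.layer_def)
    then show ?thesis
      unfolding W[OF j] using ring_hom_closed[OF E.funpow_ring_hom[OF E.hom]] by blast
  qed
  have W_D: "W (D * j) = \<sigma> (W j)" for j
  proof -
    obtain m u k where j: "(m, u) \<in> O.idx" "[j = D ^ k * O.rep m u] (mod p ^ n)" using O.rep_exists by blast
    have "[D * j = D ^ Suc k * O.rep m u] (mod p ^ n)"
      using cong_scalar_left[OF j(2), of D] by (simp add: mult.assoc)
    then have "W (D * j) = (\<sigma> ^^ Suc k) (V m u)" by (rule W[OF j(1)])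
    then show ?thesis using W[OF j] by simp
  qed
  have W_cong: "W i = W j" if "[i = j] (mod p ^ n)" for i j
  proof -
    obtain m u k where j: "(m, u) \<in> O.idx" "[j = D ^ k * O.rep m u] (mod p ^ n)" using O.rep_exists by blast
    then show ?thesis using W[OF j(1)] that cong_trans by metis
  qed
  obtain f where f: "f \<in> carrier A" "\<And>j. j < p ^ n \<Longrightarrow> F.dft f j = W j"
    using F.dft_surj[of W] Wc by blast
  have fW: "F.dft f j = W j" for j
  proof -
    have j: "[j = j mod p ^ n] (mod p ^ n)" by (simp add: cong_def)
    show ?thesis
      using F.dft_cong[OF f(1) j] f(2)[of "j mod p ^ n"] W_cong[OF j] E.pos[of n] by simp
  qed
  have "f \<in> carrier H" using f(1) by (simp add: carrier_hopf_alg fW W_D del: One_nat_def)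
  moreover have "F.dft f (O.rep m u) = V m u" if "(m, u) \<in> O.idx" for m u
    using W[OF that, of "O.rep m u" 0] by (simp add: fW)
  ultimately show ?thesis by blast
qed

text \<open>The isomorphism evaluates the transform at the orbit representatives. Injectivity is
  \<open>hopf_alg_eqI\<close>, surjectivity is \<open>hopf_alg_interpolation\<close>, and
  compatibility with products holds because each evaluation is a character.\<close>

lemma hopf_alg_isomorphic:
  "alg_isomorphic (L\<lparr>carrier := K\<rparr>) H
    (alg_times (alg_power (field_alg L K) (p ^ e))
      (alg_prod {1..n - e} (\<lambda>m. alg_power (field_alg L (E.layer m)) (p ^ (e - 1) * (p - 1)))))"
  (is "alg_isomorphic ?K H (alg_times ?B0 (alg_prod ?J ?B1))")
proof -
  define c where "c = p ^ (e - 1) * (p - 1)"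
  have "card {u. u < p ^ e \<and> \<not> p dvd u} = card {..<c}"
    using card_less_not_dvd_prime_power[OF O.p O.e(1)] by (simp add: c_def)
  \<comment> \<open>\<open>alg_power\<close> indexes its factors by an initial segment, so the units
    below \<open>p ^ e\<close> are enumerated.\<close>
  then obtain U where U: "bij_betw U {..<c} {u. u < p ^ e \<and> \<not> p dvd u}"
    using finite_same_card_bij[of "{..<c}" "{u. u < p ^ e \<and> \<not> p dvd u}"] by auto
  define h where "h f = (\<lambda>i\<in>{..<p ^ e}. F.dft f (O.rep 0 i), \<lambda>m\<in>?J. \<lambda>k\<in>{..<c}. F.dft f (O.rep m (U k)))" for f
  note h_simps = h_def c_def alg_times_def alg_power_def alg_prod_def field_alg_def fun_eq_iff
  have idx0: "(0, i) \<in> O.idx" if "i < p ^ e" for i using that by (simp add: O.idx_def)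
  have idx1: "(m, U k) \<in> O.idx" if "m \<in> ?J" "k < c" for m k
    using that U by (auto simp: O.idx_def bij_betw_def)
  have Kc: "cring ?K" using E.subfield_iff(2)[OF E.K_subfield] fieldE(1) by blast
  have alg_layer: "algebra ?K (alg_power (field_alg L (E.layer m)) l)" for m l
    unfolding alg_power_def
    by (intro algebra_alg_prod Kc algebra_field_alg E.field_axioms E.K_subfield E.layer_subfield E.K_subset_layer)
  have algB: "algebra ?K (alg_times ?B0 (alg_prod ?J ?B1))"
    using alg_layer[of 0] unfolding E.layer_0
    by (intro algebra_alg_times algebra_alg_prod Kc alg_layer)
  show ?thesis
  proof (rule alg_isomorphic_transport[OF algB, where h = h])
    show "bij_betw h (carrier H) (carrier (alg_times ?B0 (alg_prod ?J ?B1)))"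
    proof (rule bij_betwI')
      fix f g assume fg: "f \<in> carrier H" "g \<in> carrier H"
      show "h f = h g \<longleftrightarrow> f = g"
      proof
        assume eq: "h f = h g"
        show "f = g"
        proof (rule hopf_alg_eqI[OF fg])
          fix m u assume i: "(m, u) \<in> O.idx"
          show "F.dft f (O.rep m u) = F.dft g (O.rep m u)"
          proof (cases "m = 0")
            case True
            then have "u \<in> {..<p ^ e}" using i by (simp add: O.idx_def)
            then show ?thesis using fun_cong[OF arg_cong[OF eq, of fst], of u] True by (simp add: h_def)
          next
            case False
            then have "m \<in> ?J" "u \<in> U ` {..<c}" using i U by (auto simp: O.idx_def bij_betw_def)
            then obtain k where k: "k < c" "u = U k" by auto
            then show ?thesis
              using fun_cong[OF fun_cong[OF arg_cong[OF eq, of snd], of m], of k] \<open>m \<in> ?J\<close> by (simp add: h_def)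
          qed
        qed
      qed simp
    next
      fix f assume f: "f \<in> carrier H"
      show "h f \<in> carrier (alg_times ?B0 (alg_prod ?J ?B1))"
        using dft_rep_layer[OF f idx0] dft_rep_layer[OF f idx1]
        by (auto simp: h_def alg_times_def alg_power_def alg_prod_def field_alg_def E.layer_0 c_def)
    next
      fix y assume "y \<in> carrier (alg_times ?B0 (alg_prod ?J ?B1))"
      then obtain y0 y1 where y: "y = (y0, y1)" "y0 \<in> {..<p ^ e} \<rightarrow>\<^sub>E K" "y1 \<in> (\<Pi>\<^sub>E m\<in>?J. {..<c} \<rightarrow>\<^sub>E E.layer m)"
        by (auto simp: alg_times_def alg_power_def alg_prod_def field_alg_def c_def)
      define V where "V m u = (if m = 0 then y0 u else y1 m (inv_into {..<c} U u))" for m u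
      have VU: "V m (U k) = y1 m k" if "m \<in> ?J" "k < c" for m k
        using that U by (auto simp: V_def bij_betw_def inv_into_f_f)
      have "V m u \<in> E.layer m" if i: "(m, u) \<in> O.idx" for m u
      proof (cases "m = 0")
        case True
        then show ?thesis using i y(2) by (auto simp: V_def O.idx_def E.layer_0)
      next
        case False
        then have m: "m \<in> ?J" and "u \<in> U ` {..<c}" using i U by (auto simp: O.idx_def bij_betw_def)
        then obtain k where k: "k < c" "u = U k" by auto
        have "y1 m \<in> {..<c} \<rightarrow>\<^sub>E E.layer m" using y(3) m by (rule PiE_mem)
        then show ?thesis using VU[OF m k(1)] k by auto
      qed
      then obtain f where f: "f \<in> carrier H" "\<And>m u. (m, u) \<in> O.idx \<Longrightarrow> F.dft f (O.rep m u) = V m u"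
        using hopf_alg_interpolation[of V] by blast
      have "(\<lambda>i\<in>{..<p ^ e}. F.dft f (O.rep 0 i)) = y0"
        using y(2) f(2)[OF idx0] by (intro extensionalityI[of _ "{..<p ^ e}"]) (auto simp: V_def PiE_iff)
      moreover have "(\<lambda>m\<in>?J. \<lambda>k\<in>{..<c}. F.dft f (O.rep m (U k))) = y1"
      proof (rule extensionalityI[of _ ?J])
        fix m assume m: "m \<in> ?J"
        have y1m: "y1 m \<in> {..<c} \<rightarrow>\<^sub>E E.layer m" using y(3) m by (rule PiE_mem)
        have "(\<lambda>k\<in>{..<c}. F.dft f (O.rep m (U k))) = y1 m"
          using y1m f(2)[OF idx1[OF m]] VU[OF m]
          by (intro extensionalityI[of _ "{..<c}"]) (auto simp: PiE_iff)
        then show "(\<lambda>m\<in>?J. \<lambda>k\<in>{..<c}. F.dft f (O.rep m (U k))) m = y1 m" using m by simp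
      qed (use y(3) in \<open>auto simp: PiE_iff\<close>)
      ultimately have "y = h f" by (simp add: h_def y(1))
      then show "\<exists>f\<in>carrier H. y = h f" using f(1) by blast
    qed
  next
    fix f g assume fg: "f \<in> carrier H" "g \<in> carrier H"
    note fg' = fg[THEN hopf_alg_group_alg]
    have "f \<oplus>\<^bsub>A\<^esub> g \<in> carrier A" using fg' by (auto simp: group_alg_def)
    then have "f \<oplus>\<^bsub>A\<^esub> g \<in> carrier H"
      using fg by (simp add: carrier_hopf_alg F.dft_add ring_hom_add[OF E.hom] F.dft_closed)
    then show "f \<oplus>\<^bsub>H\<^esub> g \<in> carrier H \<and> h (f \<oplus>\<^bsub>H\<^esub> g) = h f \<oplus>\<^bsub>alg_times ?B0 (alg_prod ?J ?B1)\<^esub> h g"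
      by (simp add: hopf_alg_ops) (simp add: h_simps F.dft_add fg')
    have "f \<otimes>\<^bsub>A\<^esub> g \<in> carrier H"
      using fg F.group_alg_mult_closed[OF fg']
      by (simp add: carrier_hopf_alg F.dft_mult ring_hom_mult[OF E.hom] F.dft_closed)
    then show "f \<otimes>\<^bsub>H\<^esub> g \<in> carrier H \<and> h (f \<otimes>\<^bsub>H\<^esub> g) = h f \<otimes>\<^bsub>alg_times ?B0 (alg_prod ?J ?B1)\<^esub> h g"
      by (simp add: hopf_alg_ops) (simp add: h_simps F.dft_mult fg')
  next
    have "\<sigma> \<zero>\<^bsub>L\<^esub> = \<zero>\<^bsub>L\<^esub>" using ring_hom_zero[OF E.hom] E.ring_axioms by blast
    then have "\<zero>\<^bsub>A\<^esub> \<in> carrier H"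
      by (auto simp: carrier_hopf_alg F.dft_zero) (auto simp: group_alg_def)
    then show "\<zero>\<^bsub>H\<^esub> \<in> carrier H" "h \<zero>\<^bsub>H\<^esub> = \<zero>\<^bsub>alg_times ?B0 (alg_prod ?J ?B1)\<^esub>"
      by (simp_all only: hopf_alg_ops) (simp add: h_simps F.dft_zero)
    have "\<one>\<^bsub>A\<^esub> \<in> carrier H"
      by (auto simp: carrier_hopf_alg F.dft_one ring_hom_one[OF E.hom]) (auto simp: group_alg_def)
    then show "\<one>\<^bsub>H\<^esub> \<in> carrier H" "h \<one>\<^bsub>H\<^esub> = \<one>\<^bsub>alg_times ?B0 (alg_prod ?J ?B1)\<^esub>"
      by (simp_all only: hopf_alg_ops) (simp add: h_simps F.dft_one)
  next
    fix k f assume k: "k \<in> carrier ?K" and f: "f \<in> carrier H"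
    note f' = hopf_alg_group_alg[OF f]
    have k': "k \<in> carrier L" "\<sigma> k = k" using k by (auto simp: E.fixed)
    have "k \<odot>\<^bsub>A\<^esub> f \<in> carrier A" using f' k' by (auto simp: group_alg_def)
    then have "k \<odot>\<^bsub>A\<^esub> f \<in> carrier H"
      using f k' by (simp add: carrier_hopf_alg F.dft_smult ring_hom_mult[OF E.hom] F.dft_closed)
    then show "k \<odot>\<^bsub>H\<^esub> f \<in> carrier H \<and> h (k \<odot>\<^bsub>H\<^esub> f) = k \<odot>\<^bsub>alg_times ?B0 (alg_prod ?J ?B1)\<^esub> h f"
      by (simp add: hopf_alg_ops) (simp add: h_simps F.dft_smult f' k')
  qed
qed

end

theorem theorem4p10:
  fixes p n r :: nat
    and L :: "('a, 'm) ring_scheme" and K :: "'a set" and \<sigma> :: "'a \<Rightarrow> 'a"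
    and N :: "('c, 'd) monoid_scheme" and \<eta> :: 'c and \<gamma> \<delta> :: "'c \<Rightarrow> 'c"
  assumes p: "Factorial_Ring.prime p" "odd p"
    and n: "1 \<le> n"
    and galois: "finite_galois L K" "ring.dimension L (p ^ n) K (carrier L)"
    and char: "char_zero (L\<lparr>carrier := K\<rparr>)"
    and root: "\<exists>\<zeta>. primitive_root_of_unity (L\<lparr>carrier := K\<rparr>) (p ^ n) \<zeta>"
    and G: "\<sigma> \<in> carrier (Gal L K)" "carrier (Gal L K) = generate (Gal L K) {\<sigma>}"
    and N: "group N" "order N = p ^ n" "\<eta> \<in> carrier N" "carrier N = generate N {\<eta>}"
    and \<gamma>: "\<gamma> \<in> carrier (AutoGroup N)" "carrier (AutoGroup N) = generate (AutoGroup N) {\<gamma>}"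
    and \<delta>: "\<delta> = \<gamma> [^]\<^bsub>AutoGroup N\<^esub> (p - 1)"
    and r: "r < p ^ (n - 1)"
  shows "alg_isomorphic (L\<lparr>carrier := K\<rparr>)
    (hopf_alg L (Gal L K) \<sigma> N \<eta> \<delta> r)
    (alg_times
      (alg_power (field_alg L K) (p ^ (1 + val p n r)))
      (alg_prod {1..n - 1 - val p n r}
        (\<lambda>m. alg_power (field_alg L (intermediate_field L K (p ^ m)))
               (p ^ val p n r * (p - 1)))))"
proof -
  let ?q = "p ^ n" and ?e = "1 + val p n r"
  define e where "e = ?e"
  have q: "0 < ?q" using p(1) by (simp add: prime_gt_0_nat)
  interpret E: cyclic_extension L K \<sigma> p n by (rule cyclic_galois(1)[OF p(1) galois G])
  interpret G: cyclic_gen "Gal L K" \<sigma> ?q by (rule cyclic_galois(2)[OF p(1) galois G])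
  interpret N: group N by (rule N(1))
  have "N.ord \<eta> = ?q"
    using N.generate_pow_card[OF N(3)] N(2,4) by (simp add: order_def)
  then interpret N: cyclic_gen N \<eta> ?q
    using N.cyclic_genI[OF N(3,4)] q by simp
  interpret A: group "AutoGroup N" by (rule N.AutoGroup)
  obtain g a where g: "\<gamma> \<eta> = \<eta> [^]\<^bsub>N\<^esub> g" "g ^ (p - 1) = 1 + p * a" "2 \<le> n \<Longrightarrow> \<not> p dvd a"
    using N.AutoGroup_generator[OF refl p n \<gamma>] by blast
  \<comment> \<open>\<delta> is the power of \<gamma> with exponent \<open>p - 1\<close>, so its
    \<open>r\<close>-th power raises \<eta> to this exponent.\<close>
  define d where "d = g ^ ((p - 1) * r)"
  have \<delta>r: "\<delta> [^]\<^bsub>AutoGroup N\<^esub> r = \<gamma> [^]\<^bsub>AutoGroup N\<^esub> ((p - 1) * r)"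
    unfolding \<delta> by (rule A.nat_pow_pow[OF \<gamma>(1)])
  have d1: "[d = 1] (mod p)" "0 < d"
  proof -
    have "[1 + p * a = 1] (mod p)" by (simp only: cong_one_plus_iff) simp
    then have "[(1 + p * a) ^ r = 1 ^ r] (mod p)" by (rule cong_pow)
    moreover have "d = (1 + p * a) ^ r" unfolding d_def power_mult g(2) ..
    ultimately show "[d = 1] (mod p)" "0 < d" by simp_all
  qed
  interpret R: regular_embedding N \<eta> ?q "Gal L K" \<sigma> \<delta> r d
  proof
    show "\<delta> [^]\<^bsub>AutoGroup N\<^esub> r \<in> carrier (AutoGroup N)" using \<gamma>(1) by (simp add: \<delta>r)
    show "(\<delta> [^]\<^bsub>AutoGroup N\<^esub> r) \<eta> = \<eta> [^]\<^bsub>N\<^esub> d"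
      unfolding \<delta>r d_def by (rule N.AutoGroup_pow_apply[OF \<gamma>(1) g(1)])
    show "?q dvd (\<Sum>i<k. d ^ i) \<longleftrightarrow> ?q dvd k" for k
      by (rule prime_power_dvd_geometric_sum_iff[OF p d1(2,1)])
  qed
  have e: "0 < e" "e \<le> n" using val_less[OF p(1) n r] by (simp_all add: e_def)
  have order: "[(d ^ (?q - 1)) ^ k = 1] (mod p ^ (e + m)) \<longleftrightarrow> p ^ m dvd k" if m: "m \<le> n - e" for k m
  proof -
    have "[(d ^ (?q - 1)) ^ k = 1] (mod p ^ (e + m)) \<longleftrightarrow> p ^ m dvd (?q - 1) * k"
      unfolding e_def d_def power_mult[of "g ^ ((p - 1) * r)", symmetric]
      by (rule multiplier_power_cong_one_iff[OF p r g(2,3)]) (use m in \<open>simp_all add: e_def\<close>)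
    \<comment> \<open>Replacing \<open>d\<close> by its inverse \<open>D\<close> does not change
      orders, as \<open>p ^ n - 1\<close> is prime to \<open>p\<close>.\<close>
    also have "\<dots> \<longleftrightarrow> p ^ m dvd k"
    proof -
      have "coprime ?q (?q - 1)" using q by (metis Suc_diff_1 coprime_Suc_left_nat)
      then have "coprime (p ^ m) (?q - 1)" using n by (simp add: coprime_power_left_iff)
      then show ?thesis by (simp add: coprime_dvd_mult_right_iff)
    qed
    finally show ?thesis .
  qed
  interpret O: orbit_transversal p n e "d ^ (?q - 1)"
    by unfold_locales (use p(1) e order in auto)
  obtain \<zeta> where \<zeta>: "primitive_root_of_unity (L\<lparr>carrier := K\<rparr>) ?q \<zeta>" using root by blast
  have pow: "x [^]\<^bsub>L\<lparr>carrier := K\<rparr>\<^esub> (k::nat) = x [^]\<^bsub>L\<^esub> k" for x k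
    by (rule E.nat_pow_consistent[symmetric])
  have \<zeta>K: "\<zeta> \<in> K" "\<zeta> [^]\<^bsub>L\<^esub> ?q = \<one>\<^bsub>L\<^esub>"
    "\<And>j::nat. 0 < j \<Longrightarrow> j < ?q \<Longrightarrow> \<zeta> [^]\<^bsub>L\<^esub> j \<noteq> \<one>\<^bsub>L\<^esub>"
    using \<zeta> by (auto simp: primitive_root_of_unity_def pow)
  then have \<zeta>L: "\<zeta> \<in> carrier L" by (simp add: E.fixed)
  \<comment> \<open>The definition of a primitive root only excludes positive exponents below
    \<open>p ^ n\<close>; division with remainder reduces any exponent to these.\<close>
  have \<zeta>_one: "\<zeta> [^]\<^bsub>L\<^esub> j = \<one>\<^bsub>L\<^esub> \<longleftrightarrow> ?q dvd j" for j :: nat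
  proof -
    have "\<zeta> [^]\<^bsub>L\<^esub> (?q * (j div ?q) + j mod ?q) = (\<zeta> [^]\<^bsub>L\<^esub> ?q) [^]\<^bsub>L\<^esub> (j div ?q) \<otimes>\<^bsub>L\<^esub> \<zeta> [^]\<^bsub>L\<^esub> (j mod ?q)"
      using \<zeta>L by (simp only: E.nat_pow_mult E.nat_pow_pow)
    then have "\<zeta> [^]\<^bsub>L\<^esub> j = \<zeta> [^]\<^bsub>L\<^esub> (j mod ?q)" using \<zeta>L \<zeta>K(2) by simp
    then show ?thesis
      using \<zeta>K(3)[of "j mod ?q"] q by (cases "j mod ?q = 0") (auto simp: dvd_eq_mod_eq_0)
  qed
  have "[(?q)] \<cdot>\<^bsub>L\<^esub> \<one>\<^bsub>L\<^esub> \<noteq> \<zero>\<^bsub>L\<^esub>"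
  proof -
    have "[(?q)] \<cdot>\<^bsub>L\<lparr>carrier := K\<rparr>\<^esub> \<one>\<^bsub>L\<lparr>carrier := K\<rparr>\<^esub> \<noteq> \<zero>\<^bsub>L\<lparr>carrier := K\<rparr>\<^esub>"
      using char q unfolding char_zero_def by blast
    then show ?thesis by (simp add: add_pow_def nat_pow_def)
  qed
  then interpret hopf_descent L K \<sigma> p n N \<eta> \<delta> r d e \<zeta>
    by unfold_locales (use \<zeta>K(1) \<zeta>_one in auto)
  have "alg_prod {1..n - e} (\<lambda>m. alg_power (field_alg L (E.layer m)) (p ^ (e - 1) * (p - 1)))
      = alg_prod {1..n - 1 - val p n r} (\<lambda>m. alg_power (field_alg L (intermediate_field L K (p ^ m)))
          (p ^ val p n r * (p - 1)))"
  proof -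
    have "alg_power (field_alg L (E.layer m)) (p ^ (e - 1) * (p - 1))
        = alg_power (field_alg L (intermediate_field L K (p ^ m))) (p ^ val p n r * (p - 1))"
      if "m \<in> {1..n - e}" for m
    proof -
      have "m \<le> n" using that by auto
      then show ?thesis by (simp add: e_def E.intermediate_field_eq_layer)
    qed
    from alg_prod_cong[of "{1..n - e}", OF this] show ?thesis by (simp add: e_def)
  qed
  with hopf_alg_isomorphic show ?thesis by (simp add: e_def)
qed

end
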